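(* Let $\Gamma=\langle A,S\rangle$ be the subgroup of $G_2$ generated by $A$ and $S$. Then $\Gamma$ is dense in $G_2$: $\overline{\langle A,S\rangle}=G_2$. For every nonzero $U\in\mathfrak g_2$, the real span of $\{wUw^{-1}:w\in\Gamma\}$ is $\mathfrak g_2$. In particular, there are $w_1,\dots,w_{14}\in\Gamma$ such that the map $\mathbb R^{14}\to G_2$, $(t_1,\dots,t_{14})\mapsto\prod_{j=1}^{14}w_je^{t_jX}w_j^{-1}$, has invertible differential at the origin.
   Context: Octonions: $\mathbb O$ has real basis $1,e_1,\dots,e_7$ with $1$ the identity, $e_i^2=-1$, and multiplication given by the oriented triples $(123),(145),(176),(246),(257),(347),(365)$: for a triple $(abc)$, $e_ae_b=e_c$, $e_be_c=e_a$, $e_ce_a=e_b$, and reversing the order changes the sign. $G_2=\operatorname{Aut}(\mathbb O)$, $\mathfrak g_2=\operatorname{Der}(\mathbb O)$, identified with their faithful actions on $V=\operatorname{Im}\mathbb O$. $D_{ij}=D_{e_i,e_j}\in\mathfrak g_2$ with $D_{a,b}(x)=[[a,b],x]-3[a,b,x]$, where $[a,b]=ab-ba$ and $[a,b,x]=(ab)x-a(bx)$. $S\in G_2$ is the involution $S(e_1)=e_1$, $e_2\leftrightarrow e_4$, $e_3\leftrightarrow e_5$, $S(e_6)=-e_6$, $S(e_7)=-e_7$. $X=D_{46}+D_{47}$ and $A=e^{\pi X/(8\sqrt2)}\in G_2$. *)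

theory Defs
  imports "HOL-Analysis.Analysis" "HOL-Algebra.Generated_Groups"
begin

text \<open>
  An octonion is a pair (real part, imaginary part). The imaginary units are
  \<open>e\<^sub>1, \<dots>, e\<^sub>7\<close>; note that in the numeral type \<open>7\<close> the index \<open>7\<close> is the
  element \<open>0\<close>, so that \<open>1, \<dots>, 7\<close> are exactly its seven distinct elements.
\<close>

type_synonym octonion = "real \<times> (real ^ 7)"

definition oct_triples :: "(7 \<times> 7 \<times> 7) set" where
  "oct_triples = {(1,2,3), (1,4,5), (1,7,6), (2,4,6), (2,5,7), (3,4,7), (3,6,5)}"

text \<open>The coefficient of \<open>e\<^sub>k\<close> in \<open>e\<^sub>i e\<^sub>j\<close>.\<close>

definition oct_coeff :: "7 \<Rightarrow> 7 \<Rightarrow> 7 \<Rightarrow> real" where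
  "oct_coeff i j k =
     (if {(i,j,k), (j,k,i), (k,i,j)} \<inter> oct_triples \<noteq> {} then 1
      else if {(j,i,k), (i,k,j), (k,j,i)} \<inter> oct_triples \<noteq> {} then -1
      else 0)"

text \<open>
  The bilinear extension of \<open>e\<^sub>i\<^sup>2 = -1\<close> and the products given by the triples, with
  \<open>(1, 0)\<close> as identity.
\<close>

definition oct_mult :: "octonion \<Rightarrow> octonion \<Rightarrow> octonion"  (infixl "*\<^sub>O" 70) where
  "x *\<^sub>O y =
     (fst x * fst y - snd x \<bullet> snd y,
      fst x *\<^sub>R snd y + fst y *\<^sub>R snd x
        + (\<chi> k. \<Sum>i\<in>UNIV. \<Sum>j\<in>UNIV. oct_coeff i j k * snd x $ i * snd y $ j))"

abbreviation im_unit :: "7 \<Rightarrow> real ^ 7" where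
  "im_unit i \<equiv> axis i 1"

definition oct_unit :: "7 \<Rightarrow> octonion" where
  "oct_unit i = (0, im_unit i)"

definition oct_commutator :: "octonion \<Rightarrow> octonion \<Rightarrow> octonion" where
  "oct_commutator a b = a *\<^sub>O b - b *\<^sub>O a"

definition oct_associator :: "octonion \<Rightarrow> octonion \<Rightarrow> octonion \<Rightarrow> octonion" where
  "oct_associator a b x = (a *\<^sub>O b) *\<^sub>O x - a *\<^sub>O (b *\<^sub>O x)"

definition oct_aut :: "(octonion \<Rightarrow> octonion) set" where
  "oct_aut = {g. linear g \<and> bij g \<and> (\<forall>x y. g (x *\<^sub>O y) = g x *\<^sub>O g y)}"

definition oct_der :: "(octonion \<Rightarrow> octonion) set" where
  "oct_der = {d. linear d \<and> (\<forall>x y. d (x *\<^sub>O y) = d x *\<^sub>O y + x *\<^sub>O d y)}"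

text \<open>
  Automorphisms and derivations of the octonions preserve the imaginary octonions, and are
  identified with the matrices of their restrictions to them.
\<close>

definition im_matrix :: "(octonion \<Rightarrow> octonion) \<Rightarrow> real ^ 7 ^ 7" where
  "im_matrix g = matrix (\<lambda>v. snd (g (0, v)))"

definition G2 :: "(real ^ 7 ^ 7) set" where
  "G2 = im_matrix ` oct_aut"

definition g2 :: "(real ^ 7 ^ 7) set" where
  "g2 = im_matrix ` oct_der"

definition G2_group :: "(real ^ 7 ^ 7) monoid" where
  "G2_group = \<lparr>carrier = G2, mult = (**), one = mat 1\<rparr>"

definition inner_der :: "octonion \<Rightarrow> octonion \<Rightarrow> octonion \<Rightarrow> octonion" where
  "inner_der a b x =
     oct_commutator (oct_commutator a b) x - 3 *\<^sub>R oct_associator a b x"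

definition D_matrix :: "7 \<Rightarrow> 7 \<Rightarrow> real ^ 7 ^ 7" where
  "D_matrix i j = im_matrix (inner_der (oct_unit i) (oct_unit j))"

text \<open>
  The library's \<open>exp\<close> is not available for matrices, since multiplication in the type of
  vectors (and hence of matrices) is componentwise.
\<close>

definition mat_exp :: "real ^ 'n ^ 'n \<Rightarrow> real ^ 'n ^ 'n" where
  "mat_exp M = (\<Sum>k. (1 / fact k) *\<^sub>R (((**) M ^^ k) (mat 1)))"

definition S_mat :: "real ^ 7 ^ 7" where
  "S_mat = matrix (\<lambda>v. v $ 1 *\<^sub>R im_unit 1
     + v $ 2 *\<^sub>R im_unit 4 + v $ 4 *\<^sub>R im_unit 2
     + v $ 3 *\<^sub>R im_unit 5 + v $ 5 *\<^sub>R im_unit 3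
     - v $ 6 *\<^sub>R im_unit 6 - v $ 7 *\<^sub>R im_unit 7)"

definition X_mat :: "real ^ 7 ^ 7" where
  "X_mat = D_matrix 4 6 + D_matrix 4 7"

definition A_mat :: "real ^ 7 ^ 7" where
  "A_mat = mat_exp ((pi / (8 * sqrt 2)) *\<^sub>R X_mat)"

definition Gamma_AS :: "(real ^ 7 ^ 7) set" where
  "Gamma_AS = generate G2_group {A_mat, S_mat}"

text \<open>
  The ordered product \<open>\<Prod>\<^sub>j w\<^sub>j exp (t\<^sub>j X) w\<^sub>j\<inverse>\<close> for \<open>j = 1, \<dots>, 14\<close>, from left to right.
  As above, \<open>of_nat 14\<close> is the element \<open>0\<close> of the index type \<open>14\<close>.
\<close>

definition conj_exp_prod :: "(nat \<Rightarrow> real ^ 7 ^ 7) \<Rightarrow> real ^ 14 \<Rightarrow> real ^ 7 ^ 7" where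
  "conj_exp_prod w t =
     foldr (\<lambda>j P. (w j ** mat_exp ((t $ of_nat j) *\<^sub>R X_mat) ** matrix_inv (w j)) ** P)
       [1..<15] (mat 1)"

text \<open>
  Velocity vectors at \<open>p\<close> of curves in \<open>M\<close>; for an embedded submanifold \<open>M\<close> of a
  Euclidean space, such as \<open>G2\<close>, this is its tangent space at \<open>p\<close>.
\<close>

definition tangent_space :: "'a::real_normed_vector set \<Rightarrow> 'a \<Rightarrow> 'a set" where
  "tangent_space M p =
     {v. \<exists>\<gamma>::real \<Rightarrow> 'a. range \<gamma> \<subseteq> M \<and> \<gamma> 0 = p \<and> (\<gamma> has_vector_derivative v) (at 0)}"

text \<open>
  \<open>F\<close> maps into \<open>M\<close> and its differential at \<open>x\<close> is an isomorphism onto the tangent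
  space of \<open>M\<close> at \<open>F x\<close>.
\<close>

definition invertible_differential_at ::
  "('a::real_normed_vector \<Rightarrow> 'b::real_normed_vector) \<Rightarrow> 'b set \<Rightarrow> 'a \<Rightarrow> bool" where
  "invertible_differential_at F M x \<longleftrightarrow>
     range F \<subseteq> M \<and>
     (\<exists>F'. (F has_derivative F') (at x) \<and> bij_betw F' UNIV (tangent_space M (F x)))"

end

theory Submission
  imports Defs
begin

text \<open>
  The generator \<open>A\<close> has order 8, and conjugation by it has on \<open>g2\<close> an eigenspace for \<open>\<plusminus>\<i>\<close> that is a
  single plane. The projection onto this plane lies in the group algebra, so an invariant subspace of
  \<open>g2\<close> or its orthogonal complement contains the plane; as the conjugates of the plane span \<open>g2\<close>, the
  adjoint action of the generated group is irreducible. The group is infinite because a certain word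
  in the generators is a rational matrix whose powers have unbounded powers of 2 in the denominators.
  Hence its closure contains elements arbitrarily close to the identity, and a limit of secants is a
  nonzero element of the Lie algebra of the closure. By irreducibility this Lie algebra is \<open>g2\<close>, and
  the one-parameter subgroups generate \<open>G2\<close>: plane rotations in them carry the images of
  \<open>e\<^sub>1, e\<^sub>2, e\<^sub>4\<close> under any automorphism back to \<open>e\<^sub>1, e\<^sub>2, e\<^sub>4\<close>, which generate the octonions.
\<close>

subsection \<open>The index type with seven elements\<close>

text \<open>On the imaginary octonions X turns planes at the speeds 1, 1, 2 in units of 2 sqrt 2,
  and the time in A makes the unit an angle of pi/4. These are the values of the positive short
  roots; the long roots take the values 0, 3, 3. So conjugation by A has the eigenvalues exp(k i
  pi/4) with |k| at most 3, and only k = 2 and k = -2 come from a single root: this is the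
  distinguished plane. Irreducibility alone does not exclude a finite group, hence the search for an
  element of infinite order; it is a word in which all irrational entries cancel, so that
  divisibility by 2 makes sense. Connectedness of \<open>G2\<close> is not presupposed. The
  exponentials act transitively on the unit vectors, then on those orthogonal to e1 with e1 fixed,
  then on those orthogonal to e1, e2, e3 with e1, e2 fixed. The two remaining claims also rest on
  irreducibility: the conjugates of U span an invariant subspace, and fourteen conjugates of X
  forming a basis of \<open>g2\<close> are the partial derivatives of the product map at the
  origin.\<close>

lemma exhaust_7:
  fixes x :: 7
  shows "x = 1 \<or> x = 2 \<or> x = 3 \<or> x = 4 \<or> x = 5 \<or> x = 6 \<or> x = 7"
proof (induct x)
  case (of_int z)
  then have "0 \<le> z" "z < 7" by simp_all
  then have "z = 0 \<or> z = 1 \<or> z = 2 \<or> z = 3 \<or> z = 4 \<or> z = 5 \<or> z = 6" by presburger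
  then show ?case by (elim disjE) simp_all
qed

lemma forall_7: "(\<forall>i::7. P i) \<longleftrightarrow> P 1 \<and> P 2 \<and> P 3 \<and> P 4 \<and> P 5 \<and> P 6 \<and> P 7"
proof (intro iffI allI)
  fix i
  assume "P 1 \<and> P 2 \<and> P 3 \<and> P 4 \<and> P 5 \<and> P 6 \<and> P 7"
  then show "P i" using exhaust_7[of i] by (elim conjE disjE) simp_all
qed simp

lemma UNIV_7: "UNIV = {1, 2, 3, 4, 5, 6, 7::7}"
  by (simp add: set_eq_iff exhaust_7)

lemma sum_7: "sum f (UNIV::7 set) = f 1 + f 2 + f 3 + f 4 + f 5 + f 6 + f 7"
  unfolding UNIV_7 by (simp add: ac_simps)

subsection \<open>The matrix exponential\<close>

lemma matrix_add_rdistrib: "(A + B) ** C = A ** C + B ** (C :: 'a::semiring_1^'n^'m)"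
  by (simp add: matrix_matrix_mult_def vec_eq_iff sum.distrib distrib_right)

lemma bounded_bilinear_matrix_mult:
  "bounded_bilinear ((**) :: real^'n^'m \<Rightarrow> real^'p^'n \<Rightarrow> real^'p^'m)"
  by (simp add: bilinear_conv_bounded_bilinear[symmetric] bilinear_def linear_iff
      matrix_add_ldistrib matrix_add_rdistrib matrix_scalar_ac flip: scalar_matrix_assoc)

lemma bounded_bilinear_matrix_vector_mult:
  "bounded_bilinear ((*v) :: real^'n^'m \<Rightarrow> real^'n \<Rightarrow> real^'m)"
  by (simp add: bilinear_conv_bounded_bilinear[symmetric] bilinear_def linear_iff
      matrix_vector_right_distrib matrix_vector_mult_add_rdistrib matrix_vector_mult_scaleR
      flip: scaleR_matrix_vector_assoc)

lemmas matrix_mult_minus_left = bounded_bilinear.minus_left[OF bounded_bilinear_matrix_mult]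
lemmas matrix_mult_minus_right = bounded_bilinear.minus_right[OF bounded_bilinear_matrix_mult]
lemmas matrix_mult_diff_left = bounded_bilinear.diff_left[OF bounded_bilinear_matrix_mult]
lemmas matrix_mult_diff_right = bounded_bilinear.diff_right[OF bounded_bilinear_matrix_mult]
lemmas matrix_vector_mult_minus_left =
  bounded_bilinear.minus_left[OF bounded_bilinear_matrix_vector_mult]
lemmas tendsto_matrix_mult [tendsto_intros] =
  bounded_bilinear.tendsto[OF bounded_bilinear_matrix_mult]
lemmas tendsto_matrix_vector_mult [tendsto_intros] =
  bounded_bilinear.tendsto[OF bounded_bilinear_matrix_vector_mult]

lemma has_vector_derivative_vecI:
  fixes f :: "real \<Rightarrow> 'a::euclidean_space^'n"
  assumes "\<And>i. ((\<lambda>t. f t $ i) has_vector_derivative f' $ i) (at x within S)"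
  shows "(f has_vector_derivative f') (at x within S)"
proof -
  have "((\<lambda>y. (1 / norm (y - x)) *\<^sub>R (f y - (f x + (y - x) *\<^sub>R f'))) \<longlongrightarrow> 0) (at x within S)"
    using assms unfolding has_vector_derivative_def has_derivative_within
    by (intro vec_tendstoI) (simp add: algebra_simps divide_inverse)
  then show ?thesis
    by (simp add: has_vector_derivative_def has_derivative_within bounded_linear_scaleR_left)
qed

abbreviation mat_power :: "real^'n^'n \<Rightarrow> nat \<Rightarrow> real^'n^'n" where
  "mat_power M k \<equiv> ((**) M ^^ k) (mat 1)"

lemma mat_power_scaleR: "mat_power (t *\<^sub>R M) k = t ^ k *\<^sub>R mat_power M k"
  by (induction k) (simp_all add: matrix_scalar_ac flip: scalar_matrix_assoc)

lemma mat_power_add: "mat_power M (k + l) = mat_power M k ** mat_power M l"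
  by (induction k) (simp_all add: matrix_mul_assoc)

lemma mat_power_entry_bound:
  fixes M :: "real^'n^'n"
  shows "\<bar>mat_power M k $ i $ j\<bar> \<le> (real CARD('n) * norm M) ^ k"
proof (induction k arbitrary: i j)
  case 0
  then show ?case by (simp add: mat_def)
next
  case (Suc k)
  have "\<bar>mat_power M (Suc k) $ i $ j\<bar> \<le> (\<Sum>l\<in>UNIV. \<bar>M $ i $ l * mat_power M k $ l $ j\<bar>)"
    by (simp add: matrix_matrix_mult_def sum_abs)
  also have "\<dots> \<le> (\<Sum>l\<in>(UNIV::'n set). norm M * (real CARD('n) * norm M) ^ k)"
  proof (intro sum_mono)
    fix l
    have "\<bar>M $ i $ l\<bar> \<le> norm M"
      by (rule order_trans[OF component_le_norm_cart Finite_Cartesian_Product.norm_nth_le])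
    then show "\<bar>M $ i $ l * mat_power M k $ l $ j\<bar> \<le> norm M * (real CARD('n) * norm M) ^ k"
      unfolding abs_mult using Suc by (intro mult_mono) auto
  qed
  finally show ?case by (simp add: algebra_simps)
qed

lemma summable_mat_exp_entry:
  fixes M :: "real^'n^'n"
  shows "summable (\<lambda>k. mat_power M k $ i $ j / fact k * t ^ k)"
proof (rule summable_comparison_test')
  fix k :: nat
  assume "0 \<le> k"
  have "\<bar>mat_power M k $ i $ j\<bar> * (\<bar>t\<bar> ^ k / fact k)
      \<le> (real CARD('n) * norm M) ^ k * (\<bar>t\<bar> ^ k / fact k)"
    by (intro mult_right_mono mat_power_entry_bound) auto
  then show "norm (mat_power M k $ i $ j / fact k * t ^ k)
      \<le> inverse (fact k) * (real CARD('n) * norm M * \<bar>t\<bar>) ^ k"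
    by (simp add: abs_mult power_mult_distrib power_abs divide_inverse ac_simps)
qed (rule summable_exp)

lemma mat_exp_sums_entry:
  fixes M :: "real^'n^'n"
  shows "(\<lambda>k. (1 / fact k) *\<^sub>R mat_power (t *\<^sub>R M) k) sums
    (\<chi> i j. \<Sum>k. mat_power M k $ i $ j / fact k * t ^ k)"
  unfolding sums_def
proof (intro vec_tendstoI)
  fix i j
  have "(\<lambda>k. mat_power M k $ i $ j / fact k * t ^ k) sums
      (\<Sum>k. mat_power M k $ i $ j / fact k * t ^ k)"
    using summable_mat_exp_entry by (rule summable_sums)
  then show "(\<lambda>n. (\<Sum>k<n. (1 / fact k) *\<^sub>R mat_power (t *\<^sub>R M) k) $ i $ j) \<longlonglongrightarrow>
      (\<chi> i j. \<Sum>k. mat_power M k $ i $ j / fact k * t ^ k) $ i $ j"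
    by (simp add: sums_def mat_power_scaleR mult.commute)
qed

lemma mat_exp_entry:
  fixes M :: "real^'n^'n"
  shows "mat_exp (t *\<^sub>R M) $ i $ j = (\<Sum>k. mat_power M k $ i $ j / fact k * t ^ k)"
  using mat_exp_sums_entry[of t M] by (simp add: mat_exp_def sums_iff)

lemma mat_exp_sums: "(\<lambda>k. (1 / fact k) *\<^sub>R mat_power M k) sums mat_exp M"
  using mat_exp_sums_entry[of 1 M] by (simp add: mat_exp_def sums_iff)

text \<open>Every entry is an everywhere convergent power series in t. Termwise differentiation
  shifts its coefficients, and by the recursion for powers the shifted coefficients are
  \<open>M\<close> times the original ones.\<close>

lemma mat_exp_has_vector_derivative:
  "((\<lambda>t. mat_exp (t *\<^sub>R M)) has_vector_derivative M ** mat_exp (t *\<^sub>R M)) (at t)"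
proof (intro has_vector_derivative_vecI)
  fix i j
  define c where "c = (\<lambda>l k. mat_power M k $ l $ j / fact k)"
  have summable: "summable (\<lambda>k. c l k * y ^ k)" for l y
    unfolding c_def by (rule summable_mat_exp_entry)
  have "diffs (c i) k = (\<Sum>l\<in>UNIV. M $ i $ l * c l k)" for k
    by (simp add: diffs_def c_def matrix_matrix_mult_def sum_divide_distrib sum_distrib_left
      divide_simps del: of_nat_Suc)
  then have "(\<Sum>k. diffs (c i) k * t ^ k) = (\<Sum>k. \<Sum>l\<in>UNIV. M $ i $ l * (c l k * t ^ k))"
    by (simp add: sum_distrib_right mult.assoc)
  also have "\<dots> = (\<Sum>l\<in>UNIV. \<Sum>k. M $ i $ l * (c l k * t ^ k))"
    by (intro suminf_sum summable_mult summable)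
  also have "\<dots> = (\<Sum>l\<in>UNIV. M $ i $ l * (\<Sum>k. c l k * t ^ k))"
    by (simp add: suminf_mult summable)
  finally have "(\<Sum>k. diffs (c i) k * t ^ k) = (M ** mat_exp (t *\<^sub>R M)) $ i $ j"
    by (simp add: matrix_matrix_mult_def mat_exp_entry c_def)
  with termdiffs_strong_converges_everywhere[OF summable, of i t]
  have "((\<lambda>t. \<Sum>k. c i k * t ^ k) has_vector_derivative (M ** mat_exp (t *\<^sub>R M)) $ i $ j) (at t)"
    by (simp only: has_real_derivative_iff_has_vector_derivative)
  then show "((\<lambda>t. mat_exp (t *\<^sub>R M) $ i $ j) has_vector_derivative
      (M ** mat_exp (t *\<^sub>R M)) $ i $ j) (at t)"
    by (simp only: mat_exp_entry c_def)
qed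

lemma mat_exp_0 [simp]: "mat_exp 0 = (mat 1 :: real^'n^'n)"
proof -
  have "mat_exp (0 *\<^sub>R M) $ i $ j = mat 1 $ i $ j" for M :: "real^'n^'n" and i j
    unfolding mat_exp_entry using powser_zero[of "\<lambda>k. mat_power M k $ i $ j / fact k"] by simp
  then show ?thesis unfolding vec_eq_iff by simp
qed

lemma zero_derivative_imp_eq:
  fixes f :: "real \<Rightarrow> 'a::real_normed_vector"
  assumes "\<And>t. (f has_vector_derivative 0) (at t)"
  shows "f s = f t"
  using has_vector_derivative_zero_constant[OF convex_UNIV, of f] assms by (metis UNIV_I)

lemma mat_exp_commute: "M ** mat_exp M = mat_exp M ** M"
proof -
  have "mat_power M k ** M = M ** mat_power M k" for k
    using mat_power_add[of k 1 M] mat_power_add[of 1 k M] by (simp add: add.commute)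
  then have "(\<lambda>k. M ** ((1 / fact k) *\<^sub>R mat_power M k)) sums (mat_exp M ** M)"
    using bounded_linear.sums[OF bounded_bilinear.bounded_linear_left[OF bounded_bilinear_matrix_mult]
        mat_exp_sums, of M M]
    by (simp add: matrix_scalar_ac flip: scalar_matrix_assoc)
  moreover have "(\<lambda>k. M ** ((1 / fact k) *\<^sub>R mat_power M k)) sums (M ** mat_exp M)"
    by (rule bounded_linear.sums[OF bounded_bilinear.bounded_linear_right[OF bounded_bilinear_matrix_mult]
        mat_exp_sums])
  ultimately show ?thesis by (rule sums_unique2[symmetric])
qed

lemma mat_exp_scaleR_commute: "M ** mat_exp (t *\<^sub>R M) = mat_exp (t *\<^sub>R M) ** M"
proof (cases "t = 0")
  case False
  have "t *\<^sub>R (M ** mat_exp (t *\<^sub>R M)) = t *\<^sub>R (mat_exp (t *\<^sub>R M) ** M)"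
    using mat_exp_commute[of "t *\<^sub>R M"]
    by (simp add: matrix_scalar_ac flip: scalar_matrix_assoc)
  with False show ?thesis by simp
qed simp

lemma mat_exp_minus_has_vector_derivative:
  "((\<lambda>t. mat_exp (- t *\<^sub>R M)) has_vector_derivative - (mat_exp (- t *\<^sub>R M) ** M)) (at t)"
  using mat_exp_has_vector_derivative[of "- M" t] mat_exp_scaleR_commute[of "- M" t]
  by (simp add: matrix_mult_minus_left matrix_mult_minus_right)

lemma mat_exp_minus_mult: "mat_exp (- t *\<^sub>R M) ** mat_exp (t *\<^sub>R M) = mat 1"
proof -
  define f where "f = (\<lambda>t. mat_exp (- t *\<^sub>R M) ** mat_exp (t *\<^sub>R M))"
  have "(f has_vector_derivative 0) (at t)" for t
    unfolding f_def
    using bounded_bilinear.has_vector_derivative[OF bounded_bilinear_matrix_mult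
        mat_exp_minus_has_vector_derivative[of M t] mat_exp_has_vector_derivative[of M t]]
    by (simp add: matrix_mul_assoc matrix_mult_minus_left)
  then have "f t = f 0" by (rule zero_derivative_imp_eq)
  then show ?thesis by (simp add: f_def)
qed

lemma mat_exp_mult_minus: "mat_exp (t *\<^sub>R M) ** mat_exp (- t *\<^sub>R M) = mat 1"
  using mat_exp_minus_mult[of "- t" M] by simp

text \<open>Multiplying a solution by the exponential at time -t gives a curve of derivative zero.
  This uniqueness principle and its matrix version identify exponentials below: a closed form only
  has to satisfy the equation and the initial value.\<close>

lemma mat_exp_ode_vector:
  assumes "\<And>t. (c has_vector_derivative M *v c t) (at t)"
  shows "c t = mat_exp (t *\<^sub>R M) *v c 0"
proof -
  define f where "f = (\<lambda>t. mat_exp (- t *\<^sub>R M) *v c t)"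
  have "(f has_vector_derivative 0) (at t)" for t
    unfolding f_def
    using bounded_bilinear.has_vector_derivative[OF bounded_bilinear_matrix_vector_mult
        mat_exp_minus_has_vector_derivative assms, of M t]
    by (simp add: matrix_vector_mul_assoc matrix_vector_mult_minus_left)
  then have "f t = f 0" by (rule zero_derivative_imp_eq)
  then have "mat_exp (t *\<^sub>R M) *v f t = mat_exp (t *\<^sub>R M) *v c 0" by (simp add: f_def)
  then show ?thesis
    by (simp add: f_def matrix_vector_mul_assoc mat_exp_mult_minus[simplified])
qed

lemma mat_exp_ode_matrix:
  fixes E :: "real \<Rightarrow> real^'n^'m"
  assumes "\<And>t. (E has_vector_derivative M ** E t) (at t)"
  shows "E t = mat_exp (t *\<^sub>R M) ** E 0"
proof -
  define f where "f = (\<lambda>t. mat_exp (- t *\<^sub>R M) ** E t)"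
  have "(f has_vector_derivative 0) (at t)" for t
    unfolding f_def
    using bounded_bilinear.has_vector_derivative[OF bounded_bilinear_matrix_mult
        mat_exp_minus_has_vector_derivative assms, of M t]
    by (simp add: matrix_mul_assoc matrix_mult_minus_left)
  then have "f t = f 0" by (rule zero_derivative_imp_eq)
  then have "mat_exp (t *\<^sub>R M) ** f t = mat_exp (t *\<^sub>R M) ** E 0" by (simp add: f_def)
  then show ?thesis
    by (simp add: f_def matrix_mul_assoc mat_exp_mult_minus[simplified])
qed

lemma mat_exp_add: "mat_exp ((s + t) *\<^sub>R M) = mat_exp (s *\<^sub>R M) ** mat_exp (t *\<^sub>R M)"
proof -
  have "((\<lambda>s. mat_exp ((s + t) *\<^sub>R M)) has_vector_derivative M ** mat_exp ((s + t) *\<^sub>R M)) (at s)" for s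
    using vector_diff_chain_at[of "\<lambda>s. s + t" 1 s, OF _ mat_exp_has_vector_derivative[of M]]
    by (simp add: o_def has_vector_derivative_add_const)
  from mat_exp_ode_matrix[of "\<lambda>s. mat_exp ((s + t) *\<^sub>R M)", OF this, of s] show ?thesis by simp
qed

lemma mat_exp_of_nat: "mat_exp (of_nat k *\<^sub>R M) = mat_power (mat_exp M) k"
proof (induction k)
  case (Suc k)
  then show ?case using mat_exp_add[of 1 "of_nat k" M] by simp
qed simp

lemma mat_exp_conj:
  fixes P :: "real^'n^'n"
  assumes "Q ** P = mat 1"
  shows "P ** mat_exp (t *\<^sub>R M) ** Q = mat_exp (t *\<^sub>R (P ** M ** Q))"
proof -
  have PQ: "P ** Q = mat 1" using assms by (simp add: matrix_left_right_inverse)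
  have "((\<lambda>t. P ** mat_exp (t *\<^sub>R M) ** Q) has_vector_derivative
      (P ** M ** Q) ** (P ** mat_exp (t *\<^sub>R M) ** Q)) (at t)" for t
  proof -
    have "((\<lambda>t. P ** mat_exp (t *\<^sub>R M) ** Q) has_vector_derivative
        P ** (M ** mat_exp (t *\<^sub>R M)) ** Q) (at t)"
      by (intro mat_exp_has_vector_derivative
        bounded_linear.has_vector_derivative[OF bounded_bilinear.bounded_linear_left[OF bounded_bilinear_matrix_mult]]
        bounded_linear.has_vector_derivative[OF bounded_bilinear.bounded_linear_right[OF bounded_bilinear_matrix_mult]])
    moreover have "(P ** M ** Q) ** (P ** mat_exp (t *\<^sub>R M) ** Q) =
        P ** M ** (Q ** P) ** mat_exp (t *\<^sub>R M) ** Q"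
      by (simp add: matrix_mul_assoc)
    ultimately show ?thesis by (simp add: assms matrix_mul_assoc)
  qed
  from mat_exp_ode_matrix[OF this, of t] show ?thesis by (simp add: PQ)
qed

lemma mat_exp_tendsto:
  "(f \<longlongrightarrow> t) F \<Longrightarrow> ((\<lambda>x. mat_exp (f x *\<^sub>R M)) \<longlongrightarrow> mat_exp (t *\<^sub>R M)) F"
  using has_vector_derivative_continuous[OF mat_exp_has_vector_derivative[of M t]]
  by (rule isCont_tendsto_compose)

subsection \<open>Orthogonal matrices and the Frobenius norm\<close>

lemma norm_matrix_mult_orthogonal_right:
  fixes M :: "real^'n^'m" and Q :: "real^'n^'n"
  assumes "orthogonal_matrix Q"
  shows "norm (M ** Q) = norm M"
proof -
  have "norm ((M ** Q) $ i) = norm (M $ i)" for i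
  proof -
    have "(M ** Q) $ i = transpose Q *v M $ i"
      by (simp add: vec_eq_iff matrix_matrix_mult_def vector_matrix_mult_def)
    moreover have "orthogonal_transformation ((*v) (transpose Q))"
      using assms unfolding orthogonal_transformation_matrix by simp
    ultimately show ?thesis by (simp only: orthogonal_transformation_norm)
  qed
  then show ?thesis by (simp add: norm_vec_def)
qed

lemma inner_matrix_conv_sum: "M \<bullet> N = (\<Sum>i\<in>UNIV. \<Sum>j\<in>UNIV. M $ i $ j * N $ i $ j)"
  for M N :: "real^'n^'m"
  by (simp add: inner_vec_def)

lemma inner_transpose: "transpose M \<bullet> transpose N = M \<bullet> N" for M N :: "real^'n^'m"
  unfolding inner_matrix_conv_sum by (subst sum.swap) (simp add: transpose_def)

lemma norm_transpose: "norm (transpose M) = norm M" for M :: "real^'n^'m"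
  by (simp add: norm_eq_sqrt_inner inner_transpose)

lemma norm_matrix_mult_orthogonal_left:
  fixes M :: "real^'n^'m" and Q :: "real^'m^'m"
  assumes "orthogonal_matrix Q"
  shows "norm (Q ** M) = norm M"
proof -
  have "norm (Q ** M) = norm (transpose M ** transpose Q)"
    by (simp add: norm_transpose flip: matrix_transpose_mul)
  then show ?thesis
    using norm_matrix_mult_orthogonal_right[of "transpose Q" "transpose M"] assms
    by (simp add: norm_transpose)
qed

lemma orthogonal_matrix_mat_power: "orthogonal_matrix P \<Longrightarrow> orthogonal_matrix (mat_power P k)"
  by (induction k) (auto simp: orthogonal_matrix_id orthogonal_matrix_mul)

text \<open>Replacing the factors P by Q one at a time costs \<open>norm (P - Q)\<close> each,
  because orthogonal factors preserve the Frobenius norm. The merely linear growth in k is what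
  makes the limit in \<open>one_parameter_limit\<close> work.\<close>

lemma norm_mat_power_diff_le:
  assumes "orthogonal_matrix P" "orthogonal_matrix Q"
  shows "norm (mat_power P k - mat_power Q k) \<le> of_nat k * norm (P - Q)"
proof (induction k)
  case (Suc k)
  have "mat_power P (Suc k) - mat_power Q (Suc k) =
      P ** (mat_power P k - mat_power Q k) + (P - Q) ** mat_power Q k"
    by (simp add: matrix_mult_diff_left matrix_mult_diff_right)
  then have "norm (mat_power P (Suc k) - mat_power Q (Suc k)) \<le>
      norm (P ** (mat_power P k - mat_power Q k)) + norm ((P - Q) ** mat_power Q k)"
    by (metis norm_triangle_ineq)
  also have "\<dots> = norm (mat_power P k - mat_power Q k) + norm (P - Q)"
    using assms by (simp add: norm_matrix_mult_orthogonal_left norm_matrix_mult_orthogonal_right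
        orthogonal_matrix_mat_power)
  finally show ?case using Suc by (simp add: algebra_simps)
qed simp

subsection \<open>The cross product of imaginary octonions\<close>

definition cross7 :: "real^7 \<Rightarrow> real^7 \<Rightarrow> real^7" where
  "cross7 u v = (\<chi> k. \<Sum>i\<in>UNIV. \<Sum>j\<in>UNIV. oct_coeff i j k * u $ i * v $ j)"

lemma cross7_components:
  "cross7 u v $ 1 = u$2 * v$3 - u$3 * v$2 + u$4 * v$5 - u$5 * v$4 + u$7 * v$6 - u$6 * v$7"
  "cross7 u v $ 2 = u$3 * v$1 - u$1 * v$3 + u$4 * v$6 - u$6 * v$4 + u$5 * v$7 - u$7 * v$5"
  "cross7 u v $ 3 = u$1 * v$2 - u$2 * v$1 + u$4 * v$7 - u$7 * v$4 + u$6 * v$5 - u$5 * v$6"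
  "cross7 u v $ 4 = u$5 * v$1 - u$1 * v$5 + u$6 * v$2 - u$2 * v$6 + u$7 * v$3 - u$3 * v$7"
  "cross7 u v $ 5 = u$1 * v$4 - u$4 * v$1 + u$7 * v$2 - u$2 * v$7 + u$3 * v$6 - u$6 * v$3"
  "cross7 u v $ 6 = u$2 * v$4 - u$4 * v$2 + u$5 * v$3 - u$3 * v$5 + u$1 * v$7 - u$7 * v$1"
  "cross7 u v $ 7 = u$6 * v$1 - u$1 * v$6 + u$2 * v$5 - u$5 * v$2 + u$3 * v$4 - u$4 * v$3"
  by (simp_all add: cross7_def sum_7 oct_coeff_def oct_triples_def)

lemma cross7_self [simp]: "cross7 v v = 0"
  by (simp add: vec_eq_iff forall_7 cross7_components)

lemma cross7_anticommute: "cross7 v u = - cross7 u v"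
  by (simp add: vec_eq_iff forall_7 cross7_components)

lemma bounded_bilinear_cross7: "bounded_bilinear cross7"
  by (simp add: bilinear_conv_bounded_bilinear[symmetric] bilinear_def linear_iff vec_eq_iff
      forall_7 cross7_components algebra_simps)

lemmas tendsto_cross7 [tendsto_intros] = bounded_bilinear.tendsto[OF bounded_bilinear_cross7]

lemma oct_mult_eq:
  "x *\<^sub>O y = (fst x * fst y - snd x \<bullet> snd y,
     fst x *\<^sub>R snd y + fst y *\<^sub>R snd x + cross7 (snd x) (snd y))"
  by (simp add: oct_mult_def cross7_def)

lemma cross7_zero [simp]: "cross7 0 v = 0" "cross7 v 0 = 0"
  by (simp_all add: cross7_def vec_eq_iff)

lemma oct_mult_one: "(1, 0) *\<^sub>O x = x" "x *\<^sub>O (1, 0) = x"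
  by (simp_all add: oct_mult_eq)

lemma oct_mult_im_self: "(0, v) *\<^sub>O (0, v) = (- (v \<bullet> v)) *\<^sub>R (1, 0)"
  by (simp add: oct_mult_eq)

lemma im_matrix_mult_vec:
  assumes "linear g"
  shows "im_matrix g *v v = snd (g (0, v))"
proof -
  have "linear (\<lambda>v. snd (g (0, v)))"
    using assms linear_compose[OF linear_compose[of "\<lambda>v. (0, v)" g] linear_snd]
    by (simp add: o_def linear_iff)
  then show ?thesis unfolding im_matrix_def by (simp add: matrix_works)
qed

text \<open>Squares detect imaginary octonions: the square of (0, v) is the real number -|v|^2, so
  the image (a, u) has the same square. Its imaginary part 2 a u must vanish, and u = 0 would leave
  a^2 = -|v|^2, which again forces a = 0.\<close>

lemma oct_aut_im:
  assumes g: "g \<in> oct_aut"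
  shows "g (1, 0) = (1, 0)" "fst (g (0, v)) = 0" "norm (snd (g (0, v))) = norm v"
proof -
  have lin: "linear g" and "bij g" and mult: "g (x *\<^sub>O y) = g x *\<^sub>O g y" for x y
    using g unfolding oct_aut_def by blast+
  then obtain e where e: "g e = (1, 0)" by (metis bij_pointE)
  have "g (1, 0) *\<^sub>O g e = g e"
    by (simp only: oct_mult_one flip: mult)
  then show one: "g (1, 0) = (1, 0)"
    unfolding e by (simp only: oct_mult_one)
  obtain a u where au: "g (0, v) = (a, u)" by fastforce
  have "(a, u) *\<^sub>O (a, u) = (- (v \<bullet> v)) *\<^sub>R (1, 0)"
    using mult[of "(0, v)" "(0, v)"] by (simp only: au oct_mult_im_self linear_cmul[OF lin] one)
  then have eq: "a * a - u \<bullet> u = - (v \<bullet> v)" "a *\<^sub>R u + a *\<^sub>R u = 0"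
    by (simp_all add: oct_mult_eq)
  from eq(2) have "(a + a) *\<^sub>R u = 0" by (simp only: scaleR_add_left)
  then have "a = 0 \<or> u = 0" by simp
  moreover have "a = 0" if "u = 0"
  proof -
    from that eq(1) have "a * a = - (v \<bullet> v)" by simp
    then have "a * a \<le> 0" by simp
    then show ?thesis by (auto simp: mult_le_0_iff)
  qed
  ultimately have "a = 0" by blast
  with eq(1) au show "fst (g (0, v)) = 0" "norm (snd (g (0, v))) = norm v"
    by (simp_all add: norm_eq_sqrt_inner)
qed

lemma orthogonal_matrix_iff_norm:
  "orthogonal_matrix Q \<longleftrightarrow> (\<forall>v. norm (Q *v v) = norm v)" for Q :: "real^'n^'n"
  using orthogonal_transformation_matrix[of "(*v) Q"]
  by (simp add: orthogonal_transformation matrix_of_matrix_vector_mul)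

text \<open>The two conditions are the real and the imaginary part of multiplicativity on imaginary
  octonions. Conversely such a matrix, extended by the identity on the reals, is an automorphism
  whose inverse comes from the transpose.\<close>

lemma G2_iff:
  "M \<in> G2 \<longleftrightarrow> orthogonal_matrix M \<and> (\<forall>u v. M *v cross7 u v = cross7 (M *v u) (M *v v))"
proof
  assume "M \<in> G2"
  then obtain g where g: "g \<in> oct_aut" "M = im_matrix g" by (auto simp: G2_def)
  then have lin: "linear g" and mult: "g (x *\<^sub>O y) = g x *\<^sub>O g y" for x y
    unfolding oct_aut_def by blast+
  have M: "g (0, v) = (0, M *v v)" for v
    using oct_aut_im[OF g(1)] by (simp add: g(2) im_matrix_mult_vec[OF lin] prod_eq_iff)
  have "norm (M *v v) = norm v" for v
    using oct_aut_im(3)[OF g(1), of v] by (simp add: M)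
  moreover have "M *v cross7 u v = cross7 (M *v u) (M *v v)" for u v
  proof -
    have "(0, u) *\<^sub>O (0, v) = (- (u \<bullet> v)) *\<^sub>R (1, 0) + (0, cross7 u v)"
      by (simp add: oct_mult_eq)
    then have "g ((0, u) *\<^sub>O (0, v)) = (- (u \<bullet> v)) *\<^sub>R (1, 0) + (0, M *v cross7 u v)"
      by (simp only: linear_add[OF lin] linear_cmul[OF lin] oct_aut_im(1)[OF g(1)] M)
    then have "(0, M *v u) *\<^sub>O (0, M *v v) = (- (u \<bullet> v)) *\<^sub>R (1, 0) + (0, M *v cross7 u v)"
      by (simp only: mult M)
    then show ?thesis by (simp add: oct_mult_eq)
  qed
  ultimately show "orthogonal_matrix M \<and> (\<forall>u v. M *v cross7 u v = cross7 (M *v u) (M *v v))"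
    by (simp add: orthogonal_matrix_iff_norm)
next
  assume M: "orthogonal_matrix M \<and> (\<forall>u v. M *v cross7 u v = cross7 (M *v u) (M *v v))"
  define g where "g = (\<lambda>x :: octonion. (fst x, M *v snd x))"
  have lin: "linear g"
    by (simp add: g_def linear_iff matrix_vector_right_distrib matrix_vector_mult_scaleR)
  have inv: "transpose M ** M = mat 1" "M ** transpose M = mat 1"
    using M by (auto simp: orthogonal_matrix_def)
  then have "bij g"
    by (intro o_bij[of "\<lambda>x. (fst x, transpose M *v snd x)"])
      (simp_all add: g_def fun_eq_iff matrix_vector_mul_assoc del: transpose_matrix_vector)
  moreover have "(M *v u) \<bullet> (M *v v) = u \<bullet> v" for u v
    using M orthogonal_transformation_matrix[of "(*v) M"]
    by (simp add: orthogonal_transformation_def matrix_of_matrix_vector_mul)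
  then have "g (x *\<^sub>O y) = g x *\<^sub>O g y" for x y
    using M by (simp add: g_def oct_mult_eq matrix_vector_right_distrib matrix_vector_mult_scaleR)
  ultimately have "g \<in> oct_aut" using lin by (simp add: oct_aut_def)
  moreover have "im_matrix g = M"
    by (simp add: im_matrix_def g_def matrix_of_matrix_vector_mul)
  ultimately show "M \<in> G2" by (auto simp: G2_def)
qed

text \<open>Skewness is the real part of the Leibniz rule on imaginary octonions, the cross product
  identity its imaginary part. Conversely the matrix is extended by zero on the reals, since a
  derivation kills 1.\<close>

lemma g2_iff:
  "M \<in> g2 \<longleftrightarrow> (\<forall>u v. (M *v u) \<bullet> v + u \<bullet> (M *v v) = 0) \<and>
    (\<forall>u v. M *v cross7 u v = cross7 (M *v u) v + cross7 u (M *v v))"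
proof
  assume "M \<in> g2"
  then obtain d where d: "d \<in> oct_der" "M = im_matrix d" by (auto simp: g2_def)
  then have lin: "linear d" and leibniz: "d (x *\<^sub>O y) = d x *\<^sub>O y + x *\<^sub>O d y" for x y
    unfolding oct_der_def by blast+
  have "d (1, 0) = d (1, 0) + d (1, 0)"
    using leibniz[of "(1, 0)" "(1, 0)"] by (simp only: oct_mult_one)
  then have one: "d (1, 0) = 0" by simp
  have "fst (d (0, v)) = 0" for v
  proof (cases "v = 0")
    case True
    then show ?thesis using linear_0[OF lin] by (simp add: zero_prod_def)
  next
    case False
    obtain a u where au: "d (0, v) = (a, u)" by fastforce
    \<comment> \<open>Differentiating v^2 = -|v|^2 leaves the imaginary part 2 a v = 0, where a is
      the real part of d v.\<close>
    have "d ((0, v) *\<^sub>O (0, v)) = 0"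
      by (simp only: oct_mult_im_self linear_cmul[OF lin] one scaleR_zero_right)
    then have "(a, u) *\<^sub>O (0, v) + (0, v) *\<^sub>O (a, u) = 0"
      by (simp only: leibniz au)
    then have "a *\<^sub>R v + a *\<^sub>R v = 0"
      by (simp add: oct_mult_eq zero_prod_def cross7_anticommute[of u v])
    then have "(a + a) *\<^sub>R v = 0" by (simp only: scaleR_add_left)
    with False show ?thesis by (simp add: au)
  qed
  then have M: "d (0, v) = (0, M *v v)" for v
    by (simp add: d(2) im_matrix_mult_vec[OF lin] prod_eq_iff)
  have "(M *v u) \<bullet> v + u \<bullet> (M *v v) = 0 \<and>
      M *v cross7 u v = cross7 (M *v u) v + cross7 u (M *v v)" for u v
  proof -
    have "(0, u) *\<^sub>O (0, v) = (- (u \<bullet> v)) *\<^sub>R (1, 0) + (0, cross7 u v)"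
      by (simp add: oct_mult_eq)
    then have "d ((0, u) *\<^sub>O (0, v)) = (0, M *v cross7 u v)"
      by (simp only: linear_add[OF lin] linear_cmul[OF lin] one M scaleR_zero_right add_0)
    then have "(0, M *v u) *\<^sub>O (0, v) + (0, u) *\<^sub>O (0, M *v v) = (0, M *v cross7 u v)"
      by (simp only: leibniz M)
    then show ?thesis by (simp add: oct_mult_eq)
  qed
  then show "(\<forall>u v. (M *v u) \<bullet> v + u \<bullet> (M *v v) = 0) \<and>
      (\<forall>u v. M *v cross7 u v = cross7 (M *v u) v + cross7 u (M *v v))" by blast
next
  assume M: "(\<forall>u v. (M *v u) \<bullet> v + u \<bullet> (M *v v) = 0) \<and>
    (\<forall>u v. M *v cross7 u v = cross7 (M *v u) v + cross7 u (M *v v))"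
  define d where "d = (\<lambda>x :: octonion. (0 :: real, M *v snd x))"
  have "linear d"
    by (simp add: d_def linear_iff matrix_vector_right_distrib matrix_vector_mult_scaleR)
  moreover have "d (x *\<^sub>O y) = d x *\<^sub>O y + x *\<^sub>O d y" for x y
  proof -
    have "snd x \<bullet> (M *v snd y) = - ((M *v snd x) \<bullet> snd y)"
      using M by (simp add: eq_neg_iff_add_eq_0 add.commute)
    then show ?thesis
      using M by (simp add: d_def oct_mult_eq matrix_vector_right_distrib matrix_vector_mult_scaleR)
  qed
  ultimately have "d \<in> oct_der" by (simp add: oct_der_def)
  moreover have "im_matrix d = M"
    by (simp add: im_matrix_def d_def matrix_of_matrix_vector_mul)
  ultimately show "M \<in> g2" by (auto simp: g2_def)
qed

subsection \<open>Closed subgroups and one-parameter subgroups\<close>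

lemma G2_one: "mat 1 \<in> G2"
  by (simp add: G2_iff orthogonal_matrix_id)

lemma G2_mult: "M \<in> G2 \<Longrightarrow> N \<in> G2 \<Longrightarrow> M ** N \<in> G2"
  by (simp add: G2_iff orthogonal_matrix_mul flip: matrix_vector_mul_assoc)

lemma G2_orthogonal: "M \<in> G2 \<Longrightarrow> orthogonal_matrix M"
  by (simp add: G2_iff)

lemma G2_transpose_mult: "M \<in> G2 \<Longrightarrow> transpose M ** M = mat 1"
  "M \<in> G2 \<Longrightarrow> M ** transpose M = mat 1"
  by (simp_all add: G2_iff orthogonal_matrix_def)

lemma matrix_inv_eqI:
  assumes "M ** N = mat 1" "N ** M = mat 1"
  shows "matrix_inv M = N"
  unfolding matrix_inv_def
proof (rule some_equality)
  fix B
  assume "M ** B = mat 1 \<and> B ** M = mat 1"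
  then have "B = B ** (M ** N)" "B ** M = mat 1" using assms by simp_all
  then show "B = N" unfolding matrix_mul_assoc by simp
qed (use assms in simp)

lemma matrix_inv_G2: "M \<in> G2 \<Longrightarrow> matrix_inv M = transpose M"
  by (intro matrix_inv_eqI G2_transpose_mult)

lemma G2_transpose:
  assumes "M \<in> G2"
  shows "transpose M \<in> G2"
proof -
  have "transpose M *v cross7 u v = cross7 (transpose M *v u) (transpose M *v v)" for u v
  proof -
    have "u = M *v (transpose M *v u)" for u
      unfolding matrix_vector_mul_assoc by (simp add: G2_transpose_mult assms)
    then have "cross7 u v = cross7 (M *v (transpose M *v u)) (M *v (transpose M *v v))" by metis
    also have "\<dots> = M *v cross7 (transpose M *v u) (transpose M *v v)"
      using assms unfolding G2_iff by metis
    finally have "transpose M *v cross7 u v =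
        transpose M *v (M *v cross7 (transpose M *v u) (transpose M *v v))"
      by (rule arg_cong)
    also have "\<dots> = cross7 (transpose M *v u) (transpose M *v v)"
      unfolding matrix_vector_mul_assoc[of "transpose M" M]
      using G2_transpose_mult(1)[OF assms] by simp
    finally show ?thesis .
  qed
  with assms show ?thesis by (simp add: G2_iff)
qed

lemma tendsto_transpose [tendsto_intros]:
  fixes f :: "'b \<Rightarrow> real^'n^'m"
  assumes "(f \<longlongrightarrow> l) F"
  shows "((\<lambda>x. transpose (f x)) \<longlongrightarrow> transpose l) F"
  unfolding transpose_def using assms by (intro vec_tendstoI) (auto intro!: tendsto_intros)

lemma closed_G2: "closed G2"
  unfolding closed_sequential_limits
proof (intro allI impI, elim conjE)
  fix x l
  assume x: "\<forall>n. x n \<in> G2" and lim: "x \<longlonglongrightarrow> l"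
  have "(\<lambda>n. transpose (x n) ** x n) \<longlonglongrightarrow> transpose l ** l"
    by (intro tendsto_intros lim)
  with x have "transpose l ** l = mat 1"
    by (simp add: G2_transpose_mult LIMSEQ_const_iff)
  moreover have "l *v cross7 u v = cross7 (l *v u) (l *v v)" for u v
  proof (rule LIMSEQ_unique)
    show "(\<lambda>n. x n *v cross7 u v) \<longlonglongrightarrow> l *v cross7 u v"
      by (intro tendsto_intros lim)
    have "(\<lambda>n. cross7 (x n *v u) (x n *v v)) \<longlonglongrightarrow> cross7 (l *v u) (l *v v)"
      by (intro tendsto_intros lim)
    with x show "(\<lambda>n. x n *v cross7 u v) \<longlonglongrightarrow> cross7 (l *v u) (l *v v)"
      by (simp add: G2_iff)
  qed
  ultimately show "l \<in> G2" by (simp add: G2_iff orthogonal_matrix)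
qed

lemma subspace_g2: "subspace g2"
proof -
  note bilinear = bounded_bilinear.add_left[OF bounded_bilinear_cross7]
    bounded_bilinear.add_right[OF bounded_bilinear_cross7]
    bounded_bilinear.scaleR_left[OF bounded_bilinear_cross7]
    bounded_bilinear.scaleR_right[OF bounded_bilinear_cross7]
  show ?thesis
    unfolding subspace_def
  proof (intro conjI ballI allI)
    show "0 \<in> g2" by (simp add: g2_iff)
    show "M + N \<in> g2" if M: "M \<in> g2" and N: "N \<in> g2" for M N
    proof -
      have "((M + N) *v u) \<bullet> v + u \<bullet> ((M + N) *v v) =
          ((M *v u) \<bullet> v + u \<bullet> (M *v v)) + ((N *v u) \<bullet> v + u \<bullet> (N *v v))" for u v
        by (simp add: matrix_vector_mult_add_rdistrib inner_add_left inner_add_right)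
      then show ?thesis
        using M N unfolding g2_iff by (simp add: matrix_vector_mult_add_rdistrib bilinear)
    qed
    show "c *\<^sub>R M \<in> g2" if M: "M \<in> g2" for c M
    proof -
      have "((c *\<^sub>R M) *v u) \<bullet> v + u \<bullet> ((c *\<^sub>R M) *v v) =
          c * ((M *v u) \<bullet> v + u \<bullet> (M *v v))" for u v
        by (simp add: algebra_simps flip: scaleR_matrix_vector_assoc)
      then show ?thesis
        using M unfolding g2_iff
        by (simp add: bilinear scaleR_add_right flip: scaleR_matrix_vector_assoc)
    qed
  qed
qed

text \<open>The defining relations of \<open>G2\<close> for g_n, divided by s_n, become exact
  relations for the quotients q_n in which one argument still carries g_n. As g_n tends to 1, they
  turn into the defining relations of \<open>g2\<close>. Working with sequences lets the lemma serve
  tangent vectors, conjugates and limits of group elements alike.\<close>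

lemma secant_limit_in_g2:
  assumes g: "\<And>n. g n \<in> G2" and s: "s \<longlonglongrightarrow> 0" "\<And>n. s n \<noteq> 0"
    and lim: "(\<lambda>n. (1 / s n) *\<^sub>R (g n - mat 1)) \<longlonglongrightarrow> Y"
  shows "Y \<in> g2"
proof -
  define q where "q = (\<lambda>n. (1 / s n) *\<^sub>R (g n - mat 1))"
  have q: "q \<longlonglongrightarrow> Y" using lim by (simp add: q_def)
  have gq: "g n = mat 1 + s n *\<^sub>R q n" for n using s(2) by (simp add: q_def)
  have "(\<lambda>n. mat 1 + s n *\<^sub>R q n) \<longlonglongrightarrow> mat 1 + 0 *\<^sub>R Y"
    by (intro tendsto_intros q s)
  then have g1: "g \<longlonglongrightarrow> mat 1" by (simp flip: gq)
  have gv: "g n *v v = v + s n *\<^sub>R (q n *v v)" for n v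
    by (simp add: gq matrix_vector_mult_add_rdistrib flip: scaleR_matrix_vector_assoc)
  have inner: "(q n *v u) \<bullet> (g n *v v) + u \<bullet> (q n *v v) = 0" for n u v
  proof -
    have "(g n *v u) \<bullet> (g n *v v) = u \<bullet> v"
      using G2_orthogonal[OF g, of n] orthogonal_transformation_matrix[of "(*v) (g n)"]
      by (simp add: orthogonal_transformation_def matrix_of_matrix_vector_mul)
    then have "s n * ((q n *v u) \<bullet> (g n *v v) + u \<bullet> (q n *v v)) = 0"
      by (simp add: gv algebra_simps)
    with s(2)[of n] show ?thesis by simp
  qed
  have cross: "q n *v cross7 u v = cross7 (q n *v u) (g n *v v) + cross7 u (q n *v v)" for n u v
  proof -
    have "g n *v cross7 u v = cross7 (g n *v u) (g n *v v)" using g[of n] by (simp add: G2_iff)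
    also have "\<dots> = cross7 u (g n *v v) + s n *\<^sub>R cross7 (q n *v u) (g n *v v)"
      by (simp add: gv[of n u] bounded_bilinear.add_left[OF bounded_bilinear_cross7]
        bounded_bilinear.scaleR_left[OF bounded_bilinear_cross7])
    also have "cross7 u (g n *v v) = cross7 u v + s n *\<^sub>R cross7 u (q n *v v)"
      by (simp add: gv[of n v] bounded_bilinear.add_right[OF bounded_bilinear_cross7]
        bounded_bilinear.scaleR_right[OF bounded_bilinear_cross7])
    finally have "s n *\<^sub>R (q n *v cross7 u v) =
        s n *\<^sub>R (cross7 (q n *v u) (g n *v v) + cross7 u (q n *v v))"
      unfolding gv[of n "cross7 u v"] by (simp add: scaleR_add_right)
    with s(2)[of n] show ?thesis by simp
  qed
  have "(Y *v u) \<bullet> v + u \<bullet> (Y *v v) = 0" for u v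
  proof (rule LIMSEQ_unique)
    have "(\<lambda>n. (q n *v u) \<bullet> (g n *v v) + u \<bullet> (q n *v v)) \<longlonglongrightarrow> (Y *v u) \<bullet> (mat 1 *v v) + u \<bullet> (Y *v v)"
      by (intro tendsto_intros q g1)
    then show "(\<lambda>n. 0) \<longlonglongrightarrow> (Y *v u) \<bullet> v + u \<bullet> (Y *v v)" by (simp add: inner)
  qed simp
  moreover have "Y *v cross7 u v = cross7 (Y *v u) v + cross7 u (Y *v v)" for u v
  proof (rule LIMSEQ_unique)
    show "(\<lambda>n. q n *v cross7 u v) \<longlonglongrightarrow> Y *v cross7 u v" by (intro tendsto_intros q)
    have "(\<lambda>n. cross7 (q n *v u) (g n *v v) + cross7 u (q n *v v)) \<longlonglongrightarrow>
        cross7 (Y *v u) (mat 1 *v v) + cross7 u (Y *v v)"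
      by (intro tendsto_intros q g1)
    then show "(\<lambda>n. q n *v cross7 u v) \<longlonglongrightarrow> cross7 (Y *v u) v + cross7 u (Y *v v)"
      by (simp add: cross)
  qed
  ultimately show ?thesis by (simp add: g2_iff)
qed

lemma mat_exp_vec_has_vector_derivative:
  "((\<lambda>t. mat_exp (t *\<^sub>R M) *v v) has_vector_derivative M *v (mat_exp (t *\<^sub>R M) *v v)) (at t)"
proof -
  have "((\<lambda>t. mat_exp (t *\<^sub>R M) *v v) has_vector_derivative (M ** mat_exp (t *\<^sub>R M)) *v v) (at t)"
    by (rule bounded_linear.has_vector_derivative[OF bounded_bilinear.bounded_linear_left[OF
        bounded_bilinear_matrix_vector_mult] mat_exp_has_vector_derivative])
  then show ?thesis by (simp only: matrix_vector_mul_assoc)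
qed

text \<open>Skewness makes the squared norm of exp(t Y) v constant. For the cross product, the
  Leibniz rule shows that both sides solve y' = Y y with the same initial value.\<close>

lemma mat_exp_in_G2:
  assumes Y: "Y \<in> g2"
  shows "mat_exp (t *\<^sub>R Y) \<in> G2"
proof -
  let ?E = "\<lambda>t. mat_exp (t *\<^sub>R Y)"
  note der = mat_exp_vec_has_vector_derivative[of Y]
  have skew: "(Y *v u) \<bullet> v + u \<bullet> (Y *v v) = 0"
    and leibniz: "Y *v cross7 u v = cross7 (Y *v u) v + cross7 u (Y *v v)" for u v
    using Y by (simp_all add: g2_iff)
  have "norm (?E t *v v) = norm v" for v
  proof -
    have "((\<lambda>t. (?E t *v v) \<bullet> (?E t *v v)) has_vector_derivative 0) (at t)" for t
      using bounded_bilinear.has_vector_derivative[OF bounded_bilinear_inner der[of v t] der[of v t]]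
        skew[of "?E t *v v" "?E t *v v"] by (simp add: inner_commute)
    then have "(?E t *v v) \<bullet> (?E t *v v) = (?E 0 *v v) \<bullet> (?E 0 *v v)"
      by (rule zero_derivative_imp_eq)
    then show ?thesis by (simp add: norm_eq_sqrt_inner)
  qed
  moreover have "?E t *v cross7 u v = cross7 (?E t *v u) (?E t *v v)" for u v
  proof -
    have "((\<lambda>t. cross7 (?E t *v u) (?E t *v v)) has_vector_derivative
        Y *v cross7 (?E t *v u) (?E t *v v)) (at t)" for t
      using bounded_bilinear.has_vector_derivative[OF bounded_bilinear_cross7 der[of u t] der[of v t]]
      by (simp add: leibniz add.commute)
    from mat_exp_ode_vector[OF this, of t] show ?thesis by simp
  qed
  ultimately show ?thesis by (simp add: G2_iff orthogonal_matrix_iff_norm)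
qed

lemma vector_derivative_secant_limit:
  fixes f :: "real \<Rightarrow> 'a::real_normed_vector"
  assumes f: "(f has_vector_derivative D) (at 0)" and s: "s \<longlonglongrightarrow> 0" "\<And>n. s n \<noteq> 0"
  shows "(\<lambda>n. (1 / s n) *\<^sub>R (f (s n) - f 0)) \<longlonglongrightarrow> D"
proof -
  have "filterlim s (at 0) sequentially"
    using s by (auto simp: filterlim_at)
  moreover have "((\<lambda>y. norm (f y - f 0 - y *\<^sub>R D) / norm y) \<longlongrightarrow> 0) (at 0)"
    using f by (simp add: has_vector_derivative_def has_derivative_iff_norm)
  ultimately have "(\<lambda>n. norm (f (s n) - f 0 - s n *\<^sub>R D) / norm (s n)) \<longlonglongrightarrow> 0"
    by (rule filterlim_compose[rotated])
  moreover have "norm (f (s n) - f 0 - s n *\<^sub>R D) / norm (s n) =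
      norm ((1 / s n) *\<^sub>R (f (s n) - f 0) - D)" for n
  proof -
    have "(1 / s n) *\<^sub>R (f (s n) - f 0) - D = (1 / s n) *\<^sub>R (f (s n) - f 0 - s n *\<^sub>R D)"
      using s(2)[of n] by (simp add: scaleR_diff_right)
    then show ?thesis by simp
  qed
  ultimately have "(\<lambda>n. norm ((1 / s n) *\<^sub>R (f (s n) - f 0) - D)) \<longlonglongrightarrow> 0" by simp
  then show ?thesis by (rule LIM_zero_cancel[OF tendsto_norm_zero_cancel])
qed

text \<open>Inverses are expressed as transposes, the elements being orthogonal.\<close>

definition closed_subgroup_G2 :: "(real^7^7) set \<Rightarrow> bool" where
  "closed_subgroup_G2 H \<longleftrightarrow> closed H \<and> H \<subseteq> G2 \<and> mat 1 \<in> H \<and>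
    (\<forall>M\<in>H. \<forall>N\<in>H. M ** N \<in> H) \<and> (\<forall>M\<in>H. transpose M \<in> H)"

text \<open>The power of g_n with exponent t / s_n, rounded down, converges to exp(t Y): g_n and
  exp(s_n Y) agree up to o(s_n), and about t / s_n such errors add up to o(1). Closedness puts the
  limit into H.\<close>

lemma one_parameter_limit:
  assumes H: "closed_subgroup_G2 H" and g: "\<And>n. g n \<in> H"
    and s: "s \<longlonglongrightarrow> 0" "\<And>n. 0 < s n"
    and lim: "(\<lambda>n. (1 / s n) *\<^sub>R (g n - mat 1)) \<longlonglongrightarrow> Y"
  shows "Y \<in> g2" "mat_exp (t *\<^sub>R Y) \<in> H"
proof -
  have s0: "s n \<noteq> 0" for n using s(2)[of n] by simp
  have gG2: "g n \<in> G2" for n using H g by (auto simp: closed_subgroup_G2_def)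
  show Y: "Y \<in> g2" using secant_limit_in_g2[OF gG2 s(1) s0 lim] .
  have nonneg: "mat_exp (t *\<^sub>R Y) \<in> H" if t: "0 \<le> t" for t
  proof -
    define k where "k = (\<lambda>n. nat \<lfloor>t / s n\<rfloor>)"
    \<comment> \<open>\<open>d n\<close> is the distance of g_n from exp(s_n Y), divided by s_n; it
      tends to 0 because both secants converge to Y.\<close>
    define d where "d = (\<lambda>n. norm ((1 / s n) *\<^sub>R (g n - mat 1) - (1 / s n) *\<^sub>R (mat_exp (s n *\<^sub>R Y) - mat 1)))"
    have ks: "real (k n) * s n \<le> t" "t - s n \<le> real (k n) * s n" for n
    proof -
      have "real (k n) \<le> t / s n" "t / s n - 1 \<le> real (k n)"
        using t s(2)[of n] unfolding k_def by (auto simp: of_nat_nat)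
      then show "real (k n) * s n \<le> t" "t - s n \<le> real (k n) * s n"
        using s(2)[of n] by (simp_all add: field_simps)
    qed
    have "(\<lambda>n. (1 / s n) *\<^sub>R (mat_exp (s n *\<^sub>R Y) - mat 1)) \<longlonglongrightarrow> Y"
      using vector_derivative_secant_limit[OF mat_exp_has_vector_derivative[of Y 0] s(1) s0] by simp
    then have "d \<longlonglongrightarrow> norm (Y - Y)"
      unfolding d_def by (intro tendsto_intros lim)
    then have td: "(\<lambda>n. t * d n) \<longlonglongrightarrow> 0"
      using tendsto_mult_left[of d 0 sequentially t] by simp
    have bound: "norm (mat_power (g n) (k n) - mat_exp ((real (k n) * s n) *\<^sub>R Y)) \<le> t * d n" for n
    proof -
      have "mat_exp ((real (k n) * s n) *\<^sub>R Y) = mat_power (mat_exp (s n *\<^sub>R Y)) (k n)"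
        using mat_exp_of_nat[of "k n" "s n *\<^sub>R Y"] by simp
      then have "norm (mat_power (g n) (k n) - mat_exp ((real (k n) * s n) *\<^sub>R Y))
          \<le> real (k n) * norm (g n - mat_exp (s n *\<^sub>R Y))"
        using norm_mat_power_diff_le[OF G2_orthogonal[OF gG2] G2_orthogonal[OF mat_exp_in_G2[OF Y]]]
        by simp
      also have "norm (g n - mat_exp (s n *\<^sub>R Y)) = s n * d n"
      proof -
        have "(1 / s n) *\<^sub>R (g n - mat 1) - (1 / s n) *\<^sub>R (mat_exp (s n *\<^sub>R Y) - mat 1) =
            (1 / s n) *\<^sub>R (g n - mat_exp (s n *\<^sub>R Y))"
          by (simp flip: scaleR_diff_right)
        then have "d n = (1 / s n) * norm (g n - mat_exp (s n *\<^sub>R Y))"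
          using s(2)[of n] by (simp add: d_def)
        then show ?thesis using s0[of n] by simp
      qed
      also have "real (k n) * (s n * d n) \<le> t * d n"
        using ks(1)[of n] by (simp add: d_def mult_right_mono flip: mult.assoc)
      finally show ?thesis .
    qed
    have "(\<lambda>n. mat_power (g n) (k n) - mat_exp ((real (k n) * s n) *\<^sub>R Y)) \<longlonglongrightarrow> 0"
      by (rule Lim_null_comparison[OF _ td]) (simp add: bound)
    moreover have "(\<lambda>n. real (k n) * s n) \<longlonglongrightarrow> t"
    proof (rule tendsto_sandwich)
      show "(\<lambda>n. t - s n) \<longlonglongrightarrow> t" using tendsto_diff[OF tendsto_const s(1), of t] by simp
    qed (use ks in auto)
    then have "(\<lambda>n. mat_exp ((real (k n) * s n) *\<^sub>R Y)) \<longlonglongrightarrow> mat_exp (t *\<^sub>R Y)"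
      by (rule mat_exp_tendsto)
    ultimately have "(\<lambda>n. mat_power (g n) (k n)) \<longlonglongrightarrow> mat_exp (t *\<^sub>R Y)"
      by (rule Lim_transform[rotated])
    moreover have "mat_power (g n) m \<in> H" for n m
      using H g by (induction m) (auto simp: closed_subgroup_G2_def)
    moreover have "closed H" using H by (simp add: closed_subgroup_G2_def)
    ultimately show ?thesis
      using closed_sequentially[of H "\<lambda>n. mat_power (g n) (k n)"] by blast
  qed
  show "mat_exp (t *\<^sub>R Y) \<in> H"
  proof (cases "0 \<le> t")
    case False
    \<comment> \<open>For negative t, exp(t Y) is the inverse of exp(-t Y) and hence its
      transpose.\<close>
    let ?T = "transpose (mat_exp (- t *\<^sub>R Y))"
    have "?T ** (mat_exp (- t *\<^sub>R Y) ** mat_exp (t *\<^sub>R Y)) = ?T"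
      by (simp only: mat_exp_minus_mult matrix_mul_rid)
    then have "mat_exp (t *\<^sub>R Y) = ?T"
      by (simp only: matrix_mul_assoc G2_transpose_mult(1)[OF mat_exp_in_G2[OF Y]] matrix_mul_lid)
    with H nonneg[of "- t"] False show ?thesis by (simp add: closed_subgroup_G2_def)
  qed (rule nonneg)
qed

section \<open>The Lie algebra of a closed subgroup\<close>

definition lie_algebra_of :: "(real^7^7) set \<Rightarrow> (real^7^7) set" where
  "lie_algebra_of H = {Y \<in> g2. \<forall>t. mat_exp (t *\<^sub>R Y) \<in> H}"

text \<open>For sums, the product of exp(s Y) and exp(s Z) is a curve in H with velocity Y + Z at 0;
  sampled at s = 1 / (n + 1) it satisfies the hypotheses of
  \<open>one_parameter_limit\<close>.\<close>

lemma subspace_lie_algebra_of: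
  assumes H: "closed_subgroup_G2 H"
  shows "subspace (lie_algebra_of H)"
  unfolding subspace_def
proof (intro conjI ballI allI)
  show "0 \<in> lie_algebra_of H"
    using H subspace_0[OF subspace_g2] by (simp add: lie_algebra_of_def closed_subgroup_G2_def)
  show "c *\<^sub>R Y \<in> lie_algebra_of H" if "Y \<in> lie_algebra_of H" for c Y
    using that subspace_scale[OF subspace_g2] by (simp add: lie_algebra_of_def)
  show "Y + Z \<in> lie_algebra_of H" if Y: "Y \<in> lie_algebra_of H" and Z: "Z \<in> lie_algebra_of H" for Y Z
  proof -
    have "((\<lambda>s. mat_exp (s *\<^sub>R Y) ** mat_exp (s *\<^sub>R Z)) has_vector_derivative Y + Z) (at 0)"
      using bounded_bilinear.has_vector_derivative[OF bounded_bilinear_matrix_mult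
          mat_exp_has_vector_derivative[of Y 0] mat_exp_has_vector_derivative[of Z 0]]
      by (simp add: add.commute)
    from vector_derivative_secant_limit[OF this LIMSEQ_inverse_real_of_nat]
    have "(\<lambda>n. (1 / inverse (real (Suc n))) *\<^sub>R
        (mat_exp (inverse (real (Suc n)) *\<^sub>R Y) ** mat_exp (inverse (real (Suc n)) *\<^sub>R Z) - mat 1))
        \<longlonglongrightarrow> Y + Z"
      by (simp del: of_nat_Suc)
    note * = one_parameter_limit[OF H _ LIMSEQ_inverse_real_of_nat _ this]
    have "mat_exp (s *\<^sub>R Y) ** mat_exp (s *\<^sub>R Z) \<in> H" for s
      using H Y Z by (simp add: closed_subgroup_G2_def lie_algebra_of_def)
    then show ?thesis using * by (simp add: lie_algebra_of_def del: of_nat_Suc)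
  qed
qed

lemma lie_algebra_of_conj:
  assumes "closed_subgroup_G2 H" "Y \<in> lie_algebra_of H" "M \<in> H"
  shows "mat_exp (t *\<^sub>R (M ** Y ** transpose M)) \<in> H"
proof -
  have "mat_exp (t *\<^sub>R (M ** Y ** transpose M)) = M ** mat_exp (t *\<^sub>R Y) ** transpose M"
    using assms by (intro mat_exp_conj[symmetric] G2_transpose_mult) (auto simp: closed_subgroup_G2_def)
  then show ?thesis using assms by (simp add: closed_subgroup_G2_def lie_algebra_of_def)
qed

text \<open>The conjugated one-parameter group stays in \<open>G2\<close>, and its velocity at 0 is
  a limit of secants.\<close>

lemma g2_conj:
  assumes M: "M \<in> G2" and Y: "Y \<in> g2"
  shows "M ** Y ** transpose M \<in> g2"
proof -
  let ?Z = "M ** Y ** transpose M"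
  have G2: "mat_exp (s *\<^sub>R ?Z) \<in> G2" for s
    using mat_exp_conj[OF G2_transpose_mult(1)[OF M], of s Y] M mat_exp_in_G2[OF Y, of s]
    by (metis G2_mult G2_transpose)
  have "(\<lambda>n. (1 / inverse (real (Suc n))) *\<^sub>R (mat_exp (inverse (real (Suc n)) *\<^sub>R ?Z) - mat 1)) \<longlonglongrightarrow> ?Z"
    using vector_derivative_secant_limit[OF mat_exp_has_vector_derivative[of ?Z 0]
        LIMSEQ_inverse_real_of_nat]
    by (simp del: of_nat_Suc)
  from secant_limit_in_g2[OF G2 LIMSEQ_inverse_real_of_nat _ this] show ?thesis
    by (simp del: of_nat_Suc)
qed

lemma tangent_space_G2: "tangent_space G2 (mat 1) = g2"
proof (intro equalityI subsetI)
  fix v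
  assume "v \<in> tangent_space G2 (mat 1)"
  then obtain \<gamma> :: "real \<Rightarrow> _" where \<gamma>: "range \<gamma> \<subseteq> G2" "\<gamma> 0 = mat 1"
    "(\<gamma> has_vector_derivative v) (at 0)"
    by (auto simp: tangent_space_def)
  have "(\<lambda>n. (1 / inverse (real (Suc n))) *\<^sub>R (\<gamma> (inverse (real (Suc n))) - mat 1)) \<longlonglongrightarrow> v"
    using vector_derivative_secant_limit[OF \<gamma>(3) LIMSEQ_inverse_real_of_nat] \<gamma>(2)
    by (simp del: of_nat_Suc)
  from secant_limit_in_g2[OF _ LIMSEQ_inverse_real_of_nat _ this] \<gamma>(1)
  show "v \<in> g2" by (auto simp del: of_nat_Suc)
next
  fix v
  assume v: "v \<in> g2"
  then show "v \<in> tangent_space G2 (mat 1)"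
    using mat_exp_has_vector_derivative[of v 0] mat_exp_in_G2[OF v]
    by (auto simp: tangent_space_def intro!: exI[of _ "\<lambda>t. mat_exp (t *\<^sub>R v)"])
qed

subsection \<open>An explicit description of \<open>g2\<close>\<close>

definition rot_gen :: "'n \<Rightarrow> 'n \<Rightarrow> real^'n^'n" where
  "rot_gen a b = (\<chi> i j. (if i = a \<and> j = b then 1 else 0) - (if i = b \<and> j = a then 1 else 0))"

text \<open>
  The pairs \<open>(a, b)\<close> with \<open>e\<^sub>a e\<^sub>b = e\<^sub>k\<close> group the entries of a matrix in \<open>g2\<close> into seven
  blocks; a skew matrix belongs to \<open>g2\<close> iff the three entries of each block sum to \<open>0\<close>.
\<close>

definition block_gen :: "'n \<times> 'n \<Rightarrow> 'n \<times> 'n \<Rightarrow> 'n \<times> 'n \<Rightarrow> real \<Rightarrow> real \<Rightarrow> real^'n^'n" where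
  "block_gen p q r x y = x *\<^sub>R rot_gen (fst p) (snd p) + y *\<^sub>R rot_gen (fst q) (snd q)
     - (x + y) *\<^sub>R rot_gen (fst r) (snd r)"

definition blk :: "7 \<Rightarrow> real \<Rightarrow> real \<Rightarrow> real^7^7" where
  "blk k =
    (if k = 1 then block_gen (2, 3) (4, 5) (7, 6)
     else if k = 2 then block_gen (3, 1) (4, 6) (5, 7)
     else if k = 3 then block_gen (1, 2) (4, 7) (6, 5)
     else if k = 4 then block_gen (5, 1) (6, 2) (7, 3)
     else if k = 5 then block_gen (1, 4) (7, 2) (3, 6)
     else if k = 6 then block_gen (2, 4) (5, 3) (1, 7)
     else block_gen (6, 1) (2, 5) (3, 4))"

lemma blk_simps:
  "blk 1 = block_gen (2, 3) (4, 5) (7, 6)"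
  "blk 2 = block_gen (3, 1) (4, 6) (5, 7)"
  "blk 3 = block_gen (1, 2) (4, 7) (6, 5)"
  "blk 4 = block_gen (5, 1) (6, 2) (7, 3)"
  "blk 5 = block_gen (1, 4) (7, 2) (3, 6)"
  "blk 6 = block_gen (2, 4) (5, 3) (1, 7)"
  "blk 7 = block_gen (6, 1) (2, 5) (3, 4)"
  by (simp_all add: blk_def)

lemma block_gen_add: "block_gen p q r x y + block_gen p q r x' y' = block_gen p q r (x + x') (y + y')"
  by (simp add: block_gen_def algebra_simps)

lemma block_gen_scaleR: "c *\<^sub>R block_gen p q r x y = block_gen p q r (c * x) (c * y)"
  by (simp add: block_gen_def algebra_simps)

lemma blk_add: "blk k x y + blk k x' y' = blk k (x + x') (y + y')"
  by (simp add: blk_def block_gen_add)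

lemma blk_scaleR: "c *\<^sub>R blk k x y = blk k (c * x) (c * y)"
  by (simp add: blk_def block_gen_scaleR)

lemma rot_gen_mult_vec: "(rot_gen a b *v v) $ i = (if i = a then v $ b else 0) - (if i = b then v $ a else 0)"
proof -
  have "(rot_gen a b *v v) $ i =
      (\<Sum>j\<in>UNIV. (if i = a \<and> j = b then 1 else 0) * v $ j) - (\<Sum>j\<in>UNIV. (if i = b \<and> j = a then 1 else 0) * v $ j)"
    by (simp add: matrix_vector_mult_def rot_gen_def left_diff_distrib sum_subtractf)
  then show ?thesis by (auto simp: if_distrib[of "\<lambda>x. x * _"] cong: if_cong)
qed

lemma block_gen_mult_vec:
  "block_gen p q r x y *v v = x *\<^sub>R (rot_gen (fst p) (snd p) *v v) + y *\<^sub>R (rot_gen (fst q) (snd q) *v v)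
     - (x + y) *\<^sub>R (rot_gen (fst r) (snd r) *v v)"
  by (simp add: block_gen_def matrix_vector_mult_add_rdistrib matrix_vector_mult_diff_rdistrib
      flip: scaleR_matrix_vector_assoc)

lemma inner_7: "u \<bullet> v = u$1 * v$1 + u$2 * v$2 + u$3 * v$3 + u$4 * v$4 + u$5 * v$5 + u$6 * v$6 + u$7 * v$7"
  for u v :: "real^7"
  by (simp add: inner_vec_def sum_7)


lemma blk_in_g2: "blk k x y \<in> g2"
proof -
  have skew: "(blk k x y *v u) \<bullet> v + u \<bullet> (blk k x y *v v) = 0" for u v
    using exhaust_7[of k]
    by (elim disjE; simp add: blk_simps block_gen_mult_vec inner_7 rot_gen_mult_vec; simp add: algebra_simps)
  have leibniz: "blk k x y *v cross7 u v = cross7 (blk k x y *v u) v + cross7 u (blk k x y *v v)" for u v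
    using exhaust_7[of k]
    by (elim disjE; simp add: blk_simps block_gen_mult_vec vec_eq_iff forall_7 cross7_components rot_gen_mult_vec;
      simp add: algebra_simps)
  show ?thesis by (simp add: g2_iff skew leibniz)
qed

text \<open>Each block relation is one component of the Leibniz rule for a product of two units: for
  e2 e4 = e6, component 7 says that entry (7,6) is the sum of the entries (3,2) and (5,4).\<close>

lemma g2_entries:
  assumes M: "M \<in> g2"
  shows "M $ j $ i = - (M $ i $ j)"
    "M$2$3 + M$4$5 + M$7$6 = 0" "M$3$1 + M$4$6 + M$5$7 = 0" "M$1$2 + M$4$7 + M$6$5 = 0"
    "M$5$1 + M$6$2 + M$7$3 = 0" "M$1$4 + M$7$2 + M$3$6 = 0" "M$2$4 + M$5$3 + M$1$7 = 0"
    "M$6$1 + M$2$5 + M$3$4 = 0"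
proof -
  have col: "(M *v axis j 1) $ i = M $ i $ j" for i j
    by (simp add: matrix_vector_mult_basis column_def)
  show skew: "M $ j $ i = - (M $ i $ j)" for i j
  proof -
    have "(M *v axis i 1) \<bullet> axis j 1 + axis i 1 \<bullet> (M *v axis j 1) = 0"
      using M by (simp add: g2_iff)
    then show ?thesis by (simp add: inner_axis inner_axis' col)
  qed
  have eq: "(M *v cross7 (axis i 1) (axis j 1)) $ l =
      (cross7 (M *v axis i 1) (axis j 1) + cross7 (axis i 1) (M *v axis j 1)) $ l" for i j l
    using M by (simp add: g2_iff)
  have prod: "cross7 (axis 2 1) (axis 4 1) = axis 6 1" "cross7 (axis 3 1) (axis 4 1) = axis 7 1"
    "cross7 (axis 1 1) (axis 4 1) = axis 5 1" "cross7 (axis 6 1) (axis 5 1) = axis 3 1"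
    "cross7 (axis 1 1) (axis 7 1) = axis 6 1" "cross7 (axis 2 1) (axis 5 1) = axis 7 1"
    "cross7 (axis 6 1) (axis 2 1) = axis 4 1"
    by (simp_all add: vec_eq_iff forall_7 cross7_components axis_def)
  show "M$2$3 + M$4$5 + M$7$6 = 0"
    using eq[of 2 4 7] skew[of 2 3] skew[of 4 5] unfolding prod col
    by (simp add: cross7_components col) (simp add: axis_def)
  show "M$3$1 + M$4$6 + M$5$7 = 0"
    using eq[of 3 4 5] skew[of 3 1] skew[of 4 6] unfolding prod col
    by (simp add: cross7_components col) (simp add: axis_def)
  show "M$1$2 + M$4$7 + M$6$5 = 0"
    using eq[of 1 4 6] skew[of 1 2] skew[of 4 7] unfolding prod col
    by (simp add: cross7_components col) (simp add: axis_def)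
  show "M$5$1 + M$6$2 + M$7$3 = 0"
    using eq[of 6 5 7] skew[of 5 1] skew[of 6 2] unfolding prod col
    by (simp add: cross7_components col) (simp add: axis_def)
  show "M$1$4 + M$7$2 + M$3$6 = 0"
    using eq[of 1 7 3] skew[of 1 4] skew[of 7 2] unfolding prod col
    by (simp add: cross7_components col) (simp add: axis_def)
  show "M$2$4 + M$5$3 + M$1$7 = 0"
    using eq[of 2 5 1] skew[of 2 4] skew[of 5 3] unfolding prod col
    by (simp add: cross7_components col) (simp add: axis_def)
  show "M$6$1 + M$2$5 + M$3$4 = 0"
    using eq[of 6 2 3] skew[of 6 1] skew[of 2 5] unfolding prod col
    by (simp add: cross7_components col) (simp add: axis_def)
qed

lemma g2_decomposition:
  assumes M: "M \<in> g2"
  shows "M = blk 1 (M$2$3) (M$4$5) + blk 2 (M$3$1) (M$4$6) + blk 3 (M$1$2) (M$4$7) + blk 4 (M$5$1) (M$6$2)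
    + blk 5 (M$1$4) (M$7$2) + blk 6 (M$2$4) (M$5$3) + blk 7 (M$6$1) (M$2$5)"
proof -
  note g2_entries(1)[OF M]
  then have diag: "M $ i $ i = 0" for i by (metis add.inverse_neutral add_eq_0_iff2 double_zero_sym)
  note sk = g2_entries(1)[OF M]
  note lines = g2_entries(2-)[OF M]
  show ?thesis
    unfolding vec_eq_iff forall_7
    using lines
      sk[of 2 3] sk[of 4 5] sk[of 7 6] sk[of 3 1] sk[of 4 6] sk[of 5 7] sk[of 1 2] sk[of 4 7] sk[of 6 5]
      sk[of 5 1] sk[of 6 2] sk[of 7 3] sk[of 1 4] sk[of 7 2] sk[of 3 6] sk[of 2 4] sk[of 5 3] sk[of 1 7]
      sk[of 6 1] sk[of 2 5] sk[of 3 4]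
    by (simp add: blk_simps block_gen_def rot_gen_def diag)
qed

subsection \<open>One-parameter subgroups generate \<open>G2\<close>\<close>

text \<open>The planes (a, b) and (c, d) turn at the same speed in opposite senses; the right-hand
  side solves the corresponding differential equation.\<close>

lemma mat_exp_double_rotation:
  fixes a b c d :: "'n::finite"
  assumes "distinct [a, b, c, d]"
  shows "mat_exp (t *\<^sub>R (rot_gen a b - rot_gen c d)) *v v =
    (\<chi> i. if i = a then cos t * v$a + sin t * v$b else if i = b then cos t * v$b - sin t * v$a
      else if i = c then cos t * v$c - sin t * v$d else if i = d then cos t * v$d + sin t * v$c
      else v$i)"
proof -
  define f where "f = (\<lambda>t. \<chi> i. if i = a then cos t * v$a + sin t * v$b
      else if i = b then cos t * v$b - sin t * v$a
      else if i = c then cos t * v$c - sin t * v$d else if i = d then cos t * v$d + sin t * v$c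
      else v$i)"
  have mult: "((rot_gen a b - rot_gen c d) *v u) $ i = (if i = a then u$b else 0)
      - (if i = b then u$a else 0) - ((if i = c then u$d else 0) - (if i = d then u$c else 0))" for u i
    by (simp add: matrix_vector_mult_diff_rdistrib rot_gen_mult_vec)
  have "(f has_vector_derivative (rot_gen a b - rot_gen c d) *v f t) (at t)" for t
  proof (rule has_vector_derivative_vecI)
    fix i
    show "((\<lambda>t. f t $ i) has_vector_derivative ((rot_gen a b - rot_gen c d) *v f t) $ i) (at t)"
      unfolding mult using assms
      by (auto simp: f_def simp flip: has_real_derivative_iff_has_vector_derivative
          intro!: derivative_eq_intros)
  qed
  from mat_exp_ode_vector[OF this, of t] have "f t = mat_exp (t *\<^sub>R (rot_gen a b - rot_gen c d)) *v f 0" .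
  moreover have "f 0 = v" by (simp add: f_def vec_eq_iff)
  ultimately show ?thesis by (simp add: f_def)
qed

text \<open>Entries 1, -1, 0 in a block add up to 0. These are the rotations used by the
  eliminations below; the first pair names the coordinate that is kept and then the one that is
  cleared.\<close>

lemma double_rotation_in_g2:
  "rot_gen 2 3 - rot_gen 4 5 \<in> g2" "rot_gen 4 5 - rot_gen 7 6 \<in> g2"
  "rot_gen 1 7 - rot_gen 5 3 \<in> g2" "rot_gen 2 4 - rot_gen 5 3 \<in> g2"
  "rot_gen 1 2 - rot_gen 4 7 \<in> g2" "rot_gen 1 6 - rot_gen 5 2 \<in> g2"
  "rot_gen 7 6 - rot_gen 2 3 \<in> g2" "rot_gen 2 7 - rot_gen 6 3 \<in> g2"
proof -
  have swap: "rot_gen b a = - rot_gen a b" for a b :: 7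
    by (simp add: rot_gen_def vec_eq_iff)
  show "rot_gen 2 3 - rot_gen 4 5 \<in> g2" using blk_in_g2[of 1 1 "-1"]
    by (simp add: blk_simps block_gen_def)
  show "rot_gen 4 5 - rot_gen 7 6 \<in> g2" using blk_in_g2[of 1 0 1]
    by (simp add: blk_simps block_gen_def)
  show "rot_gen 1 7 - rot_gen 5 3 \<in> g2" using blk_in_g2[of 6 0 "-1"]
    by (simp add: blk_simps block_gen_def)
  show "rot_gen 2 4 - rot_gen 5 3 \<in> g2" using blk_in_g2[of 6 1 "-1"]
    by (simp add: blk_simps block_gen_def)
  show "rot_gen 1 2 - rot_gen 4 7 \<in> g2" using blk_in_g2[of 3 1 "-1"]
    by (simp add: blk_simps block_gen_def)
  show "rot_gen 1 6 - rot_gen 5 2 \<in> g2" using blk_in_g2[of 7 "-1" 1]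
    by (simp add: blk_simps block_gen_def swap[of 6 1] swap[of 5 2])
  show "rot_gen 7 6 - rot_gen 2 3 \<in> g2" using blk_in_g2[of 1 "-1" 0]
    by (simp add: blk_simps block_gen_def)
  show "rot_gen 2 7 - rot_gen 6 3 \<in> g2" using blk_in_g2[of 5 0 "-1"]
    by (simp add: blk_simps block_gen_def swap[of 2 7] swap[of 6 3])
qed

definition contains_exp_g2 :: "(real^7^7) set \<Rightarrow> bool" where
  "contains_exp_g2 H \<longleftrightarrow> (\<forall>Y\<in>g2. mat_exp Y \<in> H) \<and> (\<forall>M\<in>H. \<forall>N\<in>H. M ** N \<in> H)"

text \<open>A Givens rotation: with t the polar angle of (v_a, v_b), coordinate b is absorbed into
  coordinate a, which becomes the nonnegative radius. The plane (c, d) turns along, so the order of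
  eliminations matters; the last two clauses tell when earlier zeros and fixed vectors
  survive.\<close>

lemma double_rotation_eliminate:
  assumes H: "contains_exp_g2 H" and g2: "rot_gen a b - rot_gen c d \<in> g2"
    and dist: "distinct [a, b, c, d]"
  obtains M where "M \<in> H" "(M *v v) $ b = 0" "0 \<le> (M *v v) $ a"
    "\<And>i. i \<notin> {a, b, c, d} \<Longrightarrow> (M *v v) $ i = v $ i"
    "v $ c = 0 \<Longrightarrow> v $ d = 0 \<Longrightarrow> (M *v v) $ c = 0 \<and> (M *v v) $ d = 0"
    "\<And>w. w $ a = 0 \<Longrightarrow> w $ b = 0 \<Longrightarrow> w $ c = 0 \<Longrightarrow> w $ d = 0 \<Longrightarrow> M *v w = w"
proof -
  obtain r t where r: "0 \<le> r" and ra: "v $ a = r * cos t" and rb: "v $ b = r * sin t"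
  proof (cases "v $ a = 0 \<and> v $ b = 0")
    case True
    then show ?thesis using that[of 0 0] by simp
  next
    case False
    define r where "r = sqrt ((v$a)\<^sup>2 + (v$b)\<^sup>2)"
    have r: "r > 0" "r\<^sup>2 = (v$a)\<^sup>2 + (v$b)\<^sup>2"
      using False unfolding r_def by (auto simp: sum_power2_gt_zero_iff)
    have "(v$a / r)\<^sup>2 + (v$b / r)\<^sup>2 = r\<^sup>2 / r\<^sup>2"
      by (simp only: power_divide add_divide_distrib r(2))
    also have "\<dots> = 1" using r(1) by simp
    finally obtain t where "v$a / r = cos t" "v$b / r = sin t" by (rule sincos_total_2pi)
    with r(1) show ?thesis using that[of r t] by (simp add: field_simps)
  qed
  define M where "M = mat_exp (t *\<^sub>R (rot_gen a b - rot_gen c d))"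
  have M: "M *v w = (\<chi> i. if i = a then cos t * w$a + sin t * w$b else if i = b then cos t * w$b - sin t * w$a
      else if i = c then cos t * w$c - sin t * w$d else if i = d then cos t * w$d + sin t * w$c
      else w$i)" for w
    unfolding M_def by (rule mat_exp_double_rotation[OF dist])
  have "(M *v v) $ a = cos t * (r * cos t) + sin t * (r * sin t)"
    by (simp add: M ra rb)
  also have "\<dots> = r * (cos t * cos t + sin t * sin t)"
    by (simp only: algebra_simps)
  finally have Ma: "(M *v v) $ a = r" by (simp only: sin_cos_squared_add3 mult_1_right)
  show ?thesis
  proof (rule that)
    show "M \<in> H"
      using H subspace_scale[OF subspace_g2 g2] by (simp add: M_def contains_exp_g2_def)
    show "0 \<le> (M *v v) $ a" by (simp only: Ma r)
    show "(M *v v) $ b = 0" using dist by (auto simp: M ra rb)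
    show "(M *v v) $ i = v $ i" if "i \<notin> {a, b, c, d}" for i using that by (simp add: M)
    show "(M *v v) $ c = 0 \<and> (M *v v) $ d = 0" if "v $ c = 0" "v $ d = 0"
      using that dist by (auto simp: M)
    show "M *v w = w" if "w $ a = 0" "w $ b = 0" "w $ c = 0" "w $ d = 0" for w
      using that by (auto simp: M vec_eq_iff)
  qed
qed

lemma contains_exp_g2_mult: "contains_exp_g2 H \<Longrightarrow> M \<in> H \<Longrightarrow> N \<in> H \<Longrightarrow> M ** N \<in> H"
  by (simp add: contains_exp_g2_def)

lemma unit_eq_axis:
  fixes v :: "real^'n"
  assumes "norm v = 1" "\<And>j. j \<noteq> i \<Longrightarrow> v $ j = 0" "0 \<le> v $ i"
  shows "v = axis i 1"
proof -
  have v: "v = v $ i *\<^sub>R axis i 1" using assms(2) by (auto simp: vec_eq_iff axis_def)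
  have "norm (v $ i *\<^sub>R axis i 1 :: real^'n) = \<bar>v $ i\<bar>" by simp
  then have "norm v = \<bar>v $ i\<bar>" using v by simp
  with assms have "v $ i = 1" by simp
  with v show ?thesis by simp
qed

text \<open>Transitivity on the unit sphere. The coordinates 3, 5, 7, 4, 2, 6 are cleared in this
  order; from the third rotation on, the plane that turns along consists of coordinates already
  zero, so no zero is lost.\<close>

lemma reach_axis_1:
  assumes H: "contains_exp_g2 H" and sub: "H \<subseteq> G2" and v: "norm v = 1"
  obtains M where "M \<in> H" "M *v v = axis 1 1"
proof -
  note elim = double_rotation_eliminate[OF H]
  obtain M1 where M1: "M1 \<in> H" "(M1 *v v) $ 3 = 0"
    by (rule elim[OF double_rotation_in_g2(1), of v]) auto
  define v1 where "v1 = M1 *v v"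
  have v1: "v1 $ 3 = 0" using M1 by (simp add: v1_def)
  obtain M2 where M2: "M2 \<in> H" "(M2 *v v1) $ 5 = 0" "(M2 *v v1) $ 3 = 0"
    by (rule elim[OF double_rotation_in_g2(2), of v1]) (auto simp: v1)
  define v2 where "v2 = M2 *v v1"
  have v2: "v2 $ 3 = 0" "v2 $ 5 = 0" using M2 by (simp_all add: v2_def)
  obtain M3 where M3: "M3 \<in> H" "(M3 *v v2) $ 7 = 0" "(M3 *v v2) $ 5 = 0" "(M3 *v v2) $ 3 = 0"
    by (rule elim[OF double_rotation_in_g2(3), of v2]) (auto simp: v2)
  define v3 where "v3 = M3 *v v2"
  have v3: "v3 $ 3 = 0" "v3 $ 5 = 0" "v3 $ 7 = 0" using M3 by (simp_all add: v3_def)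
  obtain M4 where M4: "M4 \<in> H" "(M4 *v v3) $ 4 = 0" "(M4 *v v3) $ 5 = 0" "(M4 *v v3) $ 3 = 0"
    "(M4 *v v3) $ 7 = 0"
    by (rule elim[OF double_rotation_in_g2(4), of v3]) (auto simp: v3)
  define v4 where "v4 = M4 *v v3"
  have v4: "v4 $ 3 = 0" "v4 $ 5 = 0" "v4 $ 7 = 0" "v4 $ 4 = 0" using M4 by (simp_all add: v4_def)
  obtain M5 where M5: "M5 \<in> H" "(M5 *v v4) $ 2 = 0" "(M5 *v v4) $ 4 = 0" "(M5 *v v4) $ 7 = 0"
    "(M5 *v v4) $ 3 = 0" "(M5 *v v4) $ 5 = 0"
    by (rule elim[OF double_rotation_in_g2(5), of v4]) (auto simp: v4)
  define v5 where "v5 = M5 *v v4"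
  have v5: "v5 $ 3 = 0" "v5 $ 5 = 0" "v5 $ 7 = 0" "v5 $ 4 = 0" "v5 $ 2 = 0"
    using M5 by (simp_all add: v5_def)
  obtain M6 where M6: "M6 \<in> H" "(M6 *v v5) $ 6 = 0" "0 \<le> (M6 *v v5) $ 1" "(M6 *v v5) $ 5 = 0"
    "(M6 *v v5) $ 2 = 0" "(M6 *v v5) $ 3 = 0" "(M6 *v v5) $ 4 = 0" "(M6 *v v5) $ 7 = 0"
    by (rule elim[OF double_rotation_in_g2(6), of v5]) (auto simp: v5)
  define M where "M = M6 ** (M5 ** (M4 ** (M3 ** (M2 ** M1))))"
  have Mv: "M *v v = M6 *v v5"
    by (simp add: M_def v5_def v4_def v3_def v2_def v1_def flip: matrix_vector_mul_assoc)
  have MH: "M \<in> H"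
    unfolding M_def by (intro contains_exp_g2_mult[OF H] M1(1) M2(1) M3(1) M4(1) M5(1) M6(1))
  moreover have "norm (M *v v) = 1"
    using MH sub v by (auto simp: G2_iff orthogonal_matrix_iff_norm)
  then have "M *v v = axis 1 1"
  proof (rule unit_eq_axis)
    show "(M *v v) $ j = 0" if "j \<noteq> 1" for j
      using that exhaust_7[of j] M6 by (auto simp: Mv)
  qed (use M6 in \<open>simp add: Mv\<close>)
  ultimately show ?thesis by (rule that)
qed

text \<open>None of the rotations used here involves coordinate 1, so all of them fix e1: the
  stabilizer of e1 is transitive on the unit sphere orthogonal to e1.\<close>

lemma reach_axis_2:
  assumes H: "contains_exp_g2 H" and sub: "H \<subseteq> G2" and v: "norm v = 1" "v $ 1 = 0"
  obtains M where "M \<in> H" "M *v v = axis 2 1" "M *v axis 1 1 = axis 1 1"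
proof -
  note elim = double_rotation_eliminate[OF H]
  let ?e = "axis 1 1 :: real^7"
  have e: "?e $ 2 = 0" "?e $ 3 = 0" "?e $ 4 = 0" "?e $ 5 = 0" "?e $ 6 = 0" "?e $ 7 = 0"
    by (simp_all add: axis_def)
  obtain M1 where M1: "M1 \<in> H" "M1 *v ?e = ?e" "(M1 *v v) $ 1 = 0" "(M1 *v v) $ 3 = 0"
    by (rule elim[OF double_rotation_in_g2(1), of v]) (auto simp: v e)
  define v1 where "v1 = M1 *v v"
  have v1: "v1 $ 1 = 0" "v1 $ 3 = 0" using M1 by (simp_all add: v1_def)
  obtain M2 where M2: "M2 \<in> H" "M2 *v ?e = ?e" "(M2 *v v1) $ 1 = 0" "(M2 *v v1) $ 5 = 0" "(M2 *v v1) $ 3 = 0"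
    by (rule elim[OF double_rotation_in_g2(2), of v1]) (auto simp: v1 e)
  define v2 where "v2 = M2 *v v1"
  have v2: "v2 $ 1 = 0" "v2 $ 3 = 0" "v2 $ 5 = 0" using M2 by (simp_all add: v2_def)
  obtain M3 where M3: "M3 \<in> H" "M3 *v ?e = ?e" "(M3 *v v2) $ 1 = 0" "(M3 *v v2) $ 4 = 0"
    "(M3 *v v2) $ 5 = 0" "(M3 *v v2) $ 3 = 0"
    by (rule elim[OF double_rotation_in_g2(4), of v2]) (auto simp: v2 e)
  define v3 where "v3 = M3 *v v2"
  have v3: "v3 $ 1 = 0" "v3 $ 3 = 0" "v3 $ 4 = 0" "v3 $ 5 = 0" using M3 by (simp_all add: v3_def)
  \<comment> \<open>Clearing coordinate 6 turns the plane (2, 3) along and spoils the zero at 3, so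
    the first kind of rotation is applied once more afterwards.\<close>
  obtain M4 where M4: "M4 \<in> H" "M4 *v ?e = ?e" "(M4 *v v3) $ 1 = 0" "(M4 *v v3) $ 6 = 0"
    "(M4 *v v3) $ 4 = 0" "(M4 *v v3) $ 5 = 0"
    by (rule elim[OF double_rotation_in_g2(7), of v3]) (auto simp: v3 e)
  define v4 where "v4 = M4 *v v3"
  have v4: "v4 $ 1 = 0" "v4 $ 6 = 0" "v4 $ 4 = 0" "v4 $ 5 = 0" using M4 by (simp_all add: v4_def)
  obtain M5 where M5: "M5 \<in> H" "M5 *v ?e = ?e" "(M5 *v v4) $ 1 = 0" "(M5 *v v4) $ 3 = 0"
    "(M5 *v v4) $ 4 = 0" "(M5 *v v4) $ 5 = 0" "(M5 *v v4) $ 6 = 0"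
    by (rule elim[OF double_rotation_in_g2(1), of v4]) (auto simp: v4 e)
  define v5 where "v5 = M5 *v v4"
  have v5: "v5 $ 1 = 0" "v5 $ 3 = 0" "v5 $ 4 = 0" "v5 $ 5 = 0" "v5 $ 6 = 0"
    using M5 by (simp_all add: v5_def)
  obtain M6 where M6: "M6 \<in> H" "M6 *v ?e = ?e" "(M6 *v v5) $ 7 = 0" "0 \<le> (M6 *v v5) $ 2"
    "(M6 *v v5) $ 1 = 0" "(M6 *v v5) $ 3 = 0" "(M6 *v v5) $ 4 = 0" "(M6 *v v5) $ 5 = 0" "(M6 *v v5) $ 6 = 0"
    by (rule elim[OF double_rotation_in_g2(8), of v5]) (auto simp: v5 e)
  define M where "M = M6 ** (M5 ** (M4 ** (M3 ** (M2 ** M1))))"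
  have Mv: "M *v v = M6 *v v5"
    by (simp add: M_def v5_def v4_def v3_def v2_def v1_def flip: matrix_vector_mul_assoc)
  have Me: "M *v ?e = ?e"
    by (simp only: M_def matrix_vector_mul_assoc[symmetric] M1(2) M2(2) M3(2) M4(2) M5(2) M6(2))
  have MH: "M \<in> H"
    unfolding M_def by (intro contains_exp_g2_mult[OF H] M1(1) M2(1) M3(1) M4(1) M5(1) M6(1))
  have "norm (M *v v) = 1"
    using MH sub v by (auto simp: G2_iff orthogonal_matrix_iff_norm)
  then have "M *v v = axis 2 1"
  proof (rule unit_eq_axis)
    show "(M *v v) $ j = 0" if "j \<noteq> 2" for j
      using that exhaust_7[of j] M6 by (auto simp: Mv)
  qed (use M6 in \<open>simp add: Mv\<close>)
  with MH Me show ?thesis by (intro that)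
qed

text \<open>On the 3-sphere orthogonal to e1, e2, e3 a single exponential suffices. The rotation
  leads from e4 to v and not back, because in \<open>G2_generated_by_exp\<close> its matrix then
  equals the remaining automorphism.\<close>

lemma reach_from_axis_4:
  assumes H: "contains_exp_g2 H" and v: "norm v = 1" "v $ 1 = 0" "v $ 2 = 0" "v $ 3 = 0"
  obtains M where "M \<in> H" "M *v axis 4 1 = v" "M *v axis 1 1 = axis 1 1" "M *v axis 2 1 = axis 2 1"
proof -
  define r where "r = sqrt ((v$5)\<^sup>2 + (v$6)\<^sup>2 + (v$7)\<^sup>2)"
  have r2: "r\<^sup>2 = (v$5)\<^sup>2 + (v$6)\<^sup>2 + (v$7)\<^sup>2" by (simp add: r_def)
  obtain x y z where xyz: "x\<^sup>2 + y\<^sup>2 + z\<^sup>2 = 1" "v$5 = r * x" "v$6 = r * y" "v$7 = r * z"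
  proof (cases "r = 0")
    case True
    then have "v$5 = 0" "v$6 = 0" "v$7 = 0"
      using r2 by (simp_all add: add_nonneg_eq_0_iff)
    then show ?thesis using that[of 1 0 0] True by simp
  next
    case False
    have "(v$5 / r)\<^sup>2 + (v$6 / r)\<^sup>2 + (v$7 / r)\<^sup>2 = r\<^sup>2 / r\<^sup>2"
      by (simp only: power_divide add_divide_distrib r2)
    also have "\<dots> = 1" using False by simp
    finally show ?thesis using that[of "v$5 / r" "v$6 / r" "v$7 / r"] False by simp
  qed
  have "v \<bullet> v = 1" using v(1) by (simp add: norm_eq_1)
  then have "(v$4)\<^sup>2 + r\<^sup>2 = 1"
    unfolding r2 by (simp add: inner_7 v power2_eq_square)
  then obtain t where t: "v$4 = cos t" "r = sin t" by (rule sincos_total_2pi)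
  \<comment> \<open>With first entry 0 the blocks 1, 2, 3 act only on the coordinates 4 to 7. The
    signs are such that Y sends e4 to the unit vector f with entries x, y, z at 5, 6, 7, and f to
    -e4.\<close>
  define Y where "Y = blk 1 0 (- x) + blk 2 0 (- y) + blk 3 0 (- z)"
  have Yg2: "Y \<in> g2"
    unfolding Y_def by (intro subspace_add[OF subspace_g2] blk_in_g2)
  note comp = Y_def blk_simps block_gen_mult_vec rot_gen_mult_vec matrix_vector_mult_add_rdistrib
    vec_eq_iff forall_7
  define e where "e = (axis 4 1 :: real^7)"
  define f where "f = ((\<chi> i. if i = 5 then x else if i = 6 then y else if i = 7 then z else 0) :: real^7)"
  have Ye: "Y *v e = f"
    by (simp add: comp e_def f_def axis_def)
  have Yf: "Y *v f = - e"
    using xyz(1) by (simp add: comp e_def f_def axis_def) (simp add: power2_eq_square algebra_simps)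
  have fixed: "mat_exp (s *\<^sub>R Y) *v w = w" if "Y *v w = 0" for w s
    using mat_exp_ode_vector[of "\<lambda>_. w" Y s] that by simp
  have "((\<lambda>t. cos t *\<^sub>R e + sin t *\<^sub>R f) has_vector_derivative Y *v (cos t *\<^sub>R e + sin t *\<^sub>R f)) (at t)" for t
    by (auto simp: matrix_vector_right_distrib matrix_vector_mult_scaleR Ye Yf
        intro!: derivative_eq_intros)
  from mat_exp_ode_vector[OF this, of t] have "mat_exp (t *\<^sub>R Y) *v e = cos t *\<^sub>R e + sin t *\<^sub>R f"
    by simp
  also have "\<dots> = v"
    using xyz t v by (simp add: vec_eq_iff forall_7 e_def f_def axis_def)
  finally have "mat_exp (t *\<^sub>R Y) *v e = v" .
  moreover have "mat_exp (t *\<^sub>R Y) *v axis 1 1 = axis 1 1" "mat_exp (t *\<^sub>R Y) *v axis 2 1 = axis 2 1"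
    by (rule fixed; simp add: comp axis_def)+
  moreover have "mat_exp (t *\<^sub>R Y) \<in> H"
    using H subspace_scale[OF subspace_g2 Yg2] by (simp add: contains_exp_g2_def)
  ultimately show ?thesis using that by (simp add: e_def)
qed

lemma G2_eqI:
  assumes M: "M \<in> G2" and N: "N \<in> G2"
    and eq: "M *v axis 1 1 = N *v axis 1 1" "M *v axis 2 1 = N *v axis 2 1" "M *v axis 4 1 = N *v axis 4 1"
  shows "M = N"
proof -
  have prod: "axis 3 1 = cross7 (axis 1 1) (axis 2 1)" "axis 5 1 = cross7 (axis 1 1) (axis 4 1)"
    "axis 6 1 = cross7 (axis 2 1) (axis 4 1)" "axis 7 1 = cross7 (axis 3 1) (axis 4 1)"
    by (simp_all add: vec_eq_iff forall_7 cross7_components axis_def)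
  have cross: "M *v cross7 u v = N *v cross7 u v" if "M *v u = N *v u" "M *v v = N *v v" for u v
    using M N that by (simp add: G2_iff)
  have e3: "M *v axis 3 1 = N *v axis 3 1" unfolding prod by (intro cross eq)
  have "M *v axis i 1 = N *v axis i 1" for i
    using exhaust_7[of i]
  proof (elim disjE)
    assume "i = 5" then show ?thesis unfolding prod by (auto intro: cross eq simp: prod(2))
  next
    assume "i = 6" then show ?thesis by (auto intro: cross eq simp: prod(3))
  next
    assume "i = 7" then show ?thesis by (auto intro: cross eq e3 simp: prod(4))
  qed (use eq e3 in simp_all)
  then show ?thesis
    by (simp add: vec_eq_iff matrix_vector_mult_basis column_def)
qed

theorem G2_generated_by_exp:
  assumes H: "contains_exp_g2 H" and sub: "H \<subseteq> G2" and tr: "\<And>M. M \<in> H \<Longrightarrow> transpose M \<in> H"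
  shows "H = G2"
proof (intro equalityI subsetI)
  fix g
  assume g: "g \<in> G2"
  have norm: "norm (M *v axis i 1) = 1" if "M \<in> G2" for M i
    using that by (simp add: G2_iff orthogonal_matrix_iff_norm)
  have inner: "(M *v u) \<bullet> (M *v v) = u \<bullet> v" if "M \<in> G2" for M u v
    using that orthogonal_transformation_matrix[of "(*v) M"]
    by (simp add: orthogonal_transformation_def matrix_of_matrix_vector_mul G2_iff)
  obtain M1 where M1: "M1 \<in> H" "M1 *v (g *v axis 1 1) = axis 1 1"
    by (rule reach_axis_1[OF H sub norm[OF g]])
  define h1 where "h1 = M1 ** g"
  have h1: "h1 \<in> G2" "h1 *v axis 1 1 = axis 1 1"
    using M1 sub g by (auto simp: h1_def G2_mult simp flip: matrix_vector_mul_assoc)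
  have "(h1 *v axis 2 1) $ 1 = 0"
    using inner[OF h1(1), of "axis 2 1" "axis 1 1"]
    unfolding h1(2) by (simp flip: cart_eq_inner_axis) (simp add: axis_def)
  then obtain M2 where M2: "M2 \<in> H" "M2 *v (h1 *v axis 2 1) = axis 2 1" "M2 *v axis 1 1 = axis 1 1"
    by (rule reach_axis_2[OF H sub norm[OF h1(1)]])
  define h2 where "h2 = M2 ** h1"
  have h2: "h2 \<in> G2" "h2 *v axis 1 1 = axis 1 1" "h2 *v axis 2 1 = axis 2 1"
    using M2 sub h1 by (auto simp: h2_def G2_mult simp flip: matrix_vector_mul_assoc)
  have e3: "h2 *v axis 3 1 = axis 3 1"
  proof -
    have "axis 3 1 = cross7 (axis 1 1) (axis 2 1)"
      by (simp add: vec_eq_iff forall_7 cross7_components axis_def)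
    then show ?thesis using h2 by (simp add: G2_iff)
  qed
  have "(h2 *v axis 4 1) $ 1 = 0" "(h2 *v axis 4 1) $ 2 = 0" "(h2 *v axis 4 1) $ 3 = 0"
    using inner[OF h2(1), of "axis 4 1" "axis 1 1"] inner[OF h2(1), of "axis 4 1" "axis 2 1"]
      inner[OF h2(1), of "axis 4 1" "axis 3 1"]
    unfolding h2(2,3) e3 by (simp_all flip: cart_eq_inner_axis) (simp_all add: axis_def)
  then obtain M3 where M3: "M3 \<in> H" "M3 *v axis 4 1 = h2 *v axis 4 1"
    "M3 *v axis 1 1 = axis 1 1" "M3 *v axis 2 1 = axis 2 1"
    by (rule reach_from_axis_4[OF H norm[OF h2(1)]])
  then have "h2 = M3" using sub h2 by (intro G2_eqI) auto
  then have "M2 ** (M1 ** g) \<in> H" using M3 by (simp add: h2_def h1_def)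
  then have "transpose M1 ** (transpose M2 ** (M2 ** (M1 ** g))) \<in> H"
    by (rule contains_exp_g2_mult[OF H tr[OF M1(1)] contains_exp_g2_mult[OF H tr[OF M2(1)]]])
  moreover have "transpose M2 ** (M2 ** (M1 ** g)) = M1 ** g" "transpose M1 ** (M1 ** g) = g"
    using M1(1) M2(1) sub unfolding matrix_mul_assoc[of "transpose _"]
    by (simp_all add: G2_transpose_mult subset_iff)
  ultimately show "g \<in> H" by simp
qed (use sub in auto)

subsection \<open>The generators\<close>

text \<open>Since \<open>7 = 0\<close> in the index type, the list position of an index is given case by case.\<close>

definition pos7 :: "7 \<Rightarrow> nat" where
  "pos7 i = (if i = 1 then 0 else if i = 2 then 1 else if i = 3 then 2 else if i = 4 then 3
    else if i = 5 then 4 else if i = 6 then 5 else 6)"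

lemma pos7_simps [simp]:
  "pos7 1 = 0" "pos7 2 = 1" "pos7 3 = 2" "pos7 4 = 3" "pos7 5 = 4" "pos7 6 = 5" "pos7 7 = 6"
  by (simp_all add: pos7_def)

definition mat7 :: "real list list \<Rightarrow> real^7^7" where
  "mat7 L = (\<chi> i j. L ! pos7 i ! pos7 j)"

lemma mat7_nth [simp]: "mat7 L $ i $ j = L ! pos7 i ! pos7 j"
  by (simp add: mat7_def)

text \<open>A commutator of imaginary octonions is twice their cross product, so the double
  commutator is four times \<open>cross7 (cross7 a b) x\<close>. Three times the associator removes
  three of these and contributes the other terms.\<close>

lemma inner_der_imaginary:
  "snd (inner_der (0, a) (0, b) (0, x)) = cross7 (cross7 a b) x + (3 * (a \<bullet> b)) *\<^sub>R x
    - (3 * (b \<bullet> x)) *\<^sub>R a + 3 *\<^sub>R cross7 a (cross7 b x)"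
  by (simp add: vec_eq_iff forall_7 inner_der_def oct_commutator_def oct_associator_def oct_mult_eq
      cross7_components inner_7) (simp add: algebra_simps)

lemma D_matrix_nth:
  "D_matrix i j $ k $ l = (cross7 (cross7 (im_unit i) (im_unit j)) (im_unit l)
    + (3 * (im_unit i \<bullet> im_unit j)) *\<^sub>R im_unit l - (3 * (im_unit j \<bullet> im_unit l)) *\<^sub>R im_unit i
    + 3 *\<^sub>R cross7 (im_unit i) (cross7 (im_unit j) (im_unit l))) $ k"
  unfolding D_matrix_def im_matrix_def matrix_def oct_unit_def inner_der_imaginary by simp

lemma X_mat_eq: "X_mat = mat7
  [[0, 2, -2, 0, 0, 0, 0], [-2, 0, 0, 0, 0, 0, 0], [2, 0, 0, 0, 0, 0, 0], [0, 0, 0, 0, 0, -4, -4],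
   [0, 0, 0, 0, 0, -2, 2], [0, 0, 0, 4, 2, 0, 0], [0, 0, 0, 4, -2, 0, 0]]"
  by (simp add: X_mat_def vec_eq_iff forall_7 D_matrix_nth cross7_components inner_axis_axis)
    (simp add: axis_def)

lemma X_mat_blk: "X_mat = blk 2 2 (-4) + blk 3 2 (-4)"
  by (simp add: X_mat_eq vec_eq_iff forall_7 blk_simps block_gen_def rot_gen_def)

lemma X_mat_in_g2: "X_mat \<in> g2"
  unfolding X_mat_blk by (intro subspace_add[OF subspace_g2] blk_in_g2)

lemma X_mat_nonzero: "X_mat \<noteq> 0"
  by (simp add: X_mat_eq vec_eq_iff forall_7)

lemma matrix_mult_7_nth:
  "(M ** N) $ i $ j = M$i$1 * N$1$j + M$i$2 * N$2$j + M$i$3 * N$3$j + M$i$4 * N$4$j + M$i$5 * N$5$j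
    + M$i$6 * N$6$j + M$i$7 * N$7$j" for M N :: "real^7^7"
  by (simp add: matrix_matrix_mult_def sum_7)

lemma matrix_vector_mult_7_nth:
  "(M *v v) $ i = M$i$1 * v$1 + M$i$2 * v$2 + M$i$3 * v$3 + M$i$4 * v$4 + M$i$5 * v$5
    + M$i$6 * v$6 + M$i$7 * v$7" for M :: "real^7^7"
  by (simp add: matrix_vector_mult_def sum_7)

text \<open>X annihilates e2 + e3 and turns the orthogonal complement at the speeds 2 sqrt 2 (twice)
  and 4 sqrt 2, whence the angles \<theta> and 2 \<theta>.\<close>

lemma mat_exp_X_mat:
  assumes \<theta>: "\<theta> = 2 * sqrt 2 * t"
  shows "mat_exp (t *\<^sub>R X_mat) = mat7
   [[cos \<theta>, sqrt 2 / 2 * sin \<theta>, - (sqrt 2 / 2) * sin \<theta>, 0, 0, 0, 0],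
    [- (sqrt 2 / 2) * sin \<theta>, (1 + cos \<theta>) / 2, (1 - cos \<theta>) / 2, 0, 0, 0, 0],
    [sqrt 2 / 2 * sin \<theta>, (1 - cos \<theta>) / 2, (1 + cos \<theta>) / 2, 0, 0, 0, 0],
    [0, 0, 0, cos (2 * \<theta>), 0, - (sqrt 2 / 2) * sin (2 * \<theta>), - (sqrt 2 / 2) * sin (2 * \<theta>)],
    [0, 0, 0, 0, cos \<theta>, - (sqrt 2 / 2) * sin \<theta>, sqrt 2 / 2 * sin \<theta>],
    [0, 0, 0, sqrt 2 / 2 * sin (2 * \<theta>), sqrt 2 / 2 * sin \<theta>, (cos \<theta> + cos (2 * \<theta>)) / 2, (cos (2 * \<theta>) - cos \<theta>) / 2],
    [0, 0, 0, sqrt 2 / 2 * sin (2 * \<theta>), - (sqrt 2 / 2) * sin \<theta>, (cos (2 * \<theta>) - cos \<theta>) / 2, (cos \<theta> + cos (2 * \<theta>)) / 2]]"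
proof -
  define f where "f = (\<lambda>t. let \<theta> = 2 * sqrt 2 * t in mat7
   [[cos \<theta>, sqrt 2 / 2 * sin \<theta>, - (sqrt 2 / 2) * sin \<theta>, 0, 0, 0, 0],
    [- (sqrt 2 / 2) * sin \<theta>, (1 + cos \<theta>) / 2, (1 - cos \<theta>) / 2, 0, 0, 0, 0],
    [sqrt 2 / 2 * sin \<theta>, (1 - cos \<theta>) / 2, (1 + cos \<theta>) / 2, 0, 0, 0, 0],
    [0, 0, 0, cos (2 * \<theta>), 0, - (sqrt 2 / 2) * sin (2 * \<theta>), - (sqrt 2 / 2) * sin (2 * \<theta>)],
    [0, 0, 0, 0, cos \<theta>, - (sqrt 2 / 2) * sin \<theta>, sqrt 2 / 2 * sin \<theta>],
    [0, 0, 0, sqrt 2 / 2 * sin (2 * \<theta>), sqrt 2 / 2 * sin \<theta>, (cos \<theta> + cos (2 * \<theta>)) / 2, (cos (2 * \<theta>) - cos \<theta>) / 2],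
    [0, 0, 0, sqrt 2 / 2 * sin (2 * \<theta>), - (sqrt 2 / 2) * sin \<theta>, (cos (2 * \<theta>) - cos \<theta>) / 2, (cos \<theta> + cos (2 * \<theta>)) / 2]])"
  have "(f has_vector_derivative X_mat ** f t) (at t)" for t
  proof (intro has_vector_derivative_vecI)
    fix i j
    show "((\<lambda>t. f t $ i $ j) has_vector_derivative (X_mat ** f t) $ i $ j) (at t)"
      unfolding matrix_mult_7_nth
      using exhaust_7[of i] exhaust_7[of j]
      by (elim disjE; simp add: f_def Let_def X_mat_eq flip: has_real_derivative_iff_has_vector_derivative;
        auto intro!: derivative_eq_intros simp: field_simps)
  qed
  from mat_exp_ode_matrix[OF this, of t] have "f t = mat_exp (t *\<^sub>R X_mat) ** f 0" .
  moreover have "f 0 = mat 1"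
    by (simp add: f_def vec_eq_iff forall_7 mat_def)
  ultimately have "mat_exp (t *\<^sub>R X_mat) = f t" by simp
  then show ?thesis by (simp only: f_def Let_def \<theta>)
qed

lemma A_mat_eq: "A_mat = mat7
   [[sqrt 2 / 2, 1 / 2, - (1 / 2), 0, 0, 0, 0],
    [- (1 / 2), 1 / 2 + sqrt 2 / 4, 1 / 2 - sqrt 2 / 4, 0, 0, 0, 0],
    [1 / 2, 1 / 2 - sqrt 2 / 4, 1 / 2 + sqrt 2 / 4, 0, 0, 0, 0],
    [0, 0, 0, 0, 0, - (sqrt 2 / 2), - (sqrt 2 / 2)],
    [0, 0, 0, 0, sqrt 2 / 2, - (1 / 2), 1 / 2],
    [0, 0, 0, sqrt 2 / 2, 1 / 2, sqrt 2 / 4, - (sqrt 2 / 4)],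
    [0, 0, 0, sqrt 2 / 2, - (1 / 2), - (sqrt 2 / 4), sqrt 2 / 4]]"
proof -
  \<comment> \<open>For A the slow angle is pi / 4 and the fast one is pi / 2.\<close>
  have "pi / 4 = 2 * sqrt 2 * (pi / (8 * sqrt 2))" by simp
  from mat_exp_X_mat[OF this] show ?thesis
    by (simp add: A_mat_def sin_45 cos_45 vec_eq_iff forall_7 add_divide_distrib diff_divide_distrib)
qed

lemma S_mat_eq: "S_mat = mat7
   [[1, 0, 0, 0, 0, 0, 0], [0, 0, 0, 1, 0, 0, 0], [0, 0, 0, 0, 1, 0, 0], [0, 1, 0, 0, 0, 0, 0],
    [0, 0, 1, 0, 0, 0, 0], [0, 0, 0, 0, 0, -1, 0], [0, 0, 0, 0, 0, 0, -1]]"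
  by (simp add: S_mat_def matrix_def vec_eq_iff forall_7) (simp add: axis_def)

lemma A_mat_in_G2: "A_mat \<in> G2"
  unfolding A_mat_def by (rule mat_exp_in_G2[OF X_mat_in_g2])

lemma S_mat_in_G2: "S_mat \<in> G2"
  unfolding G2_iff orthogonal_matrix
proof (intro conjI allI)
  show "transpose S_mat ** S_mat = mat 1"
    by (simp add: S_mat_eq vec_eq_iff forall_7 matrix_mult_7_nth transpose_def mat_def)
  show "S_mat *v cross7 u v = cross7 (S_mat *v u) (S_mat *v v)" for u v
    by (simp add: S_mat_eq vec_eq_iff forall_7 matrix_vector_mult_7_nth cross7_components)
qed

abbreviation A2_mat :: "real^7^7" where "A2_mat \<equiv> A_mat ** A_mat"
abbreviation A4_mat :: "real^7^7" where "A4_mat \<equiv> A2_mat ** A2_mat"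

lemma A2_mat_eq: "A2_mat = mat7
   [[0, sqrt 2 / 2, - (sqrt 2 / 2), 0, 0, 0, 0],
    [- (sqrt 2 / 2), 1 / 2, 1 / 2, 0, 0, 0, 0],
    [sqrt 2 / 2, 1 / 2, 1 / 2, 0, 0, 0, 0],
    [0, 0, 0, -1, 0, 0, 0],
    [0, 0, 0, 0, 0, - (sqrt 2 / 2), sqrt 2 / 2],
    [0, 0, 0, 0, sqrt 2 / 2, - (1 / 2), - (1 / 2)],
    [0, 0, 0, 0, - (sqrt 2 / 2), - (1 / 2), - (1 / 2)]]"
  by (simp add: A_mat_eq vec_eq_iff forall_7 matrix_mult_7_nth) (simp add: field_simps)

text \<open>The fourth power has the angles pi and 2 pi, so it is an involution; here it is even a
  signed permutation of the units.\<close>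

lemma A4_mat_eq: "A4_mat = mat7
   [[-1, 0, 0, 0, 0, 0, 0], [0, 0, 1, 0, 0, 0, 0], [0, 1, 0, 0, 0, 0, 0], [0, 0, 0, 1, 0, 0, 0],
    [0, 0, 0, 0, -1, 0, 0], [0, 0, 0, 0, 0, 0, 1], [0, 0, 0, 0, 0, 1, 0]]"
  by (simp add: A2_mat_eq vec_eq_iff forall_7 matrix_mult_7_nth)

subsection \<open>Irreducibility of the adjoint action\<close>

text \<open>Coordinates on \<open>g2\<close>, two for each block. In them conjugation is an explicit
  linear substitution, and membership in a subspace is transferred coordinate by coordinate.\<close>

definition gel :: "real \<Rightarrow> real \<Rightarrow> real \<Rightarrow> real \<Rightarrow> real \<Rightarrow> real \<Rightarrow> real \<Rightarrow> real \<Rightarrow> real \<Rightarrow> real \<Rightarrow> real \<Rightarrow>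
    real \<Rightarrow> real \<Rightarrow> real \<Rightarrow> real^7^7" where
  "gel x1 y1 x2 y2 x3 y3 x4 y4 x5 y5 x6 y6 x7 y7 = blk 1 x1 y1 + blk 2 x2 y2 + blk 3 x3 y3 + blk 4 x4 y4 + blk 5 x5 y5
    + blk 6 x6 y6 + blk 7 x7 y7"

lemma gel_in_g2: "gel x1 y1 x2 y2 x3 y3 x4 y4 x5 y5 x6 y6 x7 y7 \<in> g2"
  unfolding gel_def by (intro subspace_add[OF subspace_g2] blk_in_g2)

lemma g2_gel:
  "M \<in> g2 \<Longrightarrow> M = gel (M$2$3) (M$4$5) (M$3$1) (M$4$6) (M$1$2) (M$4$7) (M$5$1) (M$6$2)
    (M$1$4) (M$7$2) (M$2$4) (M$5$3) (M$6$1) (M$2$5)"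
  unfolding gel_def by (rule g2_decomposition)

lemma gel_nth:
  "gel x1 y1 x2 y2 x3 y3 x4 y4 x5 y5 x6 y6 x7 y7 $ i $ j =
   [[0, x3, - x2, x5, - x4, - x7, - x6 - y6],
    [- x3, 0, x1, x6, y7, - y4, - y5],
    [x2, - x1, 0, - x7 - y7, - y6, - x5 - y5, x4 + y4],
    [- x5, - x6, x7 + y7, 0, y1, y2, y3],
    [x4, - y7, y6, - y1, 0, x3 + y3, - x2 - y2],
    [x7, y4, x5 + y5, - y2, - x3 - y3, 0, x1 + y1],
    [x6 + y6, y5, - x4 - y4, - y3, x2 + y2, - x1 - y1, 0]] ! pos7 i ! pos7 j"
  using exhaust_7[of i] exhaust_7[of j]
  by (elim disjE; simp add: gel_def blk_simps block_gen_def rot_gen_def)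

lemma gel_cong:
  assumes "x1 = x1'" "y1 = y1'" "x2 = x2'" "y2 = y2'" "x3 = x3'" "y3 = y3'" "x4 = x4'" "y4 = y4'" "x5 = x5'" "y5 = y5'" "x6 = x6'" "y6 = y6'" "x7 = x7'" "y7 = y7'"
  shows "gel x1 y1 x2 y2 x3 y3 x4 y4 x5 y5 x6 y6 x7 y7 = gel x1' y1' x2' y2' x3' y3' x4' y4' x5' y5' x6' y6' x7' y7'"
  using assms by simp

lemma sqrt2_mult_sqrt2: "sqrt 2 * sqrt 2 = 2" "sqrt 2 * (sqrt 2 * x) = 2 * x"
  by simp (simp flip: mult.assoc)

lemma gel_add: "gel x1 y1 x2 y2 x3 y3 x4 y4 x5 y5 x6 y6 x7 y7 + gel x1' y1' x2' y2' x3' y3' x4' y4' x5' y5' x6' y6' x7' y7' =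
    gel (x1 + x1') (y1 + y1') (x2 + x2') (y2 + y2') (x3 + x3') (y3 + y3') (x4 + x4') (y4 + y4') (x5 + x5') (y5 + y5') (x6 + x6') (y6 + y6') (x7 + x7') (y7 + y7')"
  by (simp add: gel_def flip: blk_add)

lemma gel_scaleR: "c *\<^sub>R gel x1 y1 x2 y2 x3 y3 x4 y4 x5 y5 x6 y6 x7 y7 =
    gel (c * x1) (c * y1) (c * x2) (c * y2) (c * x3) (c * y3) (c * x4) (c * y4) (c * x5) (c * y5) (c * x6) (c * y6) (c * x7) (c * y7)"
  by (simp add: gel_def scaleR_add_right blk_scaleR)

definition conj_mat :: "real^7^7 \<Rightarrow> real^7^7 \<Rightarrow> real^7^7" where
  "conj_mat P M = P ** M ** transpose P"

text \<open>The conjugate lies in \<open>g2\<close> by \<open>g2_conj\<close>, so fourteen entries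
  determine it. Blocks 1 to 3 stay apart from blocks 4 to 7 because A preserves the span of e1, e2,
  e3 and that of e4, ..., e7.\<close>

lemma conj_A_mat_gel:
  "conj_mat A_mat (gel x1 y1 x2 y2 x3 y3 x4 y4 x5 y5 x6 y6 x7 y7) =
    gel
      (sqrt 2 * x1 / 2 + x2 / 2 - x3 / 2) (- sqrt 2 * x1 / 2 - sqrt 2 * y1 / 2 - x2 / 2 - y2 / 2
      + x3 / 2 + y3 / 2) (- x1 / 2 + x2 / 2 + sqrt 2 * x2 / 4 + x3 / 2 - sqrt 2 * x3 / 4) (x1 /
      2 + y1 / 2 - sqrt 2 * x2 / 4 + y2 / 2 - sqrt 2 * y2 / 4 + sqrt 2 * x3 / 4 + y3 / 2 + sqrt
      2 * y3 / 4) (x1 / 2 + x2 / 2 - sqrt 2 * x2 / 4 + x3 / 2 + sqrt 2 * x3 / 4) (- x1 / 2 - y1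
      / 2 + sqrt 2 * x2 / 4 + y2 / 2 + sqrt 2 * y2 / 4 - sqrt 2 * x3 / 4 + y3 / 2 - sqrt 2 * y3
      / 4) (3 * x4 / 4 + x5 / 4 + y5 / 2 + sqrt 2 * x6 / 4 - sqrt 2 * x7 / 4 - sqrt 2 * y7 / 4)
      (- 3 * x4 / 8 + sqrt 2 * x4 / 8 + sqrt 2 * y4 / 4 - x5 / 8 + 3 * sqrt 2 * x5 / 8 - y5 / 4
      - x6 / 4 - sqrt 2 * x6 / 8 + y6 / 4 - x7 / 4 + sqrt 2 * x7 / 8 - y7 / 2 + sqrt 2 * y7 / 8)
      (sqrt 2 * x4 / 4 + sqrt 2 * y4 / 2 - sqrt 2 * x5 / 4 + x6 / 2 + y6 / 2 + x7 / 2) (3 * x4 /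
      8 - sqrt 2 * x4 / 8 - sqrt 2 * y4 / 4 + x5 / 8 + sqrt 2 * x5 / 8 + y5 / 4 - x6 / 4 - 3 *
      sqrt 2 * x6 / 8 - y6 / 4 - x7 / 4 + 3 * sqrt 2 * x7 / 8 + 3 * sqrt 2 * y7 / 8) (x4 / 4 -
      sqrt 2 * x4 / 4 + y4 / 2 - x5 / 4 + sqrt 2 * x5 / 4 + sqrt 2 * y5 / 2 - sqrt 2 * x6 / 4 -
      sqrt 2 * y6 / 4 - sqrt 2 * x7 / 4) (- x4 / 4 + sqrt 2 * x4 / 8 - y4 / 2 - x5 / 4 - sqrt 2
      * x5 / 8 - sqrt 2 * y5 / 4 + x6 / 4 + y6 / 2 + sqrt 2 * y6 / 4 - x7 / 4 + y7 / 4 - sqrt 2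
      * y7 / 4) (sqrt 2 * x4 / 8 - x5 / 2 - sqrt 2 * x5 / 8 - sqrt 2 * y5 / 4 - x6 / 4 - sqrt 2
      * x6 / 4 - y6 / 2 + x7 / 4 - sqrt 2 * x7 / 4 - y7 / 4 - sqrt 2 * y7 / 4) (x4 / 4 + sqrt 2
      * x4 / 8 + y4 / 2 + x5 / 4 - sqrt 2 * x5 / 8 - sqrt 2 * y5 / 4 + x6 / 4 + y6 / 2 - sqrt 2
      * y6 / 4 - x7 / 4 + y7 / 4 + sqrt 2 * y7 / 4)"
proof -
  have "A_mat \<in> G2" by (intro G2_mult A_mat_in_G2 S_mat_in_G2)
  then have "conj_mat A_mat (gel x1 y1 x2 y2 x3 y3 x4 y4 x5 y5 x6 y6 x7 y7) \<in> g2"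
    unfolding conj_mat_def by (intro g2_conj gel_in_g2)
  note eq = g2_gel[OF this]
  show ?thesis
    by (rule trans[OF eq gel_cong]; simp add: conj_mat_def matrix_mult_7_nth transpose_def gel_nth A_mat_eq;
      simp add: field_simps sqrt2_mult_sqrt2)
qed

lemma conj_A2_mat_gel:
  "conj_mat A2_mat (gel x1 y1 x2 y2 x3 y3 x4 y4 x5 y5 x6 y6 x7 y7) =
    gel
      (sqrt 2 * x2 / 2 - sqrt 2 * x3 / 2) (sqrt 2 * y2 / 2 - sqrt 2 * y3 / 2) (- sqrt 2 * x1 / 2
      + x2 / 2 + x3 / 2) (- sqrt 2 * y1 / 2 + y2 / 2 + y3 / 2) (sqrt 2 * x1 / 2 + x2 / 2 + x3 /
      2) (sqrt 2 * y1 / 2 + y2 / 2 + y3 / 2) (x4 / 2 + x5 / 2 + y5) (- x4 / 4 - x5 / 4 - y5 / 2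
      + sqrt 2 * x6 / 4 + sqrt 2 * y6 / 2 + sqrt 2 * x7 / 4 - sqrt 2 * y7 / 4) (- sqrt 2 * x6 /
      2 - sqrt 2 * x7 / 2 - sqrt 2 * y7 / 2) (3 * x4 / 4 - x5 / 4 - y5 / 2 + sqrt 2 * x6 / 4 +
      sqrt 2 * x7 / 4 + sqrt 2 * y7 / 4) (sqrt 2 * x5 / 2 - x6 / 2 + x7 / 2 + y7 / 2) (- sqrt 2
      * x4 / 4 - sqrt 2 * y4 / 2 - sqrt 2 * x5 / 4 + x6 / 2 + y6 / 2 - x7 / 2) (- sqrt 2 * x4 /
      4 - sqrt 2 * y4 / 2 + sqrt 2 * x5 / 4 - y6 / 2 - y7 / 2) (sqrt 2 * x4 / 4 + sqrt 2 * y4 /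
      2 + sqrt 2 * x5 / 4 + x6 / 2 + y6 / 2 - x7 / 2)"
proof -
  have "A2_mat \<in> G2" by (intro G2_mult A_mat_in_G2 S_mat_in_G2)
  then have "conj_mat A2_mat (gel x1 y1 x2 y2 x3 y3 x4 y4 x5 y5 x6 y6 x7 y7) \<in> g2"
    unfolding conj_mat_def by (intro g2_conj gel_in_g2)
  note eq = g2_gel[OF this]
  show ?thesis
    by (rule trans[OF eq gel_cong]; simp add: conj_mat_def matrix_mult_7_nth transpose_def gel_nth A2_mat_eq;
      simp add: field_simps sqrt2_mult_sqrt2)
qed

lemma conj_A4_mat_gel:
  "conj_mat A4_mat (gel x1 y1 x2 y2 x3 y3 x4 y4 x5 y5 x6 y6 x7 y7) =
    gel
      (- x1) (- y1) (x3) (y3) (x2) (y2) (x4) (- x4 - y4) (- x5) (x5 + y5) (- x7 - y7) (y7) (- x6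
      - y6) (y6)"
proof -
  have "A4_mat \<in> G2" by (intro G2_mult A_mat_in_G2 S_mat_in_G2)
  then have "conj_mat A4_mat (gel x1 y1 x2 y2 x3 y3 x4 y4 x5 y5 x6 y6 x7 y7) \<in> g2"
    unfolding conj_mat_def by (intro g2_conj gel_in_g2)
  note eq = g2_gel[OF this]
  show ?thesis
    by (rule trans[OF eq gel_cong]; simp add: conj_mat_def matrix_mult_7_nth transpose_def gel_nth A4_mat_eq;
      simp add: field_simps sqrt2_mult_sqrt2)
qed

text \<open>As S exchanges e2 with e4 and e3 with e5, it exchanges block 2 with block 4 and block 3
  with block 5. This links the two groups of blocks that A keeps apart.\<close>

lemma conj_S_mat_gel:
  "conj_mat S_mat (gel x1 y1 x2 y2 x3 y3 x4 y4 x5 y5 x6 y6 x7 y7) =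
    gel
      (y1) (x1) (x4) (y4) (x5) (y5) (x2) (y2) (x3) (y3) (- x6) (- y6) (- x7) (x7 + y7)"
proof -
  have "S_mat \<in> G2" by (intro G2_mult A_mat_in_G2 S_mat_in_G2)
  then have "conj_mat S_mat (gel x1 y1 x2 y2 x3 y3 x4 y4 x5 y5 x6 y6 x7 y7) \<in> g2"
    unfolding conj_mat_def by (intro g2_conj gel_in_g2)
  note eq = g2_gel[OF this]
  show ?thesis
    by (rule trans[OF eq gel_cong]; simp add: conj_mat_def matrix_mult_7_nth transpose_def gel_nth S_mat_eq;
      simp add: field_simps sqrt2_mult_sqrt2)
qed

section \<open>Conjugation as an orthogonal representation, and its invariant subspaces\<close>

lemma conj_mat_mult: "conj_mat P (conj_mat Q M) = conj_mat (P ** Q) M"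
  by (simp add: conj_mat_def matrix_transpose_mul matrix_mul_assoc)

lemma linear_conj_mat: "linear (conj_mat P)"
  by (simp add: linear_iff conj_mat_def matrix_add_ldistrib matrix_add_rdistrib matrix_scalar_ac
      flip: scalar_matrix_assoc)

lemma conj_mat_transpose_inverse:
  "P \<in> G2 \<Longrightarrow> conj_mat (transpose P) (conj_mat P M) = M"
  "P \<in> G2 \<Longrightarrow> conj_mat P (conj_mat (transpose P) M) = M"
  by (simp_all add: conj_mat_mult G2_transpose_mult) (simp_all add: conj_mat_def transpose_mat)

text \<open>Conjugation by an orthogonal matrix preserves the Frobenius norm, so its adjoint is
  conjugation by the inverse. This is why orthogonal complements of invariant subspaces are
  invariant.\<close>

lemma inner_conj_mat:
  assumes P: "P \<in> G2"
  shows "conj_mat P M \<bullet> N = M \<bullet> conj_mat (transpose P) N"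
proof -
  have "norm (conj_mat P M) = norm M" for M
    using G2_orthogonal[OF P] G2_orthogonal[OF G2_transpose[OF P]]
    by (simp add: conj_mat_def norm_matrix_mult_orthogonal_left norm_matrix_mult_orthogonal_right)
  then have "orthogonal_transformation (conj_mat P)"
    by (simp add: orthogonal_transformation linear_conj_mat)
  then have "conj_mat P M \<bullet> conj_mat P (conj_mat (transpose P) N) = M \<bullet> conj_mat (transpose P) N"
    by (simp add: orthogonal_transformation_def)
  then show ?thesis by (simp add: conj_mat_transpose_inverse P)
qed

text \<open>Only the two generators are mentioned: having orders 8 and 2, they have their inverses
  among their powers.\<close>

definition ad_invariant :: "(real^7^7) set \<Rightarrow> bool" where
  "ad_invariant W \<longleftrightarrow> subspace W \<and> W \<subseteq> g2 \<and>
    (\<forall>M\<in>W. conj_mat A_mat M \<in> W \<and> conj_mat S_mat M \<in> W)"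

lemma gel_mem_cong:
  assumes "gel x1 y1 x2 y2 x3 y3 x4 y4 x5 y5 x6 y6 x7 y7 \<in> W" "x1 = x1'" "y1 = y1'" "x2 = x2'" "y2 = y2'" "x3 = x3'" "y3 = y3'" "x4 = x4'" "y4 = y4'" "x5 = x5'" "y5 = y5'" "x6 = x6'" "y6 = y6'" "x7 = x7'" "y7 = y7'"
  shows "gel x1' y1' x2' y2' x3' y3' x4' y4' x5' y5' x6' y6' x7' y7' \<in> W"
  using assms by simp

lemma ad_invariantD:
  assumes "ad_invariant W" "M \<in> W"
  shows "conj_mat A_mat M \<in> W" "conj_mat S_mat M \<in> W" "conj_mat A2_mat M \<in> W" "conj_mat A4_mat M \<in> W"
  using assms by (simp_all add: ad_invariant_def flip: conj_mat_mult)

lemma ad_invariant_lin: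
  assumes "ad_invariant W" "M \<in> W" "N \<in> W"
  shows "a *\<^sub>R M + b *\<^sub>R N \<in> W"
  using assms unfolding ad_invariant_def by (intro subspace_add subspace_scale) auto

lemma blk_zero: "blk k 0 0 = 0"
  using blk_scaleR[of 0 k 0 0] by simp

text \<open>
  The matrix below spans, together with its image under conjugation by \<open>A_mat\<close>, the eigenspace
  of \<open>conj_mat A_mat\<close> for the eigenvalues \<open>\<plusminus>\<i>\<close>, that is, for the short root of largest value at \<open>X_mat\<close>.
\<close>

abbreviation root_mat :: "real^7^7" where
  "root_mat \<equiv> gel 0 0 0 0 0 0 2 (-1) 0 (-3) 0 0 0 0"

text \<open>S moves the given matrix into blocks 2 and 3, where A and its powers isolate one
  direction in each of the blocks 1, 2, 3. S carries two of these to blocks 4 and 5, where A^4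
  supplies the second directions, and back. Blocks 6 and 7 are reached from blocks 4 and 5 by
  A.\<close>

lemma ad_invariant_root_mat_imp_g2:
  assumes W: "ad_invariant W" and root: "root_mat \<in> W"
  shows "g2 \<subseteq> W"
proof -
  note A = ad_invariantD(1)[OF W]
  note S = ad_invariantD(2)[OF W]
  note A2 = ad_invariantD(3)[OF W]
  note A4 = ad_invariantD(4)[OF W]
  note lin = ad_invariant_lin[OF W]
  have p: "gel 0 0 2 (-1) 0 (-3) 0 0 0 0 0 0 0 0 \<in> W"
    by (rule gel_mem_cong[OF S[OF root, unfolded conj_S_mat_gel]]; simp add: field_simps sqrt2_mult_sqrt2)
  have q: "gel 1 (-2) (1 + sqrt 2 / 2) (-2 - sqrt 2) (1 - sqrt 2 / 2) (-2 + sqrt 2) 0 0 0 0 0 0 0 0 \<in> W"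
    by (rule gel_mem_cong[OF A[OF p, unfolded conj_A_mat_gel]]; simp add: field_simps sqrt2_mult_sqrt2)
  \<comment> \<open>A^2 acts on q like replacing sqrt 2 by its negative, so sums and differences
    with q isolate the rational and the irrational part.\<close>
  have q': "gel 1 (-2) (1 - sqrt 2 / 2) (-2 + sqrt 2) (1 + sqrt 2 / 2) (-2 - sqrt 2) 0 0 0 0 0 0 0 0 \<in> W"
    by (rule gel_mem_cong[OF A2[OF q, unfolded conj_A2_mat_gel]]; simp add: field_simps sqrt2_mult_sqrt2)
  have g: "gel 1 (-2) 1 (-2) 1 (-2) 0 0 0 0 0 0 0 0 \<in> W"
    by (rule gel_mem_cong[OF lin[OF q q', of "1 / 2" "1 / 2", unfolded gel_scaleR gel_add]]; simp add: field_simps sqrt2_mult_sqrt2)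
  have g': "gel (-1) 2 1 (-2) 1 (-2) 0 0 0 0 0 0 0 0 \<in> W"
    by (rule gel_mem_cong[OF A4[OF g, unfolded conj_A4_mat_gel]]; simp add: field_simps sqrt2_mult_sqrt2)
  have b1: "gel 1 (-2) 0 0 0 0 0 0 0 0 0 0 0 0 \<in> W"
    by (rule gel_mem_cong[OF lin[OF g g', of "1 / 2" "-1 / 2", unfolded gel_scaleR gel_add]]; simp add: field_simps sqrt2_mult_sqrt2)
  have h: "gel 0 0 1 (-2) 1 (-2) 0 0 0 0 0 0 0 0 \<in> W"
    by (rule gel_mem_cong[OF lin[OF g b1, of "1" "-1", unfolded gel_scaleR gel_add]]; simp add: field_simps sqrt2_mult_sqrt2)
  have e: "gel 0 0 1 (-2) (-1) 2 0 0 0 0 0 0 0 0 \<in> W"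
    by (rule gel_mem_cong[OF lin[OF q q', of "1 / sqrt 2" "-1 / sqrt 2", unfolded gel_scaleR gel_add]]; simp add: field_simps sqrt2_mult_sqrt2)
  have b2: "gel 0 0 1 (-2) 0 0 0 0 0 0 0 0 0 0 \<in> W"
    by (rule gel_mem_cong[OF lin[OF h e, of "1 / 2" "1 / 2", unfolded gel_scaleR gel_add]]; simp add: field_simps sqrt2_mult_sqrt2)
  have b3: "gel 0 0 0 0 1 (-2) 0 0 0 0 0 0 0 0 \<in> W"
    by (rule gel_mem_cong[OF lin[OF h e, of "1 / 2" "-1 / 2", unfolded gel_scaleR gel_add]]; simp add: field_simps sqrt2_mult_sqrt2)
  have b4: "gel 0 0 0 0 0 0 1 (-2) 0 0 0 0 0 0 \<in> W"
    by (rule gel_mem_cong[OF S[OF b2, unfolded conj_S_mat_gel]]; simp add: field_simps sqrt2_mult_sqrt2)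
  have b5: "gel 0 0 0 0 0 0 0 0 1 (-2) 0 0 0 0 \<in> W"
    by (rule gel_mem_cong[OF S[OF b3, unfolded conj_S_mat_gel]]; simp add: field_simps sqrt2_mult_sqrt2)
  have b4': "gel 0 0 0 0 0 0 1 1 0 0 0 0 0 0 \<in> W"
    by (rule gel_mem_cong[OF A4[OF b4, unfolded conj_A4_mat_gel]]; simp add: field_simps sqrt2_mult_sqrt2)
  have b5': "gel 0 0 0 0 0 0 0 0 (-1) (-1) 0 0 0 0 \<in> W"
    by (rule gel_mem_cong[OF A4[OF b5, unfolded conj_A4_mat_gel]]; simp add: field_simps sqrt2_mult_sqrt2)
  \<comment> \<open>The pairs (1, -2) and (1, 1) form a basis of the coordinate plane of a block;
    these are the coefficients of (x, y) in it.\<close>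
  have B4: "gel 0 0 0 0 0 0 x y 0 0 0 0 0 0 \<in> W" for x y
    by (rule gel_mem_cong[OF lin[OF b4 b4', of "(x - y) / 3" "(2 * x + y) / 3", unfolded gel_scaleR gel_add]]; simp add: field_simps sqrt2_mult_sqrt2)
  have B5: "gel 0 0 0 0 0 0 0 0 x y 0 0 0 0 \<in> W" for x y
    by (rule gel_mem_cong[OF lin[OF b5 b5', of "(x - y) / 3" "- (2 * x + y) / 3", unfolded gel_scaleR gel_add]]; simp add: field_simps sqrt2_mult_sqrt2)
  have B2: "gel 0 0 x y 0 0 0 0 0 0 0 0 0 0 \<in> W" for x y
    by (rule gel_mem_cong[OF S[OF B4, unfolded conj_S_mat_gel]]; simp add: field_simps sqrt2_mult_sqrt2)
  have B3: "gel 0 0 0 0 x y 0 0 0 0 0 0 0 0 \<in> W" for x y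
    by (rule gel_mem_cong[OF S[OF B5, unfolded conj_S_mat_gel]]; simp add: field_simps sqrt2_mult_sqrt2)
  have a2p: "gel (sqrt 2) (sqrt 2) 1 (-2) 1 (-2) 0 0 0 0 0 0 0 0 \<in> W"
    by (rule gel_mem_cong[OF A2[OF p, unfolded conj_A2_mat_gel]]; simp add: field_simps sqrt2_mult_sqrt2)
  have b1': "gel 1 1 0 0 0 0 0 0 0 0 0 0 0 0 \<in> W"
    by (rule gel_mem_cong[OF lin[OF a2p h, of "1 / sqrt 2" "-1 / sqrt 2", unfolded gel_scaleR gel_add]]; simp add: field_simps sqrt2_mult_sqrt2)
  have B1: "gel x y 0 0 0 0 0 0 0 0 0 0 0 0 \<in> W" for x y
    by (rule gel_mem_cong[OF lin[OF b1 b1', of "(x - y) / 3" "(2 * x + y) / 3", unfolded gel_scaleR gel_add]]; simp add: field_simps sqrt2_mult_sqrt2)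
  have af: "gel 0 0 0 0 0 0 0 0 0 0 (-2 * sqrt 2) (sqrt 2) (sqrt 2) (sqrt 2) \<in> W"
    by (rule gel_mem_cong[OF A[OF root, unfolded conj_A_mat_gel]]; simp add: field_simps sqrt2_mult_sqrt2)
  have fp: "gel 0 0 0 0 0 0 0 0 0 0 2 (-1) (-1) (-1) \<in> W"
    by (rule gel_mem_cong[OF lin[OF af af, of "-1 / sqrt 2" "0", unfolded gel_scaleR gel_add]]; simp add: field_simps sqrt2_mult_sqrt2)
  have sfp: "gel 0 0 0 0 0 0 0 0 0 0 (-2) 1 1 (-2) \<in> W"
    by (rule gel_mem_cong[OF S[OF fp, unfolded conj_S_mat_gel]]; simp add: field_simps sqrt2_mult_sqrt2)
  have b7: "gel 0 0 0 0 0 0 0 0 0 0 0 0 0 1 \<in> W"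
    by (rule gel_mem_cong[OF lin[OF fp sfp, of "-1 / 3" "-1 / 3", unfolded gel_scaleR gel_add]]; simp add: field_simps sqrt2_mult_sqrt2)
  have b6: "gel 0 0 0 0 0 0 0 0 0 0 (-1) 1 0 0 \<in> W"
    by (rule gel_mem_cong[OF A4[OF b7, unfolded conj_A4_mat_gel]]; simp add: field_simps sqrt2_mult_sqrt2)
  \<comment> \<open>Up to here only the three dimensions spanned by \<open>fp\<close>,
    \<open>b7\<close> and \<open>b6\<close> are known in blocks 6 and 7. A vector of block 5
    conjugated by A gives the fourth, once its parts in the known blocks 4 and 5 are
    subtracted.\<close>
  have v: "gel 0 0 0 0 0 0 (- 1 / 4) (1 / 8 + 3 / 8 * sqrt 2) (- sqrt 2 / 4) (- 1 / 8 + sqrt 2 / 8) (-1 / 4 - sqrt 2 / 4) (-1 / 4 + sqrt 2 / 8) (-1 / 2 + sqrt 2 / 8) (1 / 4 + sqrt 2 / 8) \<in> W"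
    by (rule gel_mem_cong[OF A[OF B5[of 1 "-1"], unfolded conj_A_mat_gel]]; simp add: field_simps sqrt2_mult_sqrt2)
  have v1: "gel 0 0 0 0 0 0 0 0 (- sqrt 2 / 4) (- 1 / 8 + sqrt 2 / 8) (-1 / 4 - sqrt 2 / 4) (-1 / 4 + sqrt 2 / 8) (-1 / 2 + sqrt 2 / 8) (1 / 4 + sqrt 2 / 8) \<in> W"
    by (rule gel_mem_cong[OF lin[OF v B4[of "- 1 / 4" "1 / 8 + 3 / 8 * sqrt 2"], of "1" "-1", unfolded gel_scaleR gel_add]]; simp add: field_simps sqrt2_mult_sqrt2)
  have v2: "gel 0 0 0 0 0 0 0 0 0 0 (-1 / 4 - sqrt 2 / 4) (-1 / 4 + sqrt 2 / 8) (-1 / 2 + sqrt 2 / 8) (1 / 4 + sqrt 2 / 8) \<in> W"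
    by (rule gel_mem_cong[OF lin[OF v1 B5[of "- sqrt 2 / 4" "- 1 / 8 + sqrt 2 / 8"], of "1" "-1", unfolded gel_scaleR gel_add]]; simp add: field_simps sqrt2_mult_sqrt2)
  have v3: "gel 0 0 0 0 0 0 0 0 0 0 (-1 / 2 - sqrt 2 / 8) 0 (-1 / 2 + sqrt 2 / 8) (1 / 4 + sqrt 2 / 8) \<in> W"
    by (rule gel_mem_cong[OF lin[OF v2 b6, of "1" "1 / 4 - sqrt 2 / 8", unfolded gel_scaleR gel_add]]; simp add: field_simps sqrt2_mult_sqrt2)
  have v4: "gel 0 0 0 0 0 0 0 0 0 0 (-1 / 2 - sqrt 2 / 8) 0 (-1 / 2 + sqrt 2 / 8) 0 \<in> W"
    by (rule gel_mem_cong[OF lin[OF v3 b7, of "1" "- (1 / 4 + sqrt 2 / 8)", unfolded gel_scaleR gel_add]]; simp add: field_simps sqrt2_mult_sqrt2)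
  have d': "gel 0 0 0 0 0 0 0 0 0 0 1 0 (-1) (-1) \<in> W"
    by (rule gel_mem_cong[OF lin[OF fp b6, of "1" "1", unfolded gel_scaleR gel_add]]; simp add: field_simps sqrt2_mult_sqrt2)
  have d: "gel 0 0 0 0 0 0 0 0 0 0 1 0 (-1) 0 \<in> W"
    by (rule gel_mem_cong[OF lin[OF d' b7, of "1" "1", unfolded gel_scaleR gel_add]]; simp add: field_simps sqrt2_mult_sqrt2)
  have b7': "gel 0 0 0 0 0 0 0 0 0 0 0 0 1 0 \<in> W"
    by (rule gel_mem_cong[OF lin[OF v4 d, of "-1" "- (1 / 2 + sqrt 2 / 8)", unfolded gel_scaleR gel_add]]; simp add: field_simps sqrt2_mult_sqrt2)
  have b6': "gel 0 0 0 0 0 0 0 0 0 0 1 0 0 0 \<in> W"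
    by (rule gel_mem_cong[OF lin[OF d b7', of "1" "1", unfolded gel_scaleR gel_add]]; simp add: field_simps sqrt2_mult_sqrt2)
  have B6: "gel 0 0 0 0 0 0 0 0 0 0 x y 0 0 \<in> W" for x y
    by (rule gel_mem_cong[OF lin[OF b6' b6, of "x + y" "y", unfolded gel_scaleR gel_add]]; simp add: field_simps sqrt2_mult_sqrt2)
  have B7: "gel 0 0 0 0 0 0 0 0 0 0 0 0 x y \<in> W" for x y
    by (rule gel_mem_cong[OF lin[OF b7' b7, of "x" "y", unfolded gel_scaleR gel_add]]; simp add: field_simps sqrt2_mult_sqrt2)
  note B = B1 B2 B3 B4 B5 B6 B7
  have "blk k x y \<in> W" for k x y
    using exhaust_7[of k] B[of x y] by (auto simp: gel_def blk_zero)
  moreover have "subspace W" using W by (simp add: ad_invariant_def)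
  ultimately have "gel x1 y1 x2 y2 x3 y3 x4 y4 x5 y5 x6 y6 x7 y7 \<in> W" for x1 y1 x2 y2 x3 y3 x4 y4 x5 y5 x6 y6 x7 y7
    unfolding gel_def by (intro subspace_add)
  then have "M \<in> W" if "M \<in> g2" for M
    by (subst g2_gel[OF that])
  then show ?thesis by blast
qed

text \<open>On \<open>g2\<close> this is one sixth of the inner product with
  \<open>root_mat\<close>, simplified by the relations of blocks 4 and 5.\<close>

definition root_coeff :: "real^7^7 \<Rightarrow> real" where
  "root_coeff M = M$5$1 - M$1$4 - 2 * M$7$2"

lemma inner_rot_gen: "M \<bullet> rot_gen a b = M$a$b - M$b$a" for M :: "real^'n^'n"
proof -
  have delta: "(\<Sum>i\<in>UNIV. \<Sum>j\<in>UNIV. M$i$j * (if i = a \<and> j = b then 1 else 0)) = M$a$b" for a b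
  proof -
    have "(\<Sum>i\<in>UNIV. \<Sum>j\<in>UNIV. M$i$j * (if i = a \<and> j = b then 1 else 0)) =
        (\<Sum>i\<in>UNIV. if i = a then \<Sum>j\<in>UNIV. if j = b then M$i$j else 0 else 0)"
      by (intro sum.cong refl) (simp add: if_distrib cong: if_cong)
    then show ?thesis by simp
  qed
  show ?thesis
    by (simp add: inner_matrix_conv_sum rot_gen_def right_diff_distrib sum_subtractf delta)
qed

lemma inner_root_mat:
  assumes "M \<in> g2"
  shows "root_mat \<bullet> M = 6 * root_coeff M"
proof -
  have "M \<bullet> root_mat = 2 * (M$5$1 - M$1$5) - (M$6$2 - M$2$6) - (M$7$3 - M$3$7)
      - 3 * (M$7$2 - M$2$7) + 3 * (M$3$6 - M$6$3)"
    by (simp add: gel_def blk_zero blk_simps block_gen_def inner_rot_gen inner_add_right inner_diff_right)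
  also have "\<dots> = 6 * root_coeff M"
  proof -
    \<comment> \<open>The letters stand for the entries of blocks 4 and 5. Skewness doubles each
      difference, and the two block relations eliminate b + c and e.\<close>
    have "2 * (a - a') - (b - b') - (c - c') - 3 * (d - d') + 3 * (e - e') = 6 * (a - f - 2 * d)"
      if "a + b + c = 0" "f + d + e = 0" "a' = - a" "b' = - b" "c' = - c" "d' = - d" "e' = - e"
      for a a' b b' c c' d d' e e' f :: real
      using that by simp
    from this[OF g2_entries(5,6)[OF assms] g2_entries(1)[OF assms] g2_entries(1)[OF assms]
        g2_entries(1)[OF assms] g2_entries(1)[OF assms] g2_entries(1)[OF assms]]
    show ?thesis unfolding root_coeff_def .
  qed
  finally have "M \<bullet> root_mat = 6 * root_coeff M" .
  then show ?thesis by (simp add: inner_commute)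
qed

text \<open>
  Conjugation by \<open>A_mat\<close> has order 8, so one fourth of the alternating sum of its even powers
  projects onto the eigenspace of \<open>\<plusminus>\<i>\<close>.
\<close>

lemma root_mat_mem:
  assumes W: "ad_invariant W" and M: "M \<in> W" and nz: "root_coeff M \<noteq> 0"
  shows "root_mat \<in> W"
proof -
  have sub: "subspace W" and "M \<in> g2" using W M by (auto simp: ad_invariant_def)
  then obtain x1 y1 x2 y2 x3 y3 x4 y4 x5 y5 x6 y6 x7 y7 where M_gel: "M = gel x1 y1 x2 y2 x3 y3 x4 y4 x5 y5 x6 y6 x7 y7" using g2_gel by blast
  define \<alpha> where "\<alpha> = x4 - x5 - 2 * y5"
  define \<beta> where "\<beta> = 2 * (x6 - x7 - y7)"
  have "\<alpha> = root_coeff M"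
    by (simp add: M_gel \<alpha>_def root_coeff_def gel_nth)
  with nz have \<alpha>: "\<alpha> \<noteq> 0" by simp
  note A2 = ad_invariantD(3)[OF W] and lin = ad_invariant_lin[OF W]
  \<comment> \<open>With powers of A acting by conjugation, N + A^4 N is M - A^2 M + A^4 M - A^6 M,
    four times the projection of M; \<alpha> and \<beta> are its coordinates in the plane.\<close>
  define N where "N = 1 *\<^sub>R M + (-1) *\<^sub>R conj_mat A2_mat M"
  have N: "N \<in> W" unfolding N_def by (intro lin M A2)
  have N': "1 *\<^sub>R N + 1 *\<^sub>R conj_mat A4_mat N \<in> W" by (intro lin N ad_invariantD(4)[OF W])
  have V: "gel 0 0 0 0 0 0 (\<alpha>) (- \<alpha> / 2) 0 (- 3 * \<alpha> / 2) (\<beta>) (- \<beta> / 2) (- \<beta> / 2) (- \<beta> / 2) \<in> W"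
    by (rule gel_mem_cong[OF N'[unfolded N_def M_gel conj_A2_mat_gel gel_scaleR gel_add conj_A4_mat_gel]];
      simp add: \<alpha>_def \<beta>_def field_simps sqrt2_mult_sqrt2)
  have AV: "gel 0 0 0 0 0 0 (sqrt 2 / 2 * \<beta>) (- (sqrt 2 / 4) * \<beta>) 0 (- (3 * sqrt 2 / 4) * \<beta>) (- sqrt 2 * \<alpha>) (sqrt 2 / 2 * \<alpha>) (sqrt 2 / 2 * \<alpha>) (sqrt 2 / 2 * \<alpha>) \<in> W"
    by (rule gel_mem_cong[OF ad_invariantD(1)[OF W V, unfolded conj_A_mat_gel]];
      simp add: field_simps sqrt2_mult_sqrt2)
  \<comment> \<open>On the plane, conjugation by A is a quarter turn, so V and its image span it.
    This combination cancels the \<beta> part and leaves a positive multiple of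
    \<open>root_mat\<close>.\<close>
  have D: "gel 0 0 0 0 0 0 (\<alpha> * \<alpha> + \<beta> * \<beta> / 2) (- (\<alpha> * \<alpha> + \<beta> * \<beta> / 2) / 2) 0 (- 3 * (\<alpha> * \<alpha> + \<beta> * \<beta> / 2) / 2) 0 0 0 0 \<in> W"
    by (rule gel_mem_cong[OF lin[OF V AV, of "\<alpha>" "\<beta> / sqrt 2", unfolded gel_scaleR gel_add]];
      simp add: field_simps sqrt2_mult_sqrt2)
  define K where "K = \<alpha> * \<alpha> + \<beta> * \<beta> / 2"
  have "K > 0"
    unfolding K_def using \<alpha> by (intro add_pos_nonneg) (auto simp: zero_less_mult_iff)
  then show ?thesis
    by (intro gel_mem_cong[OF subspace_scale[OF sub D[folded K_def], of "2 / K", unfolded gel_scaleR]])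
      simp_all
qed

text \<open>A has order 8, so its inverse is the seventh power, with exponent 1 + 2 + 4.\<close>

lemma A_mat_transpose: "transpose A_mat = A_mat ** A2_mat ** A4_mat"
proof -
  have "A4_mat ** A4_mat = mat 1"
    by (simp add: A4_mat_eq vec_eq_iff forall_7 matrix_mult_7_nth mat_def)
  moreover have "A_mat ** (A_mat ** A2_mat ** A4_mat) = A4_mat ** A4_mat"
    by (simp only: matrix_mul_assoc)
  ultimately have "transpose A_mat ** (A_mat ** (A_mat ** A2_mat ** A4_mat)) = transpose A_mat"
    by simp
  then show ?thesis
    by (simp only: matrix_mul_assoc[of "transpose A_mat"] G2_transpose_mult(1)[OF A_mat_in_G2] matrix_mul_lid)
qed

lemma S_mat_transpose: "transpose S_mat = S_mat"
  by (simp add: S_mat_eq vec_eq_iff forall_7 transpose_def)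

theorem ad_irreducible:
  assumes W: "ad_invariant W" and U: "U \<in> W" "U \<noteq> 0"
  shows "W = g2"
proof -
  have sub: "subspace W" and Wg2: "W \<subseteq> g2" using W by (auto simp: ad_invariant_def)
  define V where "V = {M \<in> g2. \<forall>N\<in>W. M \<bullet> N = 0}"
  have "conj_mat (transpose A_mat) N \<in> W" "conj_mat (transpose S_mat) N \<in> W" if "N \<in> W" for N
    using that ad_invariantD[OF W]
    by (simp_all add: A_mat_transpose S_mat_transpose flip: conj_mat_mult)
  moreover have "conj_mat P M \<in> g2" if "P \<in> G2" "M \<in> g2" for P M
    using that by (simp add: conj_mat_def g2_conj)
  ultimately have V: "ad_invariant V"
    using subspace_g2
    by (auto simp: ad_invariant_def V_def subspace_def inner_add_left inner_conj_mat A_mat_in_G2 S_mat_in_G2)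
  have "root_mat \<in> W"
  proof (rule ccontr)
    \<comment> \<open>If W misses \<open>root_mat\<close>, then \<open>root_coeff\<close> vanishes
      on W, that is, \<open>root_mat\<close> is orthogonal to W. The complement V then contains all
      of \<open>g2\<close>, so U would be orthogonal to itself.\<close>
    assume "root_mat \<notin> W"
    have "root_mat \<bullet> N = 0" if "N \<in> W" for N
      using root_mat_mem[OF W that] inner_root_mat[OF subsetD[OF Wg2 that]] \<open>root_mat \<notin> W\<close> by auto
    then have "root_mat \<in> V" by (simp add: V_def gel_in_g2)
    then have "g2 \<subseteq> V" by (rule ad_invariant_root_mat_imp_g2[OF V])
    with U Wg2 have "U \<in> V" by blast
    with U have "U \<bullet> U = 0" by (simp add: V_def)
    with U show False by simp
  qed
  then show ?thesis using ad_invariant_root_mat_imp_g2[OF W] Wg2 by blast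
qed

subsection \<open>The dimension of \<open>g2\<close>\<close>

lemma inner_blk:
  "blk k x y \<bullet> blk l x' y' = (if k = l then 2 * (x * x' + y * y' + (x + y) * (x' + y')) else 0)"
  using exhaust_7[of k] exhaust_7[of l]
  by (elim disjE; simp add: blk_simps block_gen_def inner_rot_gen inner_add_right inner_diff_right;
    simp add: rot_gen_def algebra_simps)

lemma dim_g2: "dim g2 = 14"
proof -
  \<comment> \<open>Different blocks are orthogonal, and within a block so are the vectors with
    coordinates (1, 1) and (1, -1): this is an orthogonal basis.\<close>
  define b where "b = (\<lambda>(k, y). blk k 1 y)"
  define B where "B = b ` (UNIV \<times> {1, -1})"
  have orth: "b p \<bullet> b q = 0" if "p \<in> UNIV \<times> {1, -1}" "q \<in> UNIV \<times> {1, -1}" "p \<noteq> q" for p q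
    using that by (auto simp: b_def inner_blk simp del: inner_eq_zero_iff split: if_splits)
  have nz: "b p \<noteq> 0" if p: "p \<in> UNIV \<times> {1, -1}" for p
  proof
    assume "b p = 0"
    then have "b p \<bullet> b p = 0" by simp
    then show False
      using p by (auto simp: b_def inner_blk simp del: inner_eq_zero_iff)
  qed
  have "inj_on b (UNIV \<times> {1, -1})"
  proof (intro inj_onI, rule ccontr)
    fix p q
    assume pq: "p \<in> UNIV \<times> {1, -1}" "q \<in> UNIV \<times> {1, -1}" "b p = b q" "p \<noteq> q"
    then have "b p \<bullet> b p = 0" using orth[of p q] by simp
    with nz[OF pq(1)] show False by simp
  qed
  then have card: "card B = 14"
    by (simp add: B_def card_image card_cartesian_product)
  have "pairwise orthogonal B"
  proof (rule pairwiseI)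
    fix M N
    assume M: "M \<in> B" and N: "N \<in> B" and ne: "M \<noteq> N"
    from M obtain p where p: "M = b p" "p \<in> UNIV \<times> {1, -1}" unfolding B_def by (rule imageE)
    from N obtain q where q: "N = b q" "q \<in> UNIV \<times> {1, -1}" unfolding B_def by (rule imageE)
    from p q ne have "p \<noteq> q" by metis
    with p q show "orthogonal M N" by (simp only: orthogonal_def orth not_False_eq_True)
  qed
  moreover have "0 \<notin> B"
  proof
    assume "0 \<in> B"
    then obtain p where "0 = b p" "p \<in> UNIV \<times> {1, -1}" unfolding B_def by (rule imageE)
    with nz show False by metis
  qed
  ultimately have ind: "independent B" by (rule pairwise_orthogonal_independent)
  have "blk k x y \<in> span B" for k x y
  proof -
    have "((x + y) / 2) *\<^sub>R b (k, 1) + ((x - y) / 2) *\<^sub>R b (k, -1) =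
        blk k ((x + y) / 2 + (x - y) / 2) ((x + y) / 2 - (x - y) / 2)"
      by (simp add: b_def blk_scaleR blk_add)
    also have "\<dots> = blk k x y" by (simp add: field_simps)
    finally have "blk k x y = ((x + y) / 2) *\<^sub>R b (k, 1) + ((x - y) / 2) *\<^sub>R b (k, -1)" ..
    moreover have "b (k, 1) \<in> B" "b (k, -1) \<in> B" by (auto simp: B_def)
    ultimately show ?thesis by (simp add: span_add span_scale span_base)
  qed
  then have "M \<in> span B" if "M \<in> g2" for M
    by (subst g2_decomposition[OF that]) (intro span_add)
  moreover have "B \<subseteq> g2" by (auto simp: B_def b_def blk_in_g2)
  then have "span B \<subseteq> g2" by (rule span_minimal[OF _ subspace_g2])
  ultimately have "span B = span g2" 
    using span_eq_iff[of g2] subspace_g2 by blast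
  with ind card show ?thesis using dim_eq_card[of B g2] by simp
qed

subsection \<open>The group generated by \<open>A\<close> and \<open>S\<close>\<close>

lemma group_G2: "group G2_group"
proof (rule groupI)
  fix M assume "M \<in> carrier G2_group"
  then show "\<exists>N\<in>carrier G2_group. N \<otimes>\<^bsub>G2_group\<^esub> M = \<one>\<^bsub>G2_group\<^esub>"
    by (intro bexI[of _ "transpose M"]) (simp_all add: G2_group_def G2_transpose_mult G2_transpose)
qed (simp_all add: G2_group_def G2_one G2_mult matrix_mul_assoc)

lemma Gamma_subset_G2: "Gamma_AS \<subseteq> G2"
  using group.generate_in_carrier[OF group_G2, of "{A_mat, S_mat}"] A_mat_in_G2 S_mat_in_G2
  by (auto simp: Gamma_AS_def G2_group_def)

lemma Gamma_one: "mat 1 \<in> Gamma_AS"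
  using generate.one[of G2_group "{A_mat, S_mat}"] by (simp add: Gamma_AS_def G2_group_def)

lemma Gamma_mult: "M \<in> Gamma_AS \<Longrightarrow> N \<in> Gamma_AS \<Longrightarrow> M ** N \<in> Gamma_AS"
  using generate.eng[of M G2_group "{A_mat, S_mat}" N] by (simp add: Gamma_AS_def G2_group_def)

lemma Gamma_generators: "A_mat \<in> Gamma_AS" "S_mat \<in> Gamma_AS"
  by (auto simp: Gamma_AS_def intro: generate.incl)

lemma Gamma_transpose:
  assumes "M \<in> Gamma_AS"
  shows "transpose M \<in> Gamma_AS"
proof -
  have M: "M \<in> G2" using assms Gamma_subset_G2 by blast
  have "inv\<^bsub>G2_group\<^esub> M = transpose M"
    by (rule group.inv_equality[OF group_G2])
      (simp_all add: G2_group_def M G2_transpose_mult G2_transpose)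
  moreover have "inv\<^bsub>G2_group\<^esub> M \<in> Gamma_AS"
    using assms A_mat_in_G2 S_mat_in_G2 unfolding Gamma_AS_def
    by (intro group.generate_m_inv_closed[OF group_G2]) (auto simp: G2_group_def)
  ultimately show ?thesis by simp
qed

lemma closed_subgroup_closure_Gamma: "closed_subgroup_G2 (closure Gamma_AS)"
  unfolding closed_subgroup_G2_def
proof (intro conjI ballI)
  show "closure Gamma_AS \<subseteq> G2" using Gamma_subset_G2 closed_G2 by (rule closure_minimal)
  show "mat 1 \<in> closure Gamma_AS" using Gamma_one closure_subset by blast
  fix M assume "M \<in> closure Gamma_AS"
  then obtain f where f: "\<And>n. f n \<in> Gamma_AS" "f \<longlonglongrightarrow> M" by (auto simp: closure_sequential)
  show "transpose M \<in> closure Gamma_AS"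
    unfolding closure_sequential
    using f by (intro exI[of _ "\<lambda>n. transpose (f n)"]) (auto intro: Gamma_transpose tendsto_transpose)
  fix N assume "N \<in> closure Gamma_AS"
  then obtain g where g: "\<And>n. g n \<in> Gamma_AS" "g \<longlonglongrightarrow> N" by (auto simp: closure_sequential)
  show "M ** N \<in> closure Gamma_AS"
    unfolding closure_sequential
    using f g by (intro exI[of _ "\<lambda>n. f n ** g n"]) (auto intro: Gamma_mult tendsto_matrix_mult)
qed simp

subsection \<open>An element of infinite order\<close>

text \<open>The powers of A have the exponents 2, 4, 1, 1, 4, 2, separated by S. Every sqrt 2
  cancels in this product, and twice the result is an integral matrix.\<close>

definition word_mat :: "real^7^7" where
  "word_mat = A2_mat ** S_mat ** A4_mat ** S_mat ** A_mat ** S_mat ** A_mat ** S_mat ** A4_mat ** S_mat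
    ** A2_mat ** S_mat"

lemma word_mat_in_Gamma: "word_mat \<in> Gamma_AS"
  unfolding word_mat_def by (intro Gamma_mult Gamma_generators)

lemma word_mat_eq: "2 *\<^sub>R word_mat = mat7
  [[0, -1, 1, 0, 0, -1, -1], [0, 1, -1, 0, 0, -1, -1], [0, 0, 0, 0, -2, 0, 0], [1, 1, 1, 1, 0, 0, 0],
   [-1, 1, 1, -1, 0, 0, 0], [1, 0, 0, -1, 0, 1, -1], [1, 0, 0, -1, 0, -1, 1]]"
proof -
  have 1: "A2_mat ** S_mat = mat7
    [[0, 0, 0, sqrt 2 / 2, - (sqrt 2 / 2), 0, 0], [- (sqrt 2 / 2), 0, 0, 1 / 2, 1 / 2, 0, 0],
     [sqrt 2 / 2, 0, 0, 1 / 2, 1 / 2, 0, 0], [0, -1, 0, 0, 0, 0, 0],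
     [0, 0, 0, 0, 0, sqrt 2 / 2, - (sqrt 2 / 2)], [0, 0, sqrt 2 / 2, 0, 0, 1 / 2, 1 / 2],
     [0, 0, - (sqrt 2 / 2), 0, 0, 1 / 2, 1 / 2]]"
    by (simp add: A2_mat_eq S_mat_eq vec_eq_iff forall_7 matrix_mult_7_nth)
  have 2: "A4_mat ** S_mat = mat7
    [[-1, 0, 0, 0, 0, 0, 0], [0, 0, 0, 0, 1, 0, 0], [0, 0, 0, 1, 0, 0, 0], [0, 1, 0, 0, 0, 0, 0],
     [0, 0, -1, 0, 0, 0, 0], [0, 0, 0, 0, 0, 0, -1], [0, 0, 0, 0, 0, -1, 0]]"
    by (simp add: A4_mat_eq S_mat_eq vec_eq_iff forall_7 matrix_mult_7_nth)
  have 3: "A_mat ** S_mat = mat7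
   [[sqrt 2 / 2, 0, 0, 1 / 2, - (1 / 2), 0, 0],
    [- (1 / 2), 0, 0, 1 / 2 + sqrt 2 / 4, 1 / 2 - sqrt 2 / 4, 0, 0],
    [1 / 2, 0, 0, 1 / 2 - sqrt 2 / 4, 1 / 2 + sqrt 2 / 4, 0, 0],
    [0, 0, 0, 0, 0, sqrt 2 / 2, sqrt 2 / 2],
    [0, 0, sqrt 2 / 2, 0, 0, 1 / 2, - (1 / 2)],
    [0, sqrt 2 / 2, 1 / 2, 0, 0, - (sqrt 2 / 4), sqrt 2 / 4],
    [0, sqrt 2 / 2, - (1 / 2), 0, 0, sqrt 2 / 4, - (sqrt 2 / 4)]]"
    by (simp add: A_mat_eq S_mat_eq vec_eq_iff forall_7 matrix_mult_7_nth)
  have word: "word_mat = (A2_mat ** S_mat) ** ((A4_mat ** S_mat) ** ((A_mat ** S_mat) ** ((A_mat ** S_mat)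
      ** ((A4_mat ** S_mat) ** (A2_mat ** S_mat)))))"
    by (simp only: word_mat_def matrix_mul_assoc)
  let ?M4 = "mat7
    [[0, 0, 0, - sqrt 2 / 2, sqrt 2 / 2, 0, 0],
     [0, 0, 0, 0, 0, sqrt 2 / 2, - sqrt 2 / 2],
     [0, - 1, 0, 0, 0, 0, 0],
     [- sqrt 2 / 2, 0, 0, 1 / 2, 1 / 2, 0, 0],
     [- sqrt 2 / 2, 0, 0, - 1 / 2, - 1 / 2, 0, 0],
     [0, 0, sqrt 2 / 2, 0, 0, - 1 / 2, - 1 / 2],
     [0, 0, - sqrt 2 / 2, 0, 0, - 1 / 2, - 1 / 2]]"
  have 4: "(A4_mat ** S_mat) ** (A2_mat ** S_mat) = ?M4"
    unfolding 2 1 by (simp add: vec_eq_iff forall_7 matrix_mult_7_nth; simp add: field_simps sqrt2_mult_sqrt2)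
  let ?M5 = "mat7
    [[0, 0, 0, 0, 1, 0, 0],
     [- sqrt 2 / 2, 0, 0, sqrt 2 / 2, 0, 0, 0],
     [- sqrt 2 / 2, 0, 0, - sqrt 2 / 2, 0, 0, 0],
     [0, 0, 0, 0, 0, - sqrt 2 / 2, - sqrt 2 / 2],
     [0, - sqrt 2 / 2, sqrt 2 / 2, 0, 0, 0, 0],
     [0, - 1 / 2, - 1 / 2, 0, 0, 1 / 2, - 1 / 2],
     [0, 1 / 2, 1 / 2, 0, 0, 1 / 2, - 1 / 2]]"
  have 5: "(A_mat ** S_mat) ** ?M4 = ?M5"
    unfolding 3 by (simp add: vec_eq_iff forall_7 matrix_mult_7_nth; simp add: field_simps sqrt2_mult_sqrt2)
  let ?M6 = "mat7
    [[0, sqrt 2 / 4, - sqrt 2 / 4, 0, sqrt 2 / 2, - sqrt 2 / 4, - sqrt 2 / 4],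
     [0, 1 / 4 - sqrt 2 / 4, - 1 / 4 + sqrt 2 / 4, 0, - 1 / 2, - 1 / 4 - sqrt 2 / 4, - 1 / 4 - sqrt 2 / 4],
     [0, - 1 / 4 - sqrt 2 / 4, 1 / 4 + sqrt 2 / 4, 0, 1 / 2, 1 / 4 - sqrt 2 / 4, 1 / 4 - sqrt 2 / 4],
     [0, 0, 0, 0, 0, sqrt 2 / 2, - sqrt 2 / 2],
     [- 1 / 2, - 1 / 2, - 1 / 2, - 1 / 2, 0, 0, 0],
     [- 1 / 2 - sqrt 2 / 4, sqrt 2 / 4, sqrt 2 / 4, 1 / 2 - sqrt 2 / 4, 0, 0, 0],
     [- 1 / 2 + sqrt 2 / 4, - sqrt 2 / 4, - sqrt 2 / 4, 1 / 2 + sqrt 2 / 4, 0, 0, 0]]"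
  have 6: "(A_mat ** S_mat) ** ?M5 = ?M6"
    unfolding 3 by (simp add: vec_eq_iff forall_7 matrix_mult_7_nth; simp add: field_simps sqrt2_mult_sqrt2)
  let ?M7 = "mat7
    [[0, - sqrt 2 / 4, sqrt 2 / 4, 0, - sqrt 2 / 2, sqrt 2 / 4, sqrt 2 / 4],
     [- 1 / 2, - 1 / 2, - 1 / 2, - 1 / 2, 0, 0, 0],
     [0, 0, 0, 0, 0, sqrt 2 / 2, - sqrt 2 / 2],
     [0, 1 / 4 - sqrt 2 / 4, - 1 / 4 + sqrt 2 / 4, 0, - 1 / 2, - 1 / 4 - sqrt 2 / 4, - 1 / 4 - sqrt 2 / 4],
     [0, 1 / 4 + sqrt 2 / 4, - 1 / 4 - sqrt 2 / 4, 0, - 1 / 2, - 1 / 4 + sqrt 2 / 4, - 1 / 4 + sqrt 2 / 4],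
     [1 / 2 - sqrt 2 / 4, sqrt 2 / 4, sqrt 2 / 4, - 1 / 2 - sqrt 2 / 4, 0, 0, 0],
     [1 / 2 + sqrt 2 / 4, - sqrt 2 / 4, - sqrt 2 / 4, - 1 / 2 + sqrt 2 / 4, 0, 0, 0]]"
  have 7: "(A4_mat ** S_mat) ** ?M6 = ?M7"
    unfolding 2 by (simp add: vec_eq_iff forall_7 matrix_mult_7_nth; simp add: field_simps sqrt2_mult_sqrt2)
  show ?thesis
    unfolding word 4 5 6 7 unfolding 1
    by (simp add: vec_eq_iff forall_7 matrix_mult_7_nth; simp add: field_simps sqrt2_mult_sqrt2)
qed

text \<open>
  The parity of \<open>v\<^sub>2 + v\<^sub>3 + v\<^sub>6 + v\<^sub>7\<close> of an integral vector is invariant under the integral matrix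
  \<open>2 word_mat\<close>, so that the powers of \<open>word_mat\<close> have unbounded denominators.
\<close>

definition odd_vec :: "real^7 \<Rightarrow> bool" where
  "odd_vec v \<longleftrightarrow> (\<forall>i. v $ i \<in> \<int>) \<and> (\<exists>k::int. v$2 + v$3 + v$6 + v$7 = 2 * of_int k + 1)"

lemma odd_vec_word_mat:
  assumes "odd_vec v"
  shows "odd_vec ((2 *\<^sub>R word_mat) *v v)"
proof -
  obtain k :: int where k: "v$2 + v$3 + v$6 + v$7 = 2 * of_int k + 1" and Z: "\<And>i. v $ i \<in> \<int>"
    using assms by (auto simp: odd_vec_def)
  obtain a b c d e f :: int where
    *: "v$1 = of_int a" "v$3 = of_int b" "v$4 = of_int c" "v$5 = of_int d" "v$6 = of_int e" "v$7 = of_int f"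
    using Z by (metis Ints_cases)
  have "((2 *\<^sub>R word_mat) *v v) $ i \<in> \<int>" for i
    using exhaust_7[of i] Z
    by (elim disjE; simp add: word_mat_eq matrix_vector_mult_7_nth)
  \<comment> \<open>The rows 2, 3, 6, 7 of the matrix add up to (2, 1, -1, -2, -2, -1, -1),
    congruent modulo 2 to the indicator of these four positions.\<close>
  moreover have "((2 *\<^sub>R word_mat) *v v) $ 2 + ((2 *\<^sub>R word_mat) *v v) $ 3 + ((2 *\<^sub>R word_mat) *v v) $ 6
      + ((2 *\<^sub>R word_mat) *v v) $ 7 = 2 * of_int (k - b - d + a - c - e - f) + 1"
    using k by (simp add: word_mat_eq matrix_vector_mult_7_nth * algebra_simps)
  ultimately show ?thesis unfolding odd_vec_def by blast
qed

text \<open>Applying the powers of the integral matrix to e2, whose sum is odd, gives vectors z_n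
  that all satisfy \<open>odd_vec\<close>. If the powers m < n agreed, then z_n = 2^(n - m) z_m
  would have an even sum.\<close>

lemma inj_mat_power_word_mat: "inj (mat_power word_mat)"
proof -
  define z where "z = (\<lambda>n. 2 ^ n *\<^sub>R (mat_power word_mat n *v axis 2 1))"
  have z_Suc: "z (Suc n) = (2 *\<^sub>R word_mat) *v z n" for n
    by (simp add: z_def matrix_vector_mult_scaleR flip: matrix_vector_mul_assoc scaleR_matrix_vector_assoc)
  have odd: "odd_vec (z n)" for n
  proof (induction n)
    case 0
    show ?case by (auto simp: z_def odd_vec_def axis_def intro!: exI[of _ 0])
  next
    case (Suc n)
    then show ?case unfolding z_Suc by (rule odd_vec_word_mat)
  qed
  have less: "mat_power word_mat m \<noteq> mat_power word_mat n" if "m < n" for m n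
  proof
    assume eq: "mat_power word_mat m = mat_power word_mat n"
    obtain d where n: "n = Suc (m + d)" using \<open>m < n\<close> by (auto dest: less_imp_Suc_add)
    have "z n = (2 * 2 ^ d) *\<^sub>R z m"
      unfolding z_def eq by (simp add: n power_add mult.commute)
    moreover obtain k :: int where "z m $ 2 + z m $ 3 + z m $ 6 + z m $ 7 = 2 * of_int k + 1"
      using odd[of m] by (auto simp: odd_vec_def)
    moreover obtain l :: int where "z n $ 2 + z n $ 3 + z n $ 6 + z n $ 7 = 2 * of_int l + 1"
      using odd[of n] by (auto simp: odd_vec_def)
    ultimately have "2 * 2 ^ d * (2 * of_int k + 1) = (2 * of_int l + 1 :: real)"
      by (simp flip: distrib_left)
    then have "of_int (2 * 2 ^ d * (2 * k + 1)) = (of_int (2 * l + 1) :: real)" by simp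
    then have "2 * 2 ^ d * (2 * k + 1) = 2 * l + 1" by (simp only: of_int_eq_iff)
    then have "even (2 * l + 1)" by (metis dvd_triv_left mult.assoc)
    then show False by simp
  qed
  show ?thesis
    by (rule injI) (metis less linorder_neqE_nat)
qed

lemma mat_power_in_Gamma: "M \<in> Gamma_AS \<Longrightarrow> mat_power M n \<in> Gamma_AS"
  by (induction n) (auto intro: Gamma_one Gamma_mult)

subsection \<open>Density\<close>

text \<open>All powers of \<open>word_mat\<close> have the same norm, so a subsequence of them is
  Cauchy. Two consecutive late terms differ by an orthogonal factor times g - 1, where g is a
  positive power; infinite order makes g different from 1.\<close>

lemma Gamma_near_one:
  assumes "0 < \<epsilon>"
  obtains g where "g \<in> Gamma_AS" "g \<noteq> mat 1" "norm (g - mat 1) < \<epsilon>"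
proof -
  have orth: "orthogonal_matrix (mat_power word_mat n)" for n
    using mat_power_in_Gamma[OF word_mat_in_Gamma] Gamma_subset_G2 G2_orthogonal by blast
  have "norm (mat_power word_mat n) = norm (mat 1 :: real^7^7)" for n
    using norm_matrix_mult_orthogonal_left[OF orth, of n "mat 1"] by simp
  then have "bounded (range (mat_power word_mat))"
    by (auto simp: bounded_iff)
  then obtain l r where r: "strict_mono (r :: nat \<Rightarrow> nat)" and lim: "(mat_power word_mat \<circ> r) \<longlonglongrightarrow> l"
    using bounded_imp_convergent_subsequence by metis
  have "\<exists>N. \<forall>m\<ge>N. \<forall>n\<ge>N. norm (mat_power word_mat (r m) - mat_power word_mat (r n)) < \<epsilon>"
    using LIMSEQ_imp_Cauchy[OF lim] assms unfolding Cauchy_iff by (simp add: o_def)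
  then obtain N where N:
    "\<forall>m\<ge>N. \<forall>n\<ge>N. norm (mat_power word_mat (r m) - mat_power word_mat (r n)) < \<epsilon>" by blast
  then have near: "norm (mat_power word_mat (r (Suc N)) - mat_power word_mat (r N)) < \<epsilon>" by simp
  define m where "m = r N"
  define d where "d = r (Suc N) - r N"
  have d: "r (Suc N) = m + d" "0 < d"
    using r by (auto simp: m_def d_def strict_mono_Suc_iff less_imp_le)
  define g where "g = mat_power word_mat d"
  have "mat_power word_mat (r (Suc N)) - mat_power word_mat (r N) = mat_power word_mat m ** (g - mat 1)"
    unfolding d(1) mat_power_add by (simp add: m_def g_def matrix_mult_diff_right)
  with near have "norm (mat_power word_mat m ** (g - mat 1)) < \<epsilon>" by (simp only:)
  then have "norm (g - mat 1) < \<epsilon>" by (simp only: norm_matrix_mult_orthogonal_left[OF orth])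
  moreover have "g \<noteq> mat 1"
    using d(2) injD[OF inj_mat_power_word_mat, of d 0] by (auto simp: g_def)
  moreover have "g \<in> Gamma_AS"
    unfolding g_def by (intro mat_power_in_Gamma word_mat_in_Gamma)
  ultimately show ?thesis using that by blast
qed

lemma lie_algebra_closure_Gamma_nontrivial: "\<exists>Y\<in>lie_algebra_of (closure Gamma_AS). Y \<noteq> 0"
proof -
  have "\<exists>g. g \<in> Gamma_AS \<and> g \<noteq> mat 1 \<and> norm (g - mat 1) < inverse (real (Suc n))" for n
    by (rule Gamma_near_one[of "inverse (real (Suc n))"]) auto
  then obtain g where g: "\<And>n. g n \<in> Gamma_AS" "\<And>n. g n \<noteq> mat 1"
    "\<And>n. norm (g n - mat 1) < inverse (real (Suc n))" by metis
  \<comment> \<open>Dividing by the distance to 1 makes the secants unit vectors; they converge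
    along a subsequence, and the limit has norm 1.\<close>
  define s where "s = (\<lambda>n. norm (g n - mat 1))"
  define q where "q = (\<lambda>n. (1 / s n) *\<^sub>R (g n - mat 1))"
  have s: "0 < s n" for n using g(2) by (simp add: s_def)
  have "s \<longlonglongrightarrow> 0"
    by (rule Lim_null_comparison[OF _ LIMSEQ_inverse_real_of_nat])
      (use g(3) in \<open>auto simp: s_def less_imp_le\<close>)
  have norm_q: "norm (q n) = 1" for n using s[of n] by (simp add: q_def s_def)
  then have "bounded (range q)" by (auto simp: bounded_iff)
  then obtain Y r where r: "strict_mono (r :: nat \<Rightarrow> nat)" and lim: "(q \<circ> r) \<longlonglongrightarrow> Y"
    using bounded_imp_convergent_subsequence by metis
  have "(\<lambda>n. (1 / (s \<circ> r) n) *\<^sub>R ((g \<circ> r) n - mat 1)) \<longlonglongrightarrow> Y"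
    using lim by (simp add: o_def q_def)
  note limit = one_parameter_limit[OF closed_subgroup_closure_Gamma _ _ _ this]
  have "(g \<circ> r) n \<in> closure Gamma_AS" for n using g(1) closure_subset by auto
  then have "Y \<in> lie_algebra_of (closure Gamma_AS)"
    using limit LIMSEQ_subseq_LIMSEQ[OF \<open>s \<longlonglongrightarrow> 0\<close> r, unfolded o_def] s by (auto simp: lie_algebra_of_def)
  moreover have "norm Y = 1"
    using tendsto_norm[OF lim] norm_q by (simp add: o_def LIMSEQ_const_iff)
  ultimately show ?thesis by (intro bexI[of _ Y]) auto
qed

lemma ad_invariant_lie_algebra_closure_Gamma: "ad_invariant (lie_algebra_of (closure Gamma_AS))"
proof -
  let ?H = "closure Gamma_AS"
  have "conj_mat P M \<in> lie_algebra_of ?H" if "P \<in> Gamma_AS" "M \<in> lie_algebra_of ?H" for P M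
  proof -
    have "P \<in> ?H" "P \<in> G2" using that closure_subset Gamma_subset_G2 by auto
    then show ?thesis
      using that lie_algebra_of_conj[OF closed_subgroup_closure_Gamma that(2), of P]
      by (simp add: lie_algebra_of_def conj_mat_def g2_conj)
  qed
  then show ?thesis
    using subspace_lie_algebra_of[OF closed_subgroup_closure_Gamma] Gamma_generators
    by (auto simp: ad_invariant_def) (simp add: lie_algebra_of_def)
qed

theorem closure_Gamma: "closure Gamma_AS = G2"
proof (rule G2_generated_by_exp)
  have "lie_algebra_of (closure Gamma_AS) = g2"
    using lie_algebra_closure_Gamma_nontrivial ad_irreducible[OF ad_invariant_lie_algebra_closure_Gamma]
    by blast
  then have "mat_exp (1 *\<^sub>R Y) \<in> closure Gamma_AS" if "Y \<in> g2" for Y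
    using that unfolding lie_algebra_of_def by blast
  then show "contains_exp_g2 (closure Gamma_AS)"
    using closed_subgroup_closure_Gamma by (simp add: contains_exp_g2_def closed_subgroup_G2_def)
qed (use closed_subgroup_closure_Gamma in \<open>auto simp: closed_subgroup_G2_def\<close>)

theorem span_conjugates_eq_g2:
  assumes U: "U \<in> g2" "U \<noteq> 0"
  shows "span {w ** U ** matrix_inv w | w. w \<in> Gamma_AS} = g2"
proof -
  define C where "C = {w ** U ** matrix_inv w | w. w \<in> Gamma_AS}"
  have G2: "w \<in> G2" if "w \<in> Gamma_AS" for w using that Gamma_subset_G2 by blast
  have C: "C = {conj_mat w U | w. w \<in> Gamma_AS}"
    unfolding C_def conj_mat_def using matrix_inv_G2 G2 by (intro Collect_cong) metis
  have "C \<subseteq> g2" using U G2 by (auto simp: C conj_mat_def g2_conj)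
  moreover have "conj_mat P M \<in> span C" if P: "P \<in> Gamma_AS" and M: "M \<in> span C" for P M
  proof -
    have "conj_mat P ` C \<subseteq> C" using P by (auto simp: C conj_mat_mult intro: Gamma_mult)
    then have "span (conj_mat P ` C) \<subseteq> span C" by (rule span_mono)
    then show ?thesis using M by (auto simp: linear_span_image[OF linear_conj_mat])
  qed
  ultimately have "ad_invariant (span C)"
    by (simp add: ad_invariant_def Gamma_generators span_minimal[OF _ subspace_g2])
  moreover have "U \<in> C"
    unfolding C using Gamma_one by (force simp: conj_mat_def transpose_mat)
  then have "U \<in> span C" by (rule span_base)
  ultimately show ?thesis using ad_irreducible U(2) unfolding C_def by blast
qed

subsection \<open>The differential of the product map\<close>

text \<open>The number 14 becomes the index 0. Injectivity follows from surjectivity by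
  counting.\<close>

lemma bij_betw_of_nat_14: "bij_betw (of_nat :: nat \<Rightarrow> 14) {1..14} UNIV"
proof -
  have "x \<in> of_nat ` {1..14}" for x :: 14
  proof (induct x)
    case (of_int z)
    then have z: "0 \<le> z" "z < 14" by simp_all
    show ?case
    proof (cases "z = 0")
      case True
      then show ?thesis by (intro image_eqI[of _ _ 14]) simp_all
    next
      case False
      with z have "nat z \<in> {1..14}" by (auto simp: Suc_le_eq nat_le_iff)
      with z show ?thesis by (intro image_eqI[of _ _ "nat z"]) (simp_all add: of_nat_nat)
    qed
  qed
  then have surj: "of_nat ` {1..14} = (UNIV :: 14 set)" by blast
  then have "inj_on (of_nat :: nat \<Rightarrow> 14) {1..14}"
    by (intro eq_card_imp_inj_on) simp_all
  with surj show ?thesis by (simp add: bij_betw_def)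
qed

lemma conj_exp_factor_has_derivative:
  fixes w X :: "real^'n^'n" and k :: "'m::finite"
  assumes "w' ** w = mat 1"
  shows "((\<lambda>t :: real^'m. w ** mat_exp (t $ k *\<^sub>R X) ** w') has_derivative
    (\<lambda>t. t $ k *\<^sub>R (w ** X ** w'))) (at 0)"
proof -
  have "((\<lambda>s. mat_exp (s *\<^sub>R (w ** X ** w'))) has_derivative (\<lambda>s. s *\<^sub>R (w ** X ** w'))) (at ((0 :: real^'m) $ k))"
    using mat_exp_has_vector_derivative[of "w ** X ** w'" 0] by (simp add: has_vector_derivative_def)
  from has_derivative_compose[OF bounded_linear_imp_has_derivative[OF bounded_linear_vec_nth] this]
  show ?thesis by (simp add: mat_exp_conj[OF assms])
qed

text \<open>The value 1 at the origin is carried through the induction, since the product rule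
  multiplies each derivative by the value of the other factor; so the derivatives simply add
  up.\<close>

lemma conj_exp_foldr_has_derivative:
  fixes w :: "nat \<Rightarrow> real^'n^'n" and X :: "real^'n^'n"
  assumes "\<And>j. j \<in> set js \<Longrightarrow> matrix_inv (w j) ** w j = mat 1"
  defines "F \<equiv> \<lambda>t :: real^14. foldr (\<lambda>j P. (w j ** mat_exp (t $ of_nat j *\<^sub>R X) ** matrix_inv (w j)) ** P) js (mat 1)"
  shows "F 0 = mat 1 \<and>
    (F has_derivative (\<lambda>t. \<Sum>j\<leftarrow>js. t $ of_nat j *\<^sub>R (w j ** X ** matrix_inv (w j)))) (at 0)"
  unfolding F_def using assms(1)
proof (induction js)
  case (Cons j js)
  have inv: "w j ** matrix_inv (w j) = mat 1"
    using Cons.prems by (simp add: matrix_left_right_inverse)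
  let ?f = "\<lambda>t :: real^14. w j ** mat_exp (t $ of_nat j *\<^sub>R X) ** matrix_inv (w j)"
  have "(?f has_derivative (\<lambda>t. t $ of_nat j *\<^sub>R (w j ** X ** matrix_inv (w j)))) (at 0)"
    using Cons.prems by (intro conj_exp_factor_has_derivative) simp
  from bounded_bilinear.FDERIV[OF bounded_bilinear_matrix_mult this conjunct2[OF Cons.IH]] Cons
  show ?case by (simp add: inv add.commute)
qed simp

lemma exists_basis_of_conjugates:
  assumes "span {w ** X ** matrix_inv w | w. w \<in> Gamma_AS} = g2"
  shows "\<exists>w :: nat \<Rightarrow> real^7^7. (\<forall>j\<in>{1..14}. w j \<in> Gamma_AS) \<and>
    inj_on (\<lambda>j. w j ** X ** matrix_inv (w j)) {1..14} \<and>
    independent ((\<lambda>j. w j ** X ** matrix_inv (w j)) ` {1..14}) \<and>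
    span ((\<lambda>j. w j ** X ** matrix_inv (w j)) ` {1..14}) = g2"
proof -
  define C where "C = {w ** X ** matrix_inv w | w. w \<in> Gamma_AS}"
  obtain B where B: "B \<subseteq> C" "independent B" "C \<subseteq> span B" "card B = dim C"
    by (rule basis_exists)
  have "dim C = 14"
    using assms dim_span[of C] by (simp add: C_def dim_g2)
  then have card: "card B = 14" using B(4) by simp
  have span: "span B = g2"
  proof -
    have "span C \<subseteq> span B" using span_mono[OF B(3)] by (simp only: span_span)
    then show ?thesis using span_mono[OF B(1)] assms by (simp add: C_def)
  qed
  have "finite B" using B(2) by (rule independent_imp_finite)
  then obtain h where h: "bij_betw h {1..14::nat} B"
    using ex_bij_betw_nat_finite_1[of B] card by auto
  have "\<forall>j\<in>{1..14}. \<exists>w. w \<in> Gamma_AS \<and> h j = w ** X ** matrix_inv w"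
    using h B(1) unfolding C_def bij_betw_def by blast
  then obtain w where w: "\<And>j. j \<in> {1..14} \<Longrightarrow> w j \<in> Gamma_AS \<and> h j = w j ** X ** matrix_inv (w j)"
    by (metis (no_types))
  have "bij_betw (\<lambda>j. w j ** X ** matrix_inv (w j)) {1..14} B"
    using h bij_betw_cong[of "{1..14}" h "\<lambda>j. w j ** X ** matrix_inv (w j)" B] w by metis
  then have inj: "inj_on (\<lambda>j. w j ** X ** matrix_inv (w j)) {1..14}"
    and image: "(\<lambda>j. w j ** X ** matrix_inv (w j)) ` {1..14} = B"
    unfolding bij_betw_def by blast+
  have "\<forall>j\<in>{1..14}. w j \<in> Gamma_AS" using w by blast
  with inj B(2) span show ?thesis unfolding image[symmetric] by blast
qed

lemma bij_betw_linear_combination: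
  fixes h :: "nat \<Rightarrow> 'a::real_vector"
  assumes inj: "inj_on h {1..14}" and ind: "independent (h ` {1..14})"
  shows "bij_betw (\<lambda>t :: real^14. \<Sum>j\<in>{1..14}. t $ of_nat j *\<^sub>R h j) UNIV (span (h ` {1..14}))"
proof -
  let ?L = "\<lambda>t :: real^14. \<Sum>j\<in>{1..14}. t $ of_nat j *\<^sub>R h j"
  \<comment> \<open>\<open>\<sigma>\<close> gives the number of a basis vector and
    \<open>\<tau>\<close> the number of an index, so that coordinates can be moved between vectors,
    numbers and indices.\<close>
  define \<sigma> where "\<sigma> = inv_into {1..14} h"
  define \<tau> where "\<tau> = inv_into {1..14} (of_nat :: nat \<Rightarrow> 14)"
  have \<sigma>: "\<sigma> (h j) = j" if "j \<in> {1..14}" for j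
    unfolding \<sigma>_def using inj that by (rule inv_into_f_f)
  have \<tau>: "\<tau> (of_nat j) = j" if "j \<in> {1..14}" for j
    unfolding \<tau>_def using bij_betw_of_nat_14 that by (simp add: bij_betw_def inv_into_f_f)
  have of_nat_\<tau>: "of_nat (\<tau> i) = i" "\<tau> i \<in> {1..14}" for i
    using bij_betw_of_nat_14 f_inv_into_f[of i of_nat "{1..14}"] inv_into_into[of i of_nat "{1..14}"]
    unfolding \<tau>_def bij_betw_def by simp_all
  have L: "?L t = (\<Sum>v\<in>h ` {1..14}. t $ of_nat (\<sigma> v) *\<^sub>R v)" for t
    by (subst sum.reindex[OF inj]) (simp add: \<sigma>)
  have "t = u" if "?L t = ?L u" for t u
  proof -
    have "?L (t - u) = 0"
      using that by (simp add: scaleR_diff_left sum_subtractf)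
    then have "(t - u) $ of_nat (\<sigma> v) = 0" if "v \<in> h ` {1..14}" for v
      using independentD[OF ind _ subset_refl, of "\<lambda>v. (t - u) $ of_nat (\<sigma> v)" v] that
      unfolding L by simp
    then have "(t - u) $ of_nat j = 0" if "j \<in> {1..14}" for j
      using \<sigma>[OF that] that by (metis imageI)
    then have "(t - u) $ i = 0" for i
      using of_nat_\<tau>[of i] by metis
    then show ?thesis by (simp add: vec_eq_iff)
  qed
  moreover have "range ?L = span (h ` {1..14})"
  proof
    show "range ?L \<subseteq> span (h ` {1..14})"
      by (auto intro!: span_sum span_scale intro: span_base)
    show "span (h ` {1..14}) \<subseteq> range ?L"
    proof
      fix x assume "x \<in> span (h ` {1..14})"
      then obtain c where x: "x = (\<Sum>v\<in>h ` {1..14}. c v *\<^sub>R v)"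
        by (auto simp: span_finite)
      also have "\<dots> = (\<Sum>j\<in>{1..14}. c (h j) *\<^sub>R h j)"
        by (subst sum.reindex[OF inj]) simp
      also have "\<dots> = ?L (\<chi> i. c (h (\<tau> i)))"
        by (intro sum.cong) (simp_all add: \<tau>)
      finally show "x \<in> range ?L" by blast
    qed
  qed
  ultimately show ?thesis by (auto simp: bij_betw_def inj_def)
qed

theorem proposition10p2:
  shows "closure Gamma_AS = G2 \<and>
    (\<forall>U\<in>g2. U \<noteq> 0 \<longrightarrow> span {w ** U ** matrix_inv w | w. w \<in> Gamma_AS} = g2) \<and>
    (\<exists>w :: nat \<Rightarrow> real ^ 7 ^ 7.
       (\<forall>j\<in>{1..14}. w j \<in> Gamma_AS) \<and>
       invertible_differential_at (conj_exp_prod w) G2 0)"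
proof (intro conjI ballI impI)
  show "closure Gamma_AS = G2" by (rule closure_Gamma)
  show "span {w ** U ** matrix_inv w | w. w \<in> Gamma_AS} = g2" if "U \<in> g2" "U \<noteq> 0" for U
    using that by (rule span_conjugates_eq_g2)
  obtain w :: "nat \<Rightarrow> real^7^7" where w: "\<And>j. j \<in> {1..14} \<Longrightarrow> w j \<in> Gamma_AS"
    and inj: "inj_on (\<lambda>j. w j ** X_mat ** matrix_inv (w j)) {1..14}"
    and ind: "independent ((\<lambda>j. w j ** X_mat ** matrix_inv (w j)) ` {1..14})"
    and span: "span ((\<lambda>j. w j ** X_mat ** matrix_inv (w j)) ` {1..14}) = g2"
    using exists_basis_of_conjugates[OF span_conjugates_eq_g2[OF X_mat_in_g2 X_mat_nonzero]]
    by blast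
  have wG2: "w j \<in> G2" if "j \<in> {1..14}" for j using w[OF that] Gamma_subset_G2 by blast
  have inv: "matrix_inv (w j) ** w j = mat 1" if "j \<in> set [1..<15]" for j
    using wG2[of j] that by (simp add: matrix_inv_G2 G2_transpose_mult)
  note F = conj_exp_foldr_has_derivative[of "[1..<15]" w X_mat, OF inv, folded conj_exp_prod_def]
  have set: "set [1..<15] = {1..14::nat}" by auto
  have "(conj_exp_prod w has_derivative
      (\<lambda>t. \<Sum>j\<in>{1..14}. t $ of_nat j *\<^sub>R (w j ** X_mat ** matrix_inv (w j)))) (at 0)"
    using F by (simp only: interv_sum_list_conv_sum_set_nat set)
  moreover have "range (conj_exp_prod w) \<subseteq> G2"
  proof -
    have "foldr (\<lambda>j P. (w j ** mat_exp ((t $ of_nat j) *\<^sub>R X_mat) ** matrix_inv (w j)) ** P) js (mat 1) \<in> G2"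
      if "set js \<subseteq> {1..14}" for js and t :: "real^14"
      using that by (induction js)
        (auto simp: wG2 matrix_inv_G2 intro!: G2_one G2_mult G2_transpose mat_exp_in_G2 X_mat_in_g2)
    then show ?thesis unfolding conj_exp_prod_def using set by blast
  qed
  \<comment> \<open>The tangent space in question is therefore the one at 1, which is
    \<open>g2\<close> and hence the span of the fourteen chosen conjugates.\<close>
  moreover have "conj_exp_prod w 0 = mat 1" using F by simp
  ultimately have "invertible_differential_at (conj_exp_prod w) G2 0"
    using bij_betw_linear_combination[OF inj ind]
    unfolding invertible_differential_at_def span by (auto simp: tangent_space_G2)
  then show "\<exists>w. (\<forall>j\<in>{1..14}. w j \<in> Gamma_AS) \<and> invertible_differential_at (conj_exp_prod w) G2 0"
    using w by blast
qed

end
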